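(* Let $X$ be a complex Banach space, let $p>0$ and let $(\mathcal{I},\|\cdot\|_{\mathcal{I}})$ be an $l_p$-ideal in $\mathcal{B}(X)$ with quasi-triangle constant $q_{\mathcal{I}}$ and eigenvalue constant $\gamma_p$. Then there exists a unique continuous function $\det_{p,\mathcal{I}}(I-\,\cdot\,):(\mathcal{I},\|\cdot\|_{\mathcal{I}})\to\mathbb{C}$ such that $$\det\nolimits_{p,\mathcal{I}}(I-F)=\det\nolimits_p(I-F)\quad\text{for all finite rank } F\in\mathcal{F}(X).$$ Moreover, for all $K,L\in\mathcal{I}$, $$|\det\nolimits_{p,\mathcal{I}}(I-L)|\le \exp\left(\gamma_p^p\,\Gamma_p\,\|L\|_{\mathcal{I}}^p\right)$$ and $$|\det\nolimits_{p,\mathcal{I}}(I-K)-\det\nolimits_{p,\mathcal{I}}(I-L)|\le \|K-L\|_{\mathcal{I}}\,\exp\left(q_{\mathcal{I}}^{2p}\,\gamma_p^p\,\Gamma_p\,(\|K\|_{\mathcal{I}}+\|L\|_{\mathcal{I}}+1)^p\right).$$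
   Context: $\mathcal{B}(X)$ denotes the bounded linear operators on $X$ with operator norm $\|\cdot\|$, $\mathcal{F}(X)$ the finite rank operators, $I$ the identity. Discrete eigenvalues: isolated points of the spectrum that are eigenvalues of finite algebraic multiplicity, the algebraic multiplicity being the rank of the associated Riesz projection. Quasi-norm: a map $\|\cdot\|_V:V\to[0,\infty)$ on a complex vector space with $\|x\|_V=0\iff x=0$, $\|\lambda x\|_V=|\lambda|\|x\|_V$, and $\|x+y\|_V\le q(\|x\|_V+\|y\|_V)$ for some $q\ge1$ (the quasi-triangle constant). $V$ carries the metrizable vector topology for which the sets $\{x:\|x\|_V\le 1/n\}$, $n\in\mathbb{N}$, form a fundamental system of neighbourhoods of $0$. $l_p$-ideal: a linear subspace $\mathcal{I}\subset\mathcal{B}(X)$ with a quasi-norm $\|\cdot\|_{\mathcal{I}}$ such that: (A1) $\mathcal{F}(X)\subset\mathcal{I}$ is dense in $(\mathcal{I},\|\cdot\|_{\mathcal{I}})$; (A2) $\|L\|\le\|L\|_{\mathcal{I}}$ for $L\in\mathcal{I}$; (A3) if $L\in\mathcal{I}$ and $A,B\in\mathcal{B}(X)$, then $ALB\in\mathcal{I}$ and $\|ALB\|_{\mathcal{I}}\le\|A\|\|L\|_{\mathcal{I}}\|B\|$; (A4) there is a constant $\gamma_p$ (the eigenvalue constant) with $\left(\sum_j|\lambda_j(L)|^p\right)^{1/p}\le\gamma_p\|L\|_{\mathcal{I}}$ for all $L\in\mathcal{I}$, where $(\lambda_j(L))$ are the discrete eigenvalues of $L$ counted with algebraic multiplicity.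 For $F\in\mathcal{F}(X)$ with range $R$ and restriction $F_R:R\to R$, $\det(I-F):=\det(I_R-F_R)$, $\operatorname{tr}(F):=\operatorname{tr}(F_R)$, and $\det_p(I-F):=\det(I-F)\exp\left(\sum_{k=1}^{\lceil p\rceil-1}\frac1k\operatorname{tr}(F^k)\right)$, where $\lceil p\rceil=\min\{n\in\mathbb{N}:n\ge p\}$ and an empty sum is $0$. $\Gamma_p>0$ is a constant such that $|\det_p(I-F)|\le\exp\left(\Gamma_p\sum_k|\lambda_k(F)|^p\right)$ for every $F\in\mathcal{F}(X)$ (discrete eigenvalues counted with algebraic multiplicity); it is a known fact that such a constant exists. *)

theory Defs
  imports "HOL-Analysis.Analysis" "Jordan_Normal_Form.Determinant"
begin

section \<open>Complex Banach spaces and their bounded operators\<close>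

class cbanach = banach +
  fixes scaleC :: "complex \<Rightarrow> 'a \<Rightarrow> 'a"  (infixr \<open>*\<^sub>C\<close> 75)
  assumes scaleC_add_right: "c *\<^sub>C (x + y) = c *\<^sub>C x + c *\<^sub>C y"
    and scaleC_add_left: "(c + d) *\<^sub>C x = c *\<^sub>C x + d *\<^sub>C x"
    and scaleC_scaleC: "c *\<^sub>C d *\<^sub>C x = (c * d) *\<^sub>C x"
    and scaleR_scaleC: "r *\<^sub>R x = complex_of_real r *\<^sub>C x"
    and norm_scaleC: "norm (c *\<^sub>C x) = cmod c * norm x"

lemma scaleC_one: "1 *\<^sub>C x = (x :: 'a::cbanach)"
  using scaleR_scaleC[of 1 x] by simp

interpretation complex_vs: vector_space "scaleC :: complex \<Rightarrow> 'a \<Rightarrow> 'a::cbanach"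
  by unfold_locales (simp_all add: scaleC_add_right scaleC_add_left scaleC_scaleC scaleC_one)

lemma bounded_linear_scaleC: "bounded_linear (scaleC c :: 'a \<Rightarrow> 'a::cbanach)"
proof (rule bounded_linear_intro[where K = "cmod c"])
  fix x y :: 'a and r :: real
  show "c *\<^sub>C (x + y) = c *\<^sub>C x + c *\<^sub>C y" by (rule scaleC_add_right)
  show "c *\<^sub>C r *\<^sub>R x = r *\<^sub>R c *\<^sub>C x"
    by (simp add: scaleR_scaleC scaleC_scaleC mult.commute)
  show "norm (c *\<^sub>C x) \<le> norm x * cmod c" by (simp add: norm_scaleC mult.commute)
qed

instantiation blinfun :: (real_normed_vector, cbanach) cbanach
begin

lift_definition scaleC_blinfun :: "complex \<Rightarrow> ('a \<Rightarrow>\<^sub>L 'b) \<Rightarrow> 'a \<Rightarrow>\<^sub>L 'b"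
  is "\<lambda>c A x. c *\<^sub>C A x"
  by (rule bounded_linear_compose[OF bounded_linear_scaleC])

instance
proof
  fix c d :: complex and r :: real and A B :: "'a \<Rightarrow>\<^sub>L 'b"
  show "c *\<^sub>C (A + B) = c *\<^sub>C A + c *\<^sub>C B"
    by transfer (simp add: scaleC_add_right)
  show "(c + d) *\<^sub>C A = c *\<^sub>C A + d *\<^sub>C A"
    by transfer (simp add: scaleC_add_left)
  show "c *\<^sub>C d *\<^sub>C A = (c * d) *\<^sub>C A"
    by transfer (simp add: scaleC_scaleC)
  show "r *\<^sub>R A = complex_of_real r *\<^sub>C A"
    by transfer (simp add: scaleR_scaleC)
  have le: "norm (e *\<^sub>C D) \<le> cmod e * norm D" for e and D :: "'a \<Rightarrow>\<^sub>L 'b"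
  proof (rule norm_blinfun_bound)
    show "norm ((e *\<^sub>C D) x) \<le> cmod e * norm D * norm x" for x
      by (simp add: scaleC_blinfun.rep_eq norm_scaleC mult.assoc mult_left_mono norm_blinfun)
  qed simp
  show "norm (c *\<^sub>C A) = cmod c * norm A"
  proof (cases "c = 0")
    case True
    then show ?thesis using le[of 0 A] by simp
  next
    case False
    have "inverse c *\<^sub>C c *\<^sub>C A = A"
      using False by transfer (simp add: scaleC_scaleC scaleC_one)
    then have "norm A \<le> inverse (cmod c) * norm (c *\<^sub>C A)"
      using le[of "inverse c" "c *\<^sub>C A"] by (simp add: norm_inverse)
    then have "cmod c * norm A \<le> norm (c *\<^sub>C A)"
      using False by (simp add: field_simps)
    then show ?thesis using le[of c A] by simp
  qed
qed

end

text \<open>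
  The type \<open>'a \<Rightarrow>\<^sub>L 'a\<close> consists of the real-linear bounded operators; \<open>\<B>(X)\<close> is the subset
  of the complex-linear ones. On it, \<open>norm\<close> is the usual operator norm.
\<close>

definition bounded_ops :: "('a::cbanach \<Rightarrow>\<^sub>L 'a) set" where
  "bounded_ops = {A. \<forall>c x. blinfun_apply A (c *\<^sub>C x) = c *\<^sub>C blinfun_apply A x}"

definition finite_rank_ops :: "('a::cbanach \<Rightarrow>\<^sub>L 'a) set" where
  "finite_rank_ops = {F \<in> bounded_ops. \<exists>B. finite B \<and> range (blinfun_apply F) = complex_vs.span B}"


section \<open>Discrete eigenvalues\<close>

definition is_resolvent_at :: "('a::cbanach \<Rightarrow>\<^sub>L 'a) \<Rightarrow> complex \<Rightarrow> ('a \<Rightarrow>\<^sub>L 'a) \<Rightarrow> bool" where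
  "is_resolvent_at L z R \<longleftrightarrow> R \<in> bounded_ops \<and>
     R o\<^sub>L (z *\<^sub>C id_blinfun - L) = id_blinfun \<and> (z *\<^sub>C id_blinfun - L) o\<^sub>L R = id_blinfun"

definition op_resolvent :: "('a::cbanach \<Rightarrow>\<^sub>L 'a) \<Rightarrow> complex \<Rightarrow> 'a \<Rightarrow>\<^sub>L 'a" where
  "op_resolvent L z = (THE R. is_resolvent_at L z R)"

definition op_spectrum :: "('a::cbanach \<Rightarrow>\<^sub>L 'a) \<Rightarrow> complex set" where
  "op_spectrum L = {z. \<nexists>R. is_resolvent_at L z R}"

text \<open>
  \<open>1/(2\<pi>i) \<integral> (z - L)\<^sup>-\<^sup>1 dz\<close> over the circle \<open>z = \<mu> + r e\<^bsup>it\<^esup>\<close>, as an operator-valued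
  Henstock-Kurzweil integral. For an isolated point of the spectrum the value does not depend on
  the admissible radius chosen below.
\<close>

definition circle_resolvent_integral ::
    "('a::cbanach \<Rightarrow>\<^sub>L 'a) \<Rightarrow> complex \<Rightarrow> real \<Rightarrow> 'a \<Rightarrow>\<^sub>L 'a" where
  "circle_resolvent_integral L \<mu> r =
     (1 / (2 * complex_of_real pi * \<i>)) *\<^sub>C
       integral {0..2 * pi} (\<lambda>t. (\<i> * complex_of_real r * cis t) *\<^sub>C
                                 op_resolvent L (\<mu> + complex_of_real r * cis t))"

definition riesz_projection :: "('a::cbanach \<Rightarrow>\<^sub>L 'a) \<Rightarrow> complex \<Rightarrow> 'a \<Rightarrow>\<^sub>L 'a" where
  "riesz_projection L \<mu> =
     circle_resolvent_integral L \<mu> (SOME r. 0 < r \<and> op_spectrum L \<inter> cball \<mu> r \<subseteq> {\<mu>})"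

definition alg_multiplicity :: "('a::cbanach \<Rightarrow>\<^sub>L 'a) \<Rightarrow> complex \<Rightarrow> nat" where
  "alg_multiplicity L \<mu> = complex_vs.dim (range (blinfun_apply (riesz_projection L \<mu>)))"

definition discrete_eigenvalues :: "('a::cbanach \<Rightarrow>\<^sub>L 'a) \<Rightarrow> complex set" where
  "discrete_eigenvalues L =
     {\<mu>. \<mu> isolated_in op_spectrum L \<and> (\<exists>x. x \<noteq> 0 \<and> blinfun_apply L x = \<mu> *\<^sub>C x) \<and>
         riesz_projection L \<mu> \<in> finite_rank_ops}"

text \<open>Counting with multiplicity: \<open>\<mu>\<close> contributes \<open>|\<mu>|\<^sup>p\<close> as often as its multiplicity says.\<close>

definition eigenvalue_term :: "real \<Rightarrow> ('a::cbanach \<Rightarrow>\<^sub>L 'a) \<Rightarrow> complex \<Rightarrow> real" where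
  "eigenvalue_term p L \<mu> = real (alg_multiplicity L \<mu>) * cmod \<mu> powr p"

definition eigenvalue_power_sum :: "real \<Rightarrow> ('a::cbanach \<Rightarrow>\<^sub>L 'a) \<Rightarrow> real" where
  "eigenvalue_power_sum p L = (\<Sum>\<^sub>\<infinity>\<mu>\<in>discrete_eigenvalues L. eigenvalue_term p L \<mu>)"


section \<open>Quasi-norms and ideals\<close>

definition quasi_norm_on ::
    "'v::cbanach set \<Rightarrow> ('v \<Rightarrow> real) \<Rightarrow> real \<Rightarrow> bool" where
  "quasi_norm_on V N q \<longleftrightarrow> 1 \<le> q \<and>
     (\<forall>x\<in>V. 0 \<le> N x) \<and>
     (\<forall>x\<in>V. N x = 0 \<longleftrightarrow> x = 0) \<and>
     (\<forall>c. \<forall>x\<in>V. N (c *\<^sub>C x) = cmod c * N x) \<and>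
     (\<forall>x\<in>V. \<forall>y\<in>V. N (x + y) \<le> q * (N x + N y))"

text \<open>
  Neighbourhoods of \<open>x\<close> are the translates of neighbourhoods of \<open>0\<close>; a set is open iff it is a
  neighbourhood of each of its points. Balls of a quasi-norm need not be open.
\<close>

definition quasi_norm_topology ::
    "'v::cbanach set \<Rightarrow> ('v \<Rightarrow> real) \<Rightarrow> 'v topology" where
  "quasi_norm_topology V N = topology (\<lambda>U. U \<subseteq> V \<and>
     (\<forall>x\<in>U. \<exists>n::nat. 0 < n \<and> {y \<in> V. N (y - x) \<le> 1 / real n} \<subseteq> U))"

lemma openin_quasi_norm_topology:
  "openin (quasi_norm_topology V N) U \<longleftrightarrow> U \<subseteq> V \<and>
     (\<forall>x\<in>U. \<exists>n::nat. 0 < n \<and> {y \<in> V. N (y - x) \<le> 1 / real n} \<subseteq> U)"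
proof -
  let ?P = "\<lambda>U. U \<subseteq> V \<and>
     (\<forall>x\<in>U. \<exists>n::nat. 0 < n \<and> {y \<in> V. N (y - x) \<le> 1 / real n} \<subseteq> U)"
  have "istopology ?P"
    unfolding istopology_def
  proof (intro conjI allI impI)
    fix S T assume S: "?P S" and T: "?P T"
    show "S \<inter> T \<subseteq> V" using S by blast
    show "\<forall>x\<in>S \<inter> T. \<exists>n::nat. 0 < n \<and> {y \<in> V. N (y - x) \<le> 1 / real n} \<subseteq> S \<inter> T"
    proof
      fix x assume x: "x \<in> S \<inter> T"
      obtain m n :: nat where m: "0 < m" "{y \<in> V. N (y - x) \<le> 1 / real m} \<subseteq> S"
        and n: "0 < n" "{y \<in> V. N (y - x) \<le> 1 / real n} \<subseteq> T"
        using S T x by blast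
      have "1 / real (max m n) \<le> 1 / real m" "1 / real (max m n) \<le> 1 / real n"
        using m(1) n(1) by (auto intro!: divide_left_mono)
      then have "{y \<in> V. N (y - x) \<le> 1 / real (max m n)} \<subseteq> S \<inter> T"
        using m(2) n(2) by fastforce
      then show "\<exists>n::nat. 0 < n \<and> {y \<in> V. N (y - x) \<le> 1 / real n} \<subseteq> S \<inter> T"
        using m(1) by (intro exI[of _ "max m n"]) auto
    qed
  next
    fix \<K> assume "\<forall>K\<in>\<K>. ?P K"
    then have K: "?P K" if "K \<in> \<K>" for K using that by blast
    then show "\<Union>\<K> \<subseteq> V" by blast
    show "\<forall>x\<in>\<Union>\<K>. \<exists>n::nat. 0 < n \<and> {y \<in> V. N (y - x) \<le> 1 / real n} \<subseteq> \<Union>\<K>"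
    proof
      fix x assume "x \<in> \<Union>\<K>"
      then obtain K where "K \<in> \<K>" "x \<in> K" by blast
      with K[of K] show "\<exists>n::nat. 0 < n \<and> {y \<in> V. N (y - x) \<le> 1 / real n} \<subseteq> \<Union>\<K>"
        by (meson Union_upper order_trans)
    qed
  qed
  then show ?thesis
    unfolding quasi_norm_topology_def by (simp add: topology_inverse')
qed

lemma topspace_quasi_norm_topology [simp]: "topspace (quasi_norm_topology V N) = V"
proof -
  have "openin (quasi_norm_topology V N) V"
    unfolding openin_quasi_norm_topology by (auto intro: exI[of _ 1])
  moreover have "topspace (quasi_norm_topology V N) \<subseteq> V"
    using openin_topspace openin_quasi_norm_topology by blast
  ultimately show ?thesis by (meson openin_subset subset_antisym)
qed

definition lp_ideal ::
    "real \<Rightarrow> real \<Rightarrow> real \<Rightarrow> ('a::cbanach \<Rightarrow>\<^sub>L 'a) set \<Rightarrow> (('a \<Rightarrow>\<^sub>L 'a) \<Rightarrow> real) \<Rightarrow> bool" where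
  "lp_ideal p q \<gamma> J N \<longleftrightarrow>
     J \<subseteq> bounded_ops \<and> complex_vs.subspace J \<and> quasi_norm_on J N q \<and>
     finite_rank_ops \<subseteq> J \<and> (quasi_norm_topology J N) closure_of finite_rank_ops = J \<and>
     (\<forall>L\<in>J. norm L \<le> N L) \<and>
     (\<forall>L\<in>J. \<forall>A\<in>bounded_ops. \<forall>B\<in>bounded_ops.
        A o\<^sub>L L o\<^sub>L B \<in> J \<and> N (A o\<^sub>L L o\<^sub>L B) \<le> norm A * N L * norm B) \<and>
     (\<forall>L\<in>J. eigenvalue_term p L summable_on discrete_eigenvalues L \<and>
        eigenvalue_power_sum p L powr (1 / p) \<le> \<gamma> * N L)"


section \<open>Determinants and traces of finite rank operators\<close>

text \<open>
  Given a basis \<open>bs\<close> of a \<open>T\<close>-invariant subspace: column \<open>j\<close> contains the coordinates of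
  \<open>T (bs ! j)\<close>. Determinant and trace below do not depend on the basis chosen for the range.
\<close>

definition matrix_wrt :: "'a::cbanach list \<Rightarrow> ('a \<Rightarrow> 'a) \<Rightarrow> complex mat" where
  "matrix_wrt bs T = mat (length bs) (length bs)
     (\<lambda>(i, j). complex_vs.representation (set bs) (T (bs ! j)) (bs ! i))"

definition range_basis :: "('a::cbanach \<Rightarrow> 'a) \<Rightarrow> 'a list" where
  "range_basis T = (SOME bs. distinct bs \<and> complex_vs.independent (set bs) \<and>
     complex_vs.span (set bs) = range T)"

definition range_matrix :: "('a::cbanach \<Rightarrow> 'a) \<Rightarrow> complex mat" where
  "range_matrix T = matrix_wrt (range_basis T) T"

definition det_one_minus :: "('a::cbanach \<Rightarrow> 'a) \<Rightarrow> complex" where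
  "det_one_minus T = Determinant.det (1\<^sub>m (dim_row (range_matrix T)) - range_matrix T)"

definition range_trace :: "('a::cbanach \<Rightarrow> 'a) \<Rightarrow> complex" where
  "range_trace T = (\<Sum>i<dim_row (range_matrix T). range_matrix T $$ (i, i))"

definition detp_one_minus :: "real \<Rightarrow> ('a::cbanach \<Rightarrow>\<^sub>L 'a) \<Rightarrow> complex" where
  "detp_one_minus p F = det_one_minus (blinfun_apply F) *
     exp (\<Sum>k = 1..nat \<lceil>p\<rceil> - 1. 1 / of_nat k * range_trace (blinfun_apply F ^^ k))"

text \<open>
  \<open>D L\<close> stands for the value \<open>det\<^sub>p(I - L)\<close> of the extension to the ideal \<open>J\<close>. Functions on \<open>J\<close>
  are represented by functions that are \<open>undefined\<close> outside \<open>J\<close>, which makes uniqueness meaningful.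
\<close>

definition is_regularized_det ::
    "real \<Rightarrow> ('a::cbanach \<Rightarrow>\<^sub>L 'a) set \<Rightarrow> (('a \<Rightarrow>\<^sub>L 'a) \<Rightarrow> real) \<Rightarrow> (('a \<Rightarrow>\<^sub>L 'a) \<Rightarrow> complex) \<Rightarrow> bool"
  where
  "is_regularized_det p J N D \<longleftrightarrow> D \<in> extensional J \<and>
     continuous_map (quasi_norm_topology J N) euclidean D \<and>
     (\<forall>F\<in>finite_rank_ops. D F = detp_one_minus p F)"

end

theory Submission
  imports Defs "Jordan_Normal_Form.Schur_Decomposition" "HOL-Complex_Analysis.Complex_Analysis"
begin

text \<open>
  Write \<open>det\<^sub>p(I - F)\<close> for the regularized determinant of a finite rank operator \<open>F\<close>, and \<open>k\<close> for
  \<open>\<lceil>p\<rceil> - 1\<close>. In a basis of any finite dimensional space containing the range of \<open>F\<close> it is a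
  determinant times the exponential of a polynomial in traces of powers, so it is entire along
  complex lines of finite rank operators. The assumption on \<open>\<Gamma>\<close> together with the eigenvalue
  inequality of the ideal gives \<open>|det\<^sub>p(I - F)| \<le> exp(\<gamma>\<^sup>p \<Gamma> N(F)\<^sup>p)\<close>, and Cauchy's estimate along the
  line from \<open>L\<close> to \<open>K\<close>, on circles of radius \<open>1 / N(K - L)\<close>, turns this growth into a Lipschitz bound
  (\<open>lipschitz_of_line_bound\<close>). Hence \<open>det\<^sub>p\<close> maps Cauchy sequences of finite rank operators to Cauchy
  sequences; as the finite rank operators are dense, it has exactly one continuous extension, called
  \<open>Dext\<close> below.

  The bound for \<open>Dext\<close> needs another idea. A quasi-norm need not be continuous: approximants
  \<open>F\<^sub>n\<close> of \<open>L\<close> only satisfy \<open>N(F\<^sub>n) \<le> q (N(L) + N(F\<^sub>n - L))\<close>, so passing to the limit would lose a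
  factor \<open>q\<^sup>p\<close> in the exponent. Instead \<open>Dext\<close> is bounded by the eigenvalues of \<open>L\<close> itself,
  \<open>|Dext L| \<le> exp(\<Gamma> \<Sum>|\<lambda>\<^sub>j(L)|\<^sup>p)\<close>, and the eigenvalue inequality is applied to \<open>L\<close> at the very end. To
  this end consider the entire function \<open>g(z) = Dext(z L)\<close>.

  \<^item> \<open>g(z) = 1 + O(z\<^sup>k\<^sup>+\<^sup>1)\<close> at \<open>0\<close>, because this holds uniformly for approximants (\<open>Dext_one_plus_O\<close>).

  \<^item> \<open>g\<close> grows more slowly than \<open>exp(\<epsilon> |z|\<^sup>k\<^sup>+\<^sup>1)\<close> for each \<open>\<epsilon> > 0\<close> (\<open>Dext_minimal_type\<close>): an approximant is a
  fixed operator \<open>F\<close> plus one of small quasi-norm, and in the direction \<open>F\<close> the determinant is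
  essentially a polynomial of degree at most the rank of \<open>F\<close>.

  \<^item> If \<open>g(a) = 0\<close>, then \<open>1 / a\<close> is a discrete eigenvalue of \<open>L\<close>, of algebraic multiplicity at least the
  order of the zero (\<open>zero_of_Dext_eigenvalue\<close>). This is analytic Fredholm theory, followed by
  splitting off the finite dimensional Riesz projection, along which \<open>Dext\<close> is multiplicative.

  \<^item> The Weierstrass factor \<open>E(u) = (1 - u) exp(u + \<dots> + u\<^sup>k / k)\<close> is \<open>det\<^sub>p(I - u Q)\<close> for a
  projection \<open>Q\<close> of rank one, whence \<open>|E(u)| \<le> exp(\<Gamma> |u|\<^sup>p)\<close> (\<open>weierstrass_factor_le_exp\<close>).

  The first two properties leave no room for an exponential factor in the Hadamard factorization of
  \<open>g\<close>, which is therefore \<open>g(z) = \<Prod> E(z / a)\<close> over its zeros; with the other two this bounds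
  \<open>g(1) = Dext L\<close> (\<open>entire_bound_by_zeros\<close>). A second application of Cauchy's estimate, now with this
  bound, yields the Lipschitz estimate for \<open>Dext\<close>.
\<close>

section \<open>Matrices of finite rank maps\<close>

definition clinear_map :: "('a::cbanach \<Rightarrow> 'b::cbanach) \<Rightarrow> bool" where
  "clinear_map f \<longleftrightarrow> (\<forall>x y. f (x + y) = f x + f y) \<and> (\<forall>c x. f (c *\<^sub>C x) = c *\<^sub>C f x)"

lemma clinear_map_add: "clinear_map f \<Longrightarrow> f (x + y) = f x + f y"
  by (simp add: clinear_map_def)

lemma clinear_map_scaleC: "clinear_map f \<Longrightarrow> f (c *\<^sub>C x) = c *\<^sub>C f x"
  by (simp add: clinear_map_def)

lemma clinear_map_zero: "clinear_map f \<Longrightarrow> f 0 = 0"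
  using clinear_map_scaleC[of f 0 0] by (simp add: complex_vs.scale_zero_left)

lemma clinear_map_sum: "clinear_map f \<Longrightarrow> f (\<Sum>i\<in>A. c i *\<^sub>C x i) = (\<Sum>i\<in>A. c i *\<^sub>C f (x i))"
  by (induction A rule: infinite_finite_induct)
    (simp_all add: clinear_map_zero clinear_map_add clinear_map_scaleC)

lemma clinear_map_funpow:
  fixes f :: "'a::cbanach \<Rightarrow> 'a"
  shows "clinear_map f \<Longrightarrow> clinear_map (f ^^ k)"
  by (induction k) (auto simp: clinear_map_def)

lemma clinear_map_bounded_ops: "A \<in> bounded_ops \<Longrightarrow> clinear_map (blinfun_apply A)"
  by (auto simp: bounded_ops_def clinear_map_def blinfun.add_right)

definition basis_list :: "'a::cbanach list \<Rightarrow> bool" where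
  "basis_list bs \<longleftrightarrow> distinct bs \<and> complex_vs.independent (set bs)"

definition coord :: "'a::cbanach list \<Rightarrow> nat \<Rightarrow> 'a \<Rightarrow> complex" where
  "coord bs i x = complex_vs.representation (set bs) x (bs ! i)"

abbreviation lspan :: "'a::cbanach list \<Rightarrow> 'a set" where
  "lspan bs \<equiv> complex_vs.span (set bs)"

lemma coord_expand:
  assumes "basis_list bs" "x \<in> lspan bs"
  shows "(\<Sum>i<length bs. coord bs i x *\<^sub>C bs ! i) = x"
proof -
  have "(\<Sum>i<length bs. coord bs i x *\<^sub>C bs ! i)
      = (\<Sum>b\<in>set bs. complex_vs.representation (set bs) x b *\<^sub>C b)"
    unfolding coord_def using assms(1)
    by (intro sum.reindex_bij_betw bij_betw_nth) (auto simp: basis_list_def)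
  also have "\<dots> = x"
    using assms by (intro complex_vs.sum_representation_eq) (auto simp: basis_list_def)
  finally show ?thesis .
qed

lemma coord_add:
  assumes "basis_list bs" "x \<in> lspan bs" "y \<in> lspan bs"
  shows "coord bs i (x + y) = coord bs i x + coord bs i y"
  using assms by (simp add: coord_def basis_list_def complex_vs.representation_add)

lemma coord_scale:
  assumes "basis_list bs" "x \<in> lspan bs"
  shows "coord bs i (c *\<^sub>C x) = c * coord bs i x"
  using assms by (simp add: coord_def basis_list_def complex_vs.representation_scale)

lemma coord_zero: "basis_list bs \<Longrightarrow> coord bs i 0 = 0"
  by (simp add: coord_def basis_list_def complex_vs.representation_zero)

lemma coord_sum:
  assumes "basis_list bs" "\<And>k. k \<in> A \<Longrightarrow> x k \<in> lspan bs"
  shows "coord bs i (\<Sum>k\<in>A. c k *\<^sub>C x k) = (\<Sum>k\<in>A. c k * coord bs i (x k))"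
  using assms(2)
proof (induction A rule: infinite_finite_induct)
  case (insert a A)
  have "c a *\<^sub>C x a \<in> lspan bs" "(\<Sum>k\<in>A. c k *\<^sub>C x k) \<in> lspan bs"
    using insert.prems by (auto intro!: complex_vs.span_scale complex_vs.span_sum)
  then show ?case
    using insert by (simp add: coord_add[OF assms(1)] coord_scale[OF assms(1)])
qed (simp_all add: coord_zero assms(1))

lemma coord_nth:
  assumes "basis_list bs" "i < length bs" "j < length bs"
  shows "coord bs i (bs ! j) = (if i = j then 1 else 0)"
  using assms
  by (auto simp: coord_def basis_list_def complex_vs.representation_basis nth_eq_iff_index_eq)

lemma dim_matrix_wrt [simp]:
  "dim_row (matrix_wrt bs T) = length bs" "dim_col (matrix_wrt bs T) = length bs"
  by (simp_all add: matrix_wrt_def)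

lemma matrix_wrt_carrier [simp]: "matrix_wrt bs T \<in> carrier_mat (length bs) (length bs)"
  by (simp add: carrier_matI)

lemma matrix_wrt_index:
  "i < length bs \<Longrightarrow> j < length bs \<Longrightarrow> matrix_wrt bs T $$ (i, j) = coord bs i (T (bs ! j))"
  by (simp add: matrix_wrt_def coord_def)

definition maps_span :: "'a::cbanach list \<Rightarrow> ('a \<Rightarrow> 'a) \<Rightarrow> bool" where
  "maps_span bs T \<longleftrightarrow> clinear_map T \<and> (\<forall>x\<in>lspan bs. T x \<in> lspan bs)"

lemma coord_apply:
  assumes "basis_list bs" "maps_span bs T" "x \<in> lspan bs"
  shows "coord bs i (T x) = (\<Sum>k<length bs. coord bs i (T (bs ! k)) * coord bs k x)"
proof -
  have "T x = T (\<Sum>k<length bs. coord bs k x *\<^sub>C bs ! k)"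
    using assms by (simp add: coord_expand)
  also have "\<dots> = (\<Sum>k<length bs. coord bs k x *\<^sub>C T (bs ! k))"
    using assms(2) unfolding maps_span_def by (intro clinear_map_sum) simp
  also have "coord bs i \<dots> = (\<Sum>k<length bs. coord bs k x * coord bs i (T (bs ! k)))"
    by (rule coord_sum[OF assms(1)]) (use assms(2) in \<open>auto simp: maps_span_def complex_vs.span_base\<close>)
  finally show ?thesis by (simp add: mult.commute)
qed

lemma matrix_wrt_comp:
  assumes "basis_list bs" "maps_span bs S" "maps_span bs T"
  shows "matrix_wrt bs (\<lambda>x. S (T x)) = matrix_wrt bs S * matrix_wrt bs T"
proof (rule eq_matI)
  fix i j assume ij: "i < dim_row (matrix_wrt bs S * matrix_wrt bs T)"
    "j < dim_col (matrix_wrt bs S * matrix_wrt bs T)"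
  have "T (bs ! j) \<in> lspan bs"
    using assms(3) ij by (simp add: maps_span_def complex_vs.span_base)
  from coord_apply[OF assms(1,2) this, of i]
  show "matrix_wrt bs (\<lambda>x. S (T x)) $$ (i, j) = (matrix_wrt bs S * matrix_wrt bs T) $$ (i, j)"
    using ij by (simp add: matrix_wrt_index scalar_prod_def lessThan_atLeast0)
qed simp_all

lemma matrix_wrt_id:
  assumes "basis_list bs" shows "matrix_wrt bs (\<lambda>x. x) = 1\<^sub>m (length bs)"
  by (rule eq_matI) (auto simp: matrix_wrt_index coord_nth assms)

lemma matrix_wrt_add:
  assumes "basis_list bs" "maps_span bs S" "maps_span bs T"
  shows "matrix_wrt bs (\<lambda>x. S x + T x) = matrix_wrt bs S + matrix_wrt bs T"
  using assms by (intro eq_matI)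
    (auto simp: matrix_wrt_index maps_span_def complex_vs.span_base intro!: coord_add)

lemma matrix_wrt_scale:
  assumes "basis_list bs" "maps_span bs T"
  shows "matrix_wrt bs (\<lambda>x. c *\<^sub>C T x) = c \<cdot>\<^sub>m matrix_wrt bs T"
  using assms by (intro eq_matI)
    (auto simp: matrix_wrt_index maps_span_def complex_vs.span_base intro!: coord_scale)

lemma maps_span_id: "maps_span bs (\<lambda>x. x)"
  by (simp add: maps_span_def clinear_map_def)

lemma maps_span_comp: "maps_span bs S \<Longrightarrow> maps_span bs T \<Longrightarrow> maps_span bs (\<lambda>x. S (T x))"
  by (simp add: maps_span_def clinear_map_def)

lemma maps_span_scale: "maps_span bs T \<Longrightarrow> maps_span bs (\<lambda>x. c *\<^sub>C T x)"
  by (auto simp: maps_span_def clinear_map_def scaleC_add_right complex_vs.span_scale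
      scaleC_scaleC mult.commute)

lemma maps_span_funpow: "maps_span bs T \<Longrightarrow> maps_span bs (T ^^ k)"
proof (induction k)
  case (Suc k)
  then show ?case using maps_span_comp[of bs T "T ^^ k"] by (simp add: comp_def)
qed (simp add: maps_span_id id_def)

lemma matrix_wrt_funpow:
  assumes "basis_list bs" "maps_span bs T"
  shows "matrix_wrt bs (T ^^ k) = matrix_wrt bs T ^\<^sub>m k"
proof (induction k)
  case 0
  then show ?case by (simp add: matrix_wrt_id[OF assms(1)] id_def)
next
  case (Suc k)
  have "matrix_wrt bs (T ^^ Suc k) = matrix_wrt bs (\<lambda>x. (T ^^ k) (T x))"
    unfolding funpow_Suc_right comp_def ..
  then show ?case
    using matrix_wrt_comp[OF assms(1) maps_span_funpow[OF assms(2), of k] assms(2)] Suc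
    by (simp del: funpow.simps)
qed

definition mat_trace :: "complex mat \<Rightarrow> complex" where
  "mat_trace M = (\<Sum>i<dim_row M. M $$ (i, i))"

lemma mat_trace_comm:
  assumes "A \<in> carrier_mat n m" "B \<in> carrier_mat m n"
  shows "mat_trace (A * B) = mat_trace (B * A)"
proof -
  have "mat_trace (A * B) = (\<Sum>i<n. \<Sum>k<m. A $$ (i, k) * B $$ (k, i))"
    using assms by (auto simp: mat_trace_def scalar_prod_def lessThan_atLeast0 intro!: sum.cong)
  also have "\<dots> = (\<Sum>k<m. \<Sum>i<n. A $$ (i, k) * B $$ (k, i))"
    by (rule sum.swap)
  also have "\<dots> = mat_trace (B * A)"
    using assms by (auto simp: mat_trace_def scalar_prod_def lessThan_atLeast0 mult.commute intro!: sum.cong)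
  finally show ?thesis .
qed

text \<open>
  Sylvester's identity. Eliminating in the block matrix with blocks \<open>1, A, B, 1\<close> once by rows and
  once by columns gives its determinant in two ways.
\<close>

lemma det_one_minus_mult_comm:
  fixes A B :: "complex mat"
  assumes A: "A \<in> carrier_mat n m" and B: "B \<in> carrier_mat m n"
  shows "Determinant.det (1\<^sub>m n - A * B) = Determinant.det (1\<^sub>m m - B * A)"
proof -
  let ?L = "four_block_mat (1\<^sub>m n) (0\<^sub>m n m) B (1\<^sub>m m)"
  let ?X = "four_block_mat (1\<^sub>m n) A (0\<^sub>m m n) (1\<^sub>m m - B * A)"
  let ?Y = "four_block_mat (1\<^sub>m n - A * B) A (0\<^sub>m m n) (1\<^sub>m m)"
  have AB: "A * B \<in> carrier_mat n n" "B * A \<in> carrier_mat m m" using A B by auto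
  have 1: "?L * ?X = four_block_mat (1\<^sub>m n) A B (1\<^sub>m m)"
  proof -
    have "B * A + (1\<^sub>m m - B * A) = 1\<^sub>m m"
      by (rule eq_matI) (use A B in \<open>auto\<close>)
    then show ?thesis
      using A B AB by (subst mult_four_block_mat[of _ n n _ m _ m _ _ n _ m]) auto
  qed
  have 2: "?Y * ?L = four_block_mat (1\<^sub>m n) A B (1\<^sub>m m)"
  proof -
    have "1\<^sub>m n - A * B + A * B = 1\<^sub>m n"
      by (rule eq_matI) (use A B in \<open>auto\<close>)
    then show ?thesis
      using A B AB by (subst mult_four_block_mat[of _ n n _ m _ m _ _ n _ m]) auto
  qed
  have L: "Determinant.det ?L = 1"
    using B by (subst det_four_block_mat_upper_right_zero[of _ n _ m]) auto
  have X: "Determinant.det ?X = Determinant.det (1\<^sub>m m - B * A)"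
    using A B AB by (subst det_four_block_mat_lower_left_zero[of _ n _ m]) auto
  have Y: "Determinant.det ?Y = Determinant.det (1\<^sub>m n - A * B)"
    using A B AB by (subst det_four_block_mat_lower_left_zero[of _ n _ m]) auto
  have c: "?L \<in> carrier_mat (n + m) (n + m)" "?X \<in> carrier_mat (n + m) (n + m)"
    "?Y \<in> carrier_mat (n + m) (n + m)" using A B AB by auto
  have "Determinant.det (?L * ?X) = Determinant.det (?Y * ?L)" using 1 2 by simp
  then show ?thesis
    using det_mult[OF c(1,2)] det_mult[OF c(3,1)] L X Y by simp
qed

text \<open>
  The matrices of \<open>T\<close> in a basis of its range and in a basis of a larger space are \<open>V U\<close> and \<open>U V\<close>:
  \<open>U\<close> describes the inclusion of the range, \<open>V\<close> the map \<open>T\<close> into its range. Hence determinants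
  \<open>det(1 - T)\<close> and traces may be computed in the larger space.
\<close>

lemma range_change_of_basis:
  assumes bs: "basis_list bs" and rb: "basis_list rb" and T: "clinear_map T"
    and sub: "range T \<subseteq> lspan bs" and rng: "lspan rb = range T"
  obtains U V where "U \<in> carrier_mat (length bs) (length rb)" "V \<in> carrier_mat (length rb) (length bs)"
    "matrix_wrt bs T = U * V" "matrix_wrt rb T = V * U"
proof -
  define U where "U = mat (length bs) (length rb) (\<lambda>(i, j). coord bs i (rb ! j))"
  define V where "V = mat (length rb) (length bs) (\<lambda>(i, j). coord rb i (T (bs ! j)))"
  have rb_bs: "rb ! j \<in> lspan bs" if "j < length rb" for j
    using sub rng that complex_vs.span_base[of "rb ! j" "set rb"] by auto
  have Trb: "T x \<in> lspan rb" for x using rng by auto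
  have "matrix_wrt bs T = U * V"
  proof (rule eq_matI)
    fix i j assume ij: "i < dim_row (U * V)" "j < dim_col (U * V)"
    have "coord bs i (T (bs ! j)) = coord bs i (\<Sum>k<length rb. coord rb k (T (bs ! j)) *\<^sub>C rb ! k)"
      using coord_expand[OF rb Trb] by simp
    also have "\<dots> = (\<Sum>k<length rb. coord rb k (T (bs ! j)) * coord bs i (rb ! k))"
      by (rule coord_sum[OF bs]) (use rb_bs in auto)
    finally show "matrix_wrt bs T $$ (i, j) = (U * V) $$ (i, j)"
      using ij by (simp add: U_def V_def matrix_wrt_index scalar_prod_def lessThan_atLeast0 mult.commute)
  qed (simp_all add: U_def V_def)
  moreover have "matrix_wrt rb T = V * U"
  proof (rule eq_matI)
    fix i j assume ij: "i < dim_row (V * U)" "j < dim_col (V * U)"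
    have j: "j < length rb" using ij by (simp add: U_def)
    have "coord rb i (T (rb ! j)) = coord rb i (T (\<Sum>k<length bs. coord bs k (rb ! j) *\<^sub>C bs ! k))"
      using coord_expand[OF bs rb_bs[OF j]] by simp
    also have "\<dots> = (\<Sum>k<length bs. coord bs k (rb ! j) * coord rb i (T (bs ! k)))"
      unfolding clinear_map_sum[OF T] by (rule coord_sum[OF rb]) (use Trb in auto)
    finally show "matrix_wrt rb T $$ (i, j) = (V * U) $$ (i, j)"
      using ij by (simp add: U_def V_def matrix_wrt_index scalar_prod_def lessThan_atLeast0 mult.commute)
  qed (simp_all add: U_def V_def)
  ultimately show ?thesis by (rule that[rotated 2]) (simp_all add: U_def V_def)
qed

text \<open>
  Extending a given list matters for the degree bound in \<open>det_line_polynomial\<close>, where the basis has to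
  start with a basis of the range of one operator.
\<close>

lemma exists_basis_list:
  assumes S: "complex_vs.subspace S" "S \<subseteq> complex_vs.span B" "finite B" and as: "basis_list as" "set as \<subseteq> S"
  obtains bs where "basis_list (as @ bs)" "lspan (as @ bs) = S"
proof -
  obtain C where C: "set as \<subseteq> C" "C \<subseteq> S" "complex_vs.independent C" "S \<subseteq> complex_vs.span C"
    using complex_vs.maximal_independent_subset_extend[of "set as" S] as
    by (auto simp: basis_list_def)
  have fin: "finite C"
    using complex_vs.independent_span_bound[OF S(3) C(3)] C(2) S(2) by blast
  obtain bs where bs: "set bs = C - set as" "distinct bs"
    using finite_distinct_list[of "C - set as"] fin by auto
  have "set (as @ bs) = C" using bs C by auto
  moreover have "complex_vs.span C = S"
    using C S(1) complex_vs.span_minimal by blast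
  ultimately show ?thesis
    using that[of bs] as bs C by (auto simp: basis_list_def)
qed

lemma range_basis_works:
  assumes T: "clinear_map T" and fin: "range T \<subseteq> complex_vs.span B" "finite B"
  shows "basis_list (range_basis T)" "lspan (range_basis T) = range T"
proof -
  have "complex_vs.subspace (range T)"
    unfolding complex_vs.subspace_def
  proof (intro conjI allI impI ballI)
    show "0 \<in> range T" using clinear_map_zero[OF T] rangeI[of T 0] by simp
    show "x + y \<in> range T" if "x \<in> range T" "y \<in> range T" for x y
      using that by (auto simp flip: clinear_map_add[OF T])
    show "c *\<^sub>C x \<in> range T" if "x \<in> range T" for c x
      using that by (auto simp flip: clinear_map_scaleC[OF T])
  qed
  then obtain bs where "basis_list ([] @ bs)" "lspan ([] @ bs) = range T"
    using fin by (rule exists_basis_list[where as = "[]"])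
      (auto simp: basis_list_def complex_vs.independent_empty)
  then have "\<exists>bs. distinct bs \<and> complex_vs.independent (set bs) \<and> lspan bs = range T"
    by (auto simp: basis_list_def)
  from someI_ex[OF this] show "basis_list (range_basis T)" "lspan (range_basis T) = range T"
    unfolding range_basis_def basis_list_def by auto
qed

lemma det_one_minus_basis:
  assumes bs: "basis_list bs" and T: "clinear_map T" and sub: "range T \<subseteq> lspan bs"
  shows "det_one_minus T = Determinant.det (1\<^sub>m (length bs) - matrix_wrt bs T)"
proof -
  note rb = range_basis_works[OF T sub finite_set]
  obtain U V where "U \<in> carrier_mat (length bs) (length (range_basis T))"
    "V \<in> carrier_mat (length (range_basis T)) (length bs)"
    "matrix_wrt bs T = U * V" "matrix_wrt (range_basis T) T = V * U"
    by (rule range_change_of_basis[OF bs rb(1) T sub rb(2)])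
  then show ?thesis
    using det_one_minus_mult_comm[of U "length bs" "length (range_basis T)" V]
    by (simp add: det_one_minus_def range_matrix_def)
qed

lemma range_trace_basis:
  assumes bs: "basis_list bs" and T: "clinear_map T" and sub: "range T \<subseteq> lspan bs"
  shows "range_trace T = mat_trace (matrix_wrt bs T)"
proof -
  note rb = range_basis_works[OF T sub finite_set]
  obtain U V where "U \<in> carrier_mat (length bs) (length (range_basis T))"
    "V \<in> carrier_mat (length (range_basis T)) (length bs)"
    "matrix_wrt bs T = U * V" "matrix_wrt (range_basis T) T = V * U"
    by (rule range_change_of_basis[OF bs rb(1) T sub rb(2)])
  then show ?thesis
    using mat_trace_comm[of U "length bs" "length (range_basis T)" V]
    by (simp add: range_trace_def range_matrix_def mat_trace_def)
qed

lemma upper_triangular_mult: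
  fixes A B :: "complex mat"
  assumes A: "A \<in> carrier_mat n n" "upper_triangular A" and B: "B \<in> carrier_mat n n" "upper_triangular B"
  shows "upper_triangular (A * B) \<and> (\<forall>i<n. (A * B) $$ (i, i) = A $$ (i, i) * B $$ (i, i))"
proof -
  have zero: "A $$ (i, k) * B $$ (k, j) = 0" if "i < n" "k < n" "j < n" "j \<le> i" "k \<noteq> i \<or> j < i" for i j k
    using that A B by (cases "k < i") (auto simp: upper_triangular_def)
  have entry: "(A * B) $$ (i, j) = (\<Sum>k<n. A $$ (i, k) * B $$ (k, j))" if "i < n" "j < n" for i j
    using that A B by (simp add: scalar_prod_def lessThan_atLeast0)
  have "(A * B) $$ (i, j) = 0" if "i < n" "j < i" for i j
    using that by (simp add: entry zero sum.neutral)
  moreover have "(A * B) $$ (i, i) = A $$ (i, i) * B $$ (i, i)" if "i < n" for i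
  proof -
    have "(\<Sum>k<n. A $$ (i, k) * B $$ (k, i)) = (\<Sum>k\<in>{i}. A $$ (i, k) * B $$ (k, i))"
      by (rule sum.mono_neutral_right) (use that zero[of i _ i] in auto)
    then show ?thesis using that by (simp add: entry)
  qed
  ultimately show ?thesis using A(1) by (auto simp: upper_triangular_def)
qed

lemma upper_triangular_power:
  fixes A :: "complex mat"
  assumes A: "A \<in> carrier_mat n n" "upper_triangular A"
  shows "upper_triangular (A ^\<^sub>m k) \<and> (\<forall>i<n. (A ^\<^sub>m k) $$ (i, i) = A $$ (i, i) ^ k)"
proof (induction k)
  case (Suc k)
  then show ?case
    using upper_triangular_mult[of "A ^\<^sub>m k" n A] A pow_carrier_mat[OF A(1), of k]
    by (simp add: mult.commute)
qed (use A in simp)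

text \<open>
  The numbers \<open>\<mu> i\<close> are the diagonal of a Schur form of \<open>M\<close>. Listing eigenvalues this way gives determinant
  and traces of powers simultaneously.
\<close>

lemma mat_eigenvalue_list:
  fixes M :: "complex mat"
  assumes M: "M \<in> carrier_mat n n"
  obtains \<mu> :: "nat \<Rightarrow> complex" where
    "\<And>z. Determinant.det (1\<^sub>m n - z \<cdot>\<^sub>m M) = (\<Prod>i<n. 1 - z * \<mu> i)"
    "\<And>k. mat_trace (M ^\<^sub>m k) = (\<Sum>i<n. \<mu> i ^ k)"
proof -
  obtain es where "char_poly M = (\<Prod>a\<leftarrow>es. [:- a, 1:])"
    using char_poly_factorized[OF M] by blast
  from schur_decomposition_exists[OF M this] obtain U where
    U: "U \<in> carrier_mat n n" "upper_triangular U" "similar_mat M U" by auto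
  obtain n' P Q where pq: "{M, U, P, Q} \<subseteq> carrier_mat n' n'" "P * Q = 1\<^sub>m n'" "Q * P = 1\<^sub>m n'"
    "M = P * U * Q"
    using similar_matD[OF U(3)] by blast
  have "n' = n" using pq(1) M by (auto dest!: carrier_matD)
  then have PQ: "P \<in> carrier_mat n n" "Q \<in> carrier_mat n n" "P * Q = 1\<^sub>m n" "Q * P = 1\<^sub>m n"
    "M = P * U * Q"
    using pq by auto
  have det: "Determinant.det (1\<^sub>m n - z \<cdot>\<^sub>m M) = (\<Prod>i<n. 1 - z * U $$ (i, i))" for z
  proof -
    have "1\<^sub>m n - z \<cdot>\<^sub>m M = 1\<^sub>m n - P * (z \<cdot>\<^sub>m U * Q)"
    proof -
      have "P * (z \<cdot>\<^sub>m U * Q) = P * (z \<cdot>\<^sub>m (U * Q))"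
        by (simp only: mult_smult_assoc_mat[OF U(1) PQ(2)])
      also have "\<dots> = z \<cdot>\<^sub>m (P * (U * Q))"
        by (rule mult_smult_distrib[OF PQ(1) mult_carrier_mat[OF U(1) PQ(2)]])
      also have "P * (U * Q) = M"
        by (simp only: PQ(5) assoc_mult_mat[OF PQ(1) U(1) PQ(2)])
      finally show ?thesis by simp
    qed
    also have "Determinant.det \<dots> = Determinant.det (1\<^sub>m n - z \<cdot>\<^sub>m U * Q * P)"
      using PQ U by (intro det_one_minus_mult_comm) auto
    also have "z \<cdot>\<^sub>m U * Q * P = z \<cdot>\<^sub>m U * (Q * P)"
      by (rule assoc_mult_mat) (use PQ U in auto)
    also have "\<dots> = z \<cdot>\<^sub>m U"
      unfolding PQ(4) by (rule right_mult_one_mat) (use U in auto)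
    also have "Determinant.det (1\<^sub>m n - z \<cdot>\<^sub>m U) = prod_list (diag_mat (1\<^sub>m n - z \<cdot>\<^sub>m U))"
      by (rule det_upper_triangular[of _ n]) (use U in \<open>auto simp: upper_triangular_def\<close>)
    also have "\<dots> = (\<Prod>i<n. 1 - z * U $$ (i, i))"
      using U by (simp add: diag_mat_def prod.list_conv_set_nth lessThan_atLeast0)
    finally show ?thesis .
  qed
  have tr: "mat_trace (M ^\<^sub>m k) = (\<Sum>i<n. U $$ (i, i) ^ k)" for k
  proof -
    have "similar_mat_wit M U P Q"
      using PQ M U by (auto simp: similar_mat_wit_def Let_def)
    from similar_mat_wit_pow[OF this, of k] have "M ^\<^sub>m k = P * U ^\<^sub>m k * Q"
      by (simp add: similar_mat_wit_def Let_def)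
    then have "mat_trace (M ^\<^sub>m k) = mat_trace (P * (U ^\<^sub>m k * Q))"
      using assoc_mult_mat[OF PQ(1) pow_carrier_mat[OF U(1)] PQ(2)] by simp
    also have "\<dots> = mat_trace (U ^\<^sub>m k * Q * P)"
      using PQ U by (intro mat_trace_comm) auto
    also have "U ^\<^sub>m k * Q * P = U ^\<^sub>m k * (Q * P)"
      by (rule assoc_mult_mat) (use PQ U in auto)
    also have "\<dots> = U ^\<^sub>m k"
      unfolding PQ(4) by (rule right_mult_one_mat) (use U in auto)
    also have "mat_trace (U ^\<^sub>m k) = (\<Sum>i<n. U $$ (i, i) ^ k)"
      using upper_triangular_power[OF U(1,2), of k] U(1) by (simp add: mat_trace_def)
    finally show ?thesis .
  qed
  show ?thesis using that[of "\<lambda>i. U $$ (i, i)"] det tr by blast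
qed

section \<open>Resolvents\<close>

lemma bounded_opsD: "A \<in> bounded_ops \<Longrightarrow> blinfun_apply A (c *\<^sub>C x) = c *\<^sub>C blinfun_apply A x"
  by (simp add: bounded_ops_def)

lemma bounded_ops_id [simp, intro]: "id_blinfun \<in> bounded_ops"
  by (simp add: bounded_ops_def)

lemma bounded_ops_zero [simp, intro]: "0 \<in> bounded_ops"
  by (simp add: bounded_ops_def)

lemma bounded_ops_add [simp, intro]: "A \<in> bounded_ops \<Longrightarrow> B \<in> bounded_ops \<Longrightarrow> A + B \<in> bounded_ops"
  by (simp add: bounded_ops_def blinfun.add_left scaleC_add_right)

lemma bounded_ops_diff [simp, intro]: "A \<in> bounded_ops \<Longrightarrow> B \<in> bounded_ops \<Longrightarrow> A - B \<in> bounded_ops"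
  by (simp add: bounded_ops_def blinfun.diff_left complex_vs.scale_right_diff_distrib)

lemma bounded_ops_scaleC [simp, intro]: "A \<in> bounded_ops \<Longrightarrow> c *\<^sub>C A \<in> bounded_ops"
  by (simp add: bounded_ops_def scaleC_blinfun.rep_eq scaleC_scaleC mult.commute)

lemma bounded_ops_compose [simp, intro]: "A \<in> bounded_ops \<Longrightarrow> B \<in> bounded_ops \<Longrightarrow> A o\<^sub>L B \<in> bounded_ops"
  by (simp add: bounded_ops_def)

lemma bounded_ops_sum: "(\<And>i. i \<in> I \<Longrightarrow> A i \<in> bounded_ops) \<Longrightarrow> (\<Sum>i\<in>I. A i) \<in> bounded_ops"
  by (induction I rule: infinite_finite_induct) auto

lemma scaleC_blinfun_apply [simp]: "blinfun_apply (c *\<^sub>C A) x = c *\<^sub>C blinfun_apply A x"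
  by (simp add: scaleC_blinfun.rep_eq)

lemma bounded_bilinear_scaleC: "bounded_bilinear (scaleC :: complex \<Rightarrow> 'a::cbanach \<Rightarrow> 'a)"
proof
  fix a a' :: complex and b b' :: 'a and r :: real
  show "(r *\<^sub>R a) *\<^sub>C b = r *\<^sub>R a *\<^sub>C b"
    by (simp add: scaleR_scaleC scaleC_scaleC scaleR_conv_of_real)
  show "a *\<^sub>C r *\<^sub>R b = r *\<^sub>R a *\<^sub>C b"
    by (simp add: scaleR_scaleC scaleC_scaleC mult.commute)
  show "\<exists>K. \<forall>a (b::'a). norm (a *\<^sub>C b) \<le> norm a * norm b * K"
    by (intro exI[of _ 1]) (simp add: norm_scaleC)
qed (simp_all add: scaleC_add_left scaleC_add_right)

lemma blinfun_compose_assoc: "(A o\<^sub>L B) o\<^sub>L C = A o\<^sub>L (B o\<^sub>L C)"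
  by (rule blinfun_eqI) simp

lemma inverse_in_bounded_ops:
  assumes "A \<in> bounded_ops" "V o\<^sub>L A = id_blinfun" "A o\<^sub>L V = id_blinfun"
  shows "V \<in> bounded_ops"
proof -
  have VA: "V (A x) = x" and AV: "A (V x) = x" for x
    using arg_cong[OF assms(2), of "\<lambda>T. blinfun_apply T x"] arg_cong[OF assms(3), of "\<lambda>T. blinfun_apply T x"]
    by simp_all
  have "V (c *\<^sub>C x) = c *\<^sub>C V x" for c x
  proof -
    have "V (c *\<^sub>C x) = V (c *\<^sub>C A (V x))" by (simp add: AV)
    also have "\<dots> = V (A (c *\<^sub>C V x))" by (simp add: bounded_opsD assms(1))
    finally show ?thesis by (simp add: VA)
  qed
  then show ?thesis by (simp add: bounded_ops_def)
qed

lemma neumann_inverse: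
  fixes S :: "'a::cbanach \<Rightarrow>\<^sub>L 'a"
  assumes S: "S \<in> bounded_ops" "norm S < 1"
  obtains V where "V \<in> bounded_ops" "V o\<^sub>L (id_blinfun - S) = id_blinfun" "(id_blinfun - S) o\<^sub>L V = id_blinfun"
proof -
  define Q where "Q k = ((o\<^sub>L) S ^^ k) id_blinfun" for k
  have Q0: "Q 0 = id_blinfun" and QS: "Q (Suc k) = S o\<^sub>L Q k" for k by (simp_all add: Q_def)
  have comm: "Q k o\<^sub>L S = S o\<^sub>L Q k" for k
  proof (induction k)
    case 0
    show ?case by (rule blinfun_eqI) (simp add: Q0)
  next
    case (Suc k)
    then show ?case unfolding QS by (simp add: blinfun_compose_assoc)
  qed
  have bd: "norm (Q k) \<le> norm S ^ k" for k
  proof (induction k)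
    case 0
    show ?case unfolding Q0 by (simp add: norm_blinfun_id_le)
  next
    case (Suc k)
    have "norm (Q (Suc k)) \<le> norm S * norm (Q k)" unfolding QS by (rule norm_blinfun_compose)
    also have "\<dots> \<le> norm S * norm S ^ k" using Suc by (intro mult_left_mono) auto
    finally show ?case by simp
  qed
  have sm: "summable Q"
    by (rule summable_comparison_test'[of "\<lambda>k. norm S ^ k" 0]) (use S bd in \<open>auto intro: summable_geometric\<close>)
  define V where "V = suminf Q"
  have shift: "suminf (\<lambda>k. Q (Suc k)) = V - id_blinfun"
    using suminf_split_head[OF sm] by (simp add: V_def Q0)
  have "S o\<^sub>L V = suminf (\<lambda>k. S o\<^sub>L Q k)"
    unfolding V_def
    by (rule bounded_linear.suminf[OF bounded_bilinear.bounded_linear_right[OF bounded_bilinear_blinfun_compose] sm])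
  then have SV: "S o\<^sub>L V = V - id_blinfun" using shift by (simp add: QS)
  have "V o\<^sub>L S = suminf (\<lambda>k. Q k o\<^sub>L S)"
    unfolding V_def
    by (rule bounded_linear.suminf[OF bounded_bilinear.bounded_linear_left[OF bounded_bilinear_blinfun_compose] sm])
  then have VS: "V o\<^sub>L S = V - id_blinfun" using shift by (simp add: comm QS)
  have "V (S x) = V x - x" "S (V x) = V x - x" for x
    using arg_cong[OF VS, of "\<lambda>A. blinfun_apply A x"] arg_cong[OF SV, of "\<lambda>A. blinfun_apply A x"]
    by (simp_all add: blinfun.diff_left)
  then have 1: "V o\<^sub>L (id_blinfun - S) = id_blinfun" "(id_blinfun - S) o\<^sub>L V = id_blinfun"
    by (auto intro!: blinfun_eqI simp: blinfun.diff_left blinfun.diff_right)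
  show ?thesis
    using that[OF inverse_in_bounded_ops[OF _ 1] 1] S by auto
qed

lemma resolvent_left:
  fixes L R :: "'a::cbanach \<Rightarrow>\<^sub>L 'a"
  assumes "is_resolvent_at L z R" shows "R (z *\<^sub>C x - L x) = x"
proof -
  have "(R o\<^sub>L (z *\<^sub>C id_blinfun - L)) x = x" using assms by (simp add: is_resolvent_at_def)
  then show ?thesis by (simp add: blinfun.diff_left)
qed

lemma resolvent_right:
  fixes L R :: "'a::cbanach \<Rightarrow>\<^sub>L 'a"
  assumes "is_resolvent_at L z R" shows "z *\<^sub>C R x - L (R x) = x"
proof -
  have "((z *\<^sub>C id_blinfun - L) o\<^sub>L R) x = x" using assms by (simp add: is_resolvent_at_def)
  then show ?thesis by (simp add: blinfun.diff_left)
qed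

lemma is_resolvent_unique:
  assumes "is_resolvent_at L z R" "is_resolvent_at L z R'" shows "R = R'"
proof (rule blinfun_eqI)
  fix x
  show "R x = R' x"
    using resolvent_left[OF assms(1), of "R' x"] resolvent_right[OF assms(2), of x] by simp
qed

lemma op_resolventI: "is_resolvent_at L z R \<Longrightarrow> op_resolvent L z = R"
  unfolding op_resolvent_def by (rule the_equality) (auto dest: is_resolvent_unique)

lemma op_resolvent_works: "z \<notin> op_spectrum L \<Longrightarrow> is_resolvent_at L z (op_resolvent L z)"
  using op_resolventI by (fastforce simp: op_spectrum_def)

lemma not_in_spectrumI: "is_resolvent_at L z R \<Longrightarrow> z \<notin> op_spectrum L"
  by (auto simp: op_spectrum_def)

lemma is_resolventI:
  fixes L R :: "'a::cbanach \<Rightarrow>\<^sub>L 'a"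
  assumes "R \<in> bounded_ops" "\<And>x. R (z *\<^sub>C x - L x) = x" "\<And>x. z *\<^sub>C R x - L (R x) = x"
  shows "is_resolvent_at L z R"
  using assms by (auto simp: is_resolvent_at_def blinfun.diff_left intro!: blinfun_eqI)

lemma resolvent_bounded_ops: "is_resolvent_at L z R \<Longrightarrow> R \<in> bounded_ops"
  by (simp add: is_resolvent_at_def)

lemma resolvent_commute:
  fixes L R :: "'a::cbanach \<Rightarrow>\<^sub>L 'a"
  assumes "L \<in> bounded_ops" "is_resolvent_at L z R" shows "L (R x) = R (L x)"
proof -
  have "L (R x) = z *\<^sub>C R x - x" using resolvent_right[OF assms(2), of x] by (simp add: algebra_simps)
  moreover have "R (L x) = z *\<^sub>C R x - x"
    using resolvent_left[OF assms(2), of x] bounded_opsD[OF resolvent_bounded_ops[OF assms(2)], of z x]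
    by (simp add: blinfun.diff_right algebra_simps)
  ultimately show ?thesis by simp
qed

lemma resolvent_outside:
  assumes L: "L \<in> bounded_ops" and z: "norm z > norm L"
  shows "z \<notin> op_spectrum L"
proof -
  have z0: "z \<noteq> 0" using z by auto
  have "norm (inverse z *\<^sub>C L) < 1"
  proof -
    have "norm (inverse z *\<^sub>C L) = norm L / norm z"
      by (simp add: norm_scaleC norm_inverse divide_inverse mult.commute)
    then show ?thesis using z z0 by (simp add: divide_less_eq_1)
  qed
  then obtain V where V: "V \<in> bounded_ops" "V o\<^sub>L (id_blinfun - inverse z *\<^sub>C L) = id_blinfun"
    "(id_blinfun - inverse z *\<^sub>C L) o\<^sub>L V = id_blinfun"
    using neumann_inverse[of "inverse z *\<^sub>C L"] L by auto
  have 1: "V (x - inverse z *\<^sub>C L x) = x" for x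
    using arg_cong[OF V(2), of "\<lambda>A. blinfun_apply A x"] by (simp add: blinfun.diff_left)
  have 2: "V x - inverse z *\<^sub>C L (V x) = x" for x
    using arg_cong[OF V(3), of "\<lambda>A. blinfun_apply A x"] by (simp add: blinfun.diff_left)
  have "is_resolvent_at L z (inverse z *\<^sub>C V)"
  proof (rule is_resolventI)
    fix x
    have "inverse z *\<^sub>C V (z *\<^sub>C x - L x) = V (inverse z *\<^sub>C (z *\<^sub>C x - L x))"
      by (simp add: bounded_opsD[OF V(1)])
    also have "inverse z *\<^sub>C (z *\<^sub>C x - L x) = x - inverse z *\<^sub>C L x"
      using z0 by (simp add: complex_vs.scale_right_diff_distrib scaleC_scaleC scaleC_one)
    finally show "(inverse z *\<^sub>C V) (z *\<^sub>C x - L x) = x" using 1 by simp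
    show "z *\<^sub>C (inverse z *\<^sub>C V) x - L ((inverse z *\<^sub>C V) x) = x"
      using 2[of x] z0 L by (simp add: scaleC_scaleC scaleC_one bounded_opsD)
  qed (use V in auto)
  then show ?thesis by (rule not_in_spectrumI)
qed

lemma resolvent_identity:
  assumes "is_resolvent_at L z R" "is_resolvent_at L w S"
  shows "S - R = (z - w) *\<^sub>C (R o\<^sub>L S)"
proof (rule blinfun_eqI)
  fix x
  have "S x - R x = R (z *\<^sub>C S x - L (S x)) - R (w *\<^sub>C S x - L (S x))"
    using resolvent_left[OF assms(1), of "S x"] resolvent_right[OF assms(2), of x] by simp
  also have "\<dots> = R (z *\<^sub>C S x - w *\<^sub>C S x)"
    by (simp flip: blinfun.diff_right)
  also have "\<dots> = (z - w) *\<^sub>C R (S x)"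
    using bounded_opsD[OF resolvent_bounded_ops[OF assms(1)]]
    by (simp flip: complex_vs.scale_left_diff_distrib)
  finally show "(S - R) x = ((z - w) *\<^sub>C (R o\<^sub>L S)) x" by (simp add: blinfun.diff_left)
qed

lemma resolvent_open:
  assumes L: "L \<in> bounded_ops" and R: "is_resolvent_at L z R" and w: "norm (w - z) * norm R < 1"
  shows "w \<notin> op_spectrum L"
proof -
  note Rb = resolvent_bounded_ops[OF R]
  have "norm ((z - w) *\<^sub>C R) < 1" using w by (simp add: norm_scaleC norm_minus_commute)
  then obtain V where V: "V \<in> bounded_ops" "V o\<^sub>L (id_blinfun - (z - w) *\<^sub>C R) = id_blinfun"
    "(id_blinfun - (z - w) *\<^sub>C R) o\<^sub>L V = id_blinfun"
    using neumann_inverse[of "(z - w) *\<^sub>C R"] Rb by auto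
  have 1: "V (x - (z - w) *\<^sub>C R x) = x" for x
    using arg_cong[OF V(2), of "\<lambda>A. blinfun_apply A x"] by (simp add: blinfun.diff_left)
  have 2: "V x - (z - w) *\<^sub>C R (V x) = x" for x
    using arg_cong[OF V(3), of "\<lambda>A. blinfun_apply A x"] by (simp add: blinfun.diff_left)
  have split: "w *\<^sub>C x - L x = (z *\<^sub>C x - L x) - (z - w) *\<^sub>C x" for x
    by (simp add: complex_vs.scale_left_diff_distrib)
  have "is_resolvent_at L w (V o\<^sub>L R)"
  proof (rule is_resolventI)
    fix x
    have "R (w *\<^sub>C x - L x) = x - (z - w) *\<^sub>C R x"
      unfolding split by (simp add: blinfun.diff_right[of R "z *\<^sub>C x - L x"] resolvent_left[OF R] bounded_opsD[OF Rb])
    then show "(V o\<^sub>L R) (w *\<^sub>C x - L x) = x" using 1 by simp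
    have comm: "V (R x) = R (V x)"
    proof -
      have "R x = R (V x - (z - w) *\<^sub>C R (V x))" using 2[of x] by simp
      also have "\<dots> = R (V x) - (z - w) *\<^sub>C R (R (V x))" by (simp add: blinfun.diff_right bounded_opsD[OF Rb])
      finally show ?thesis using 1[of "R (V x)"] by simp
    qed
    have "w *\<^sub>C R (V x) - L (R (V x)) = (z *\<^sub>C R (V x) - L (R (V x))) - (z - w) *\<^sub>C R (V x)"
      by (rule split)
    also have "\<dots> = x" using resolvent_right[OF R, of "V x"] 2[of x] by simp
    finally show "w *\<^sub>C (V o\<^sub>L R) x - L ((V o\<^sub>L R) x) = x" by (simp add: comm)
  qed (use V Rb in auto)
  then show ?thesis by (rule not_in_spectrumI)
qed

lemma resolvent_open_ball:
  assumes L: "L \<in> bounded_ops" and z: "z \<notin> op_spectrum L"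
  obtains d where "d > 0" "\<And>w. norm (w - z) < d \<Longrightarrow> w \<notin> op_spectrum L"
proof (rule that[of "1 / (norm (op_resolvent L z) + 1)"])
  show "1 / (norm (op_resolvent L z) + 1) > 0" by (simp add: add_nonneg_pos)
  fix w assume w: "norm (w - z) < 1 / (norm (op_resolvent L z) + 1)"
  have "norm (w - z) * (norm (op_resolvent L z) + 1) < 1"
  proof -
    have "norm (op_resolvent L z) + 1 > 0" by (simp add: add_nonneg_pos)
    then show ?thesis using w by (simp only: pos_less_divide_eq)
  qed
  then have "norm (w - z) * norm (op_resolvent L z) < 1"
    by (smt (verit) mult_left_mono norm_ge_zero)
  then show "w \<notin> op_spectrum L" by (rule resolvent_open[OF L op_resolvent_works[OF z]])
qed

lemma resolvent_isCont:
  assumes L: "L \<in> bounded_ops" and z: "z \<notin> op_spectrum L"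
  shows "isCont (op_resolvent L) z"
proof -
  let ?R = "op_resolvent L"
  obtain d where d: "d > 0" "\<And>w. norm (w - z) < d \<Longrightarrow> w \<notin> op_spectrum L"
    using resolvent_open_ball[OF L z] by blast
  define M where "M = norm (?R z) + 1"
  have M: "M > 0" by (simp add: M_def add_nonneg_pos)
  have est: "norm (?R w - ?R z) \<le> 2 * M * M * norm (w - z)" if w: "norm (w - z) < d" "norm (w - z) < 1 / (2 * M)" for w
  proof -
    have id: "?R w - ?R z = (z - w) *\<^sub>C (?R z o\<^sub>L ?R w)"
      by (rule resolvent_identity) (use z d(2)[OF w(1)] in \<open>auto intro: op_resolvent_works\<close>)
    have 1: "norm (?R w - ?R z) \<le> norm (w - z) * (norm (?R z) * norm (?R w))"
      unfolding id norm_scaleC norm_minus_commute[of z w] by (intro mult_left_mono norm_blinfun_compose) auto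
    also have "\<dots> \<le> norm (w - z) * (M * norm (?R w))"
      by (intro mult_left_mono mult_right_mono) (auto simp: M_def)
    finally have 2: "norm (?R w - ?R z) \<le> norm (w - z) * (M * norm (?R w))" .
    have "norm (?R w) \<le> norm (?R z) + norm (?R w - ?R z)" by (metis add.commute diff_add_cancel norm_triangle_ineq)
    also have "\<dots> \<le> M + (norm (w - z) * M) * norm (?R w)" using 2 by (simp add: M_def mult.assoc)
    also have "norm (w - z) * M \<le> 1 / 2" using w(2) M by (simp add: field_simps)
    then have "(norm (w - z) * M) * norm (?R w) \<le> 1/2 * norm (?R w)" by (intro mult_right_mono) auto
    finally have "norm (?R w) \<le> 2 * M" by simp
    then have "norm (w - z) * (M * norm (?R w)) \<le> norm (w - z) * (M * (2 * M))"
      using M by (intro mult_left_mono) auto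
    then show ?thesis using 2 by (simp add: mult_ac)
  qed
  have "((\<lambda>w. 2 * M * M * norm (w - z)) \<longlongrightarrow> 0) (at z)"
    by (auto intro!: tendsto_eq_intros)
  moreover have "eventually (\<lambda>w. norm (?R w - ?R z) \<le> 2 * M * M * norm (w - z)) (at z)"
  proof -
    have "eventually (\<lambda>w. w \<in> ball z (min d (1 / (2 * M)))) (at z)"
      using d(1) M by (intro eventually_at_in_open') auto
    then show ?thesis by eventually_elim (use est in \<open>auto simp: dist_norm norm_minus_commute\<close>)
  qed
  ultimately have "((\<lambda>w. ?R w - ?R z) \<longlongrightarrow> 0) (at z)"
    by (rule Lim_null_comparison[rotated])
  then show ?thesis by (simp add: isCont_def LIM_zero_iff)
qed

text \<open>
  Complex differentiability of the resolvent, expressed by a real derivative that is multiplication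
  by the complex scalar \<open>h\<close>. It follows from the resolvent identity and continuity.
\<close>

lemma resolvent_has_derivative:
  assumes L: "L \<in> bounded_ops" and z: "z \<notin> op_spectrum L"
  shows "(op_resolvent L has_derivative (\<lambda>h. h *\<^sub>C (- (op_resolvent L z o\<^sub>L op_resolvent L z)))) (at z)"
proof -
  let ?R = "op_resolvent L"
  obtain d where d: "d > 0" "\<And>w. norm (w - z) < d \<Longrightarrow> w \<notin> op_spectrum L"
    using resolvent_open_ball[OF L z] by blast
  have bl: "bounded_linear (\<lambda>h. h *\<^sub>C (- (?R z o\<^sub>L ?R z)))"
    by (rule bounded_bilinear.bounded_linear_left[OF bounded_bilinear_scaleC])
  have "((\<lambda>w. norm (?R z o\<^sub>L (?R z - ?R w))) \<longlongrightarrow> norm (?R z o\<^sub>L (?R z - ?R z))) (at z)"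
    by (intro tendsto_intros bounded_bilinear.tendsto[OF bounded_bilinear_blinfun_compose])
      (use resolvent_isCont[OF L z] in \<open>auto simp: isCont_def\<close>)
  then have lim: "((\<lambda>w. norm (?R z o\<^sub>L (?R z - ?R w))) \<longlongrightarrow> 0) (at z)" by simp
  have "eventually (\<lambda>w. norm (?R w - ?R z - (w - z) *\<^sub>C (- (?R z o\<^sub>L ?R z))) / norm (w - z)
      = norm (?R z o\<^sub>L (?R z - ?R w))) (at z)"
  proof -
    have "eventually (\<lambda>w. w \<in> ball z d - {z}) (at z)"
      using d(1) by (intro eventually_at_in_open) auto
    then show ?thesis
    proof eventually_elim
      case (elim w)
      then have "norm (w - z) < d" by (auto simp: dist_norm norm_minus_commute)
      then have id: "?R w - ?R z = (z - w) *\<^sub>C (?R z o\<^sub>L ?R w)"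
        by (intro resolvent_identity) (use z d(2) in \<open>auto intro: op_resolvent_works\<close>)
      have "?R w - ?R z - (w - z) *\<^sub>C (- (?R z o\<^sub>L ?R z)) = (w - z) *\<^sub>C (?R z o\<^sub>L (?R z - ?R w))"
      proof -
        have "(z - w) *\<^sub>C (?R z o\<^sub>L ?R w) - (w - z) *\<^sub>C (- (?R z o\<^sub>L ?R z))
            = (w - z) *\<^sub>C (?R z o\<^sub>L ?R z) - (w - z) *\<^sub>C (?R z o\<^sub>L ?R w)"
          using complex_vs.scale_minus_left[of "w - z" "?R z o\<^sub>L ?R w"]
          by (simp add: complex_vs.scale_minus_right)
        then show ?thesis unfolding id
          by (simp add: bounded_bilinear.diff_right[OF bounded_bilinear_blinfun_compose]
              complex_vs.scale_right_diff_distrib)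
      qed
      then show ?case using elim by (simp add: norm_scaleC)
    qed
  qed
  then have "((\<lambda>w. norm (?R w - ?R z - (w - z) *\<^sub>C (- (?R z o\<^sub>L ?R z))) / norm (w - z)) \<longlongrightarrow> 0) (at z)"
    using lim by (simp add: tendsto_cong)
  then show ?thesis
    unfolding has_derivative_iff_norm using bl by simp
qed

definition circle_integral :: "(complex \<Rightarrow> 'b::cbanach) \<Rightarrow> complex \<Rightarrow> real \<Rightarrow> 'b" where
  "circle_integral f \<mu> r = integral {0..2 * pi} (\<lambda>t. (\<i> * of_real r * cis t) *\<^sub>C f (\<mu> + of_real r * cis t))"

lemma continuous_on_cis [continuous_intros]:
  "continuous_on A f \<Longrightarrow> continuous_on A (\<lambda>x. cis (f x))"
  by (simp add: cis_conv_exp continuous_intros)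

lemma continuous_on_annulus_param:
  fixes h :: "complex \<Rightarrow> 'b::topological_space" and a b :: "'c::topological_space \<Rightarrow> real"
  assumes h: "continuous_on (cball \<mu> r - {\<mu>}) h" and ab: "continuous_on A a" "continuous_on A b"
    and s: "0 < s" "\<And>x. x \<in> A \<Longrightarrow> a x \<in> {s..r}"
  shows "continuous_on A (\<lambda>x. h (\<mu> + of_real (a x) * cis (b x)))"
proof (rule continuous_on_compose2[OF h])
  show "continuous_on A (\<lambda>x. \<mu> + of_real (a x) * cis (b x))" by (intro continuous_intros ab)
  show "(\<lambda>x. \<mu> + of_real (a x) * cis (b x)) ` A \<subseteq> cball \<mu> r - {\<mu>}"
  proof clarify
    fix x assume "x \<in> A"
    then have "s \<le> a x" "a x \<le> r" using s(2)[of x] by auto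
    then show "\<mu> + of_real (a x) * cis (b x) \<in> cball \<mu> r - {\<mu>}"
      using s(1) by (auto simp: dist_norm norm_mult)
  qed
qed

text \<open>
  Cauchy's theorem on an annulus for vector valued functions. Differentiating under the integral
  with respect to the radius, the integrand becomes the derivative with respect to the angle of
  \<open>t \<mapsto> e\<^sup>i\<^sup>t f(\<mu> + \<rho> e\<^sup>i\<^sup>t)\<close>, which is periodic, so the integral does not depend on the radius.
\<close>

lemma circle_integral_const_radius:
  fixes f f' :: "complex \<Rightarrow> 'b::cbanach"
  assumes der: "\<And>z. z \<in> cball \<mu> r - {\<mu>} \<Longrightarrow> (f has_derivative (\<lambda>h. h *\<^sub>C f' z)) (at z)"
    and cont: "continuous_on (cball \<mu> r - {\<mu>}) f'" and s: "0 < s" "s \<le> r"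
  shows "circle_integral f \<mu> s = circle_integral f \<mu> r"
proof -
  note bs = bounded_bilinear.continuous_on[OF bounded_bilinear_scaleC]
  define D where "D = (\<lambda>\<rho> t. (\<i> * cis t) *\<^sub>C f (\<mu> + of_real \<rho> * cis t)
      + (\<i> * of_real \<rho> * cis t) *\<^sub>C cis t *\<^sub>C f' (\<mu> + of_real \<rho> * cis t))"
  have contf: "continuous_on (cball \<mu> r - {\<mu>}) f"
    by (rule has_derivative_continuous_on) (use der has_derivative_at_withinI in blast)
  have mem: "\<mu> + of_real \<rho> * cis t \<in> cball \<mu> r - {\<mu>}" if "\<rho> \<in> {s..r}" for \<rho> t
    using that s by (auto simp: dist_norm norm_mult)
  have dist: "((\<lambda>\<rho>. (\<i> * of_real \<rho> * cis t) *\<^sub>C f (\<mu> + of_real \<rho> * cis t)) has_vector_derivative D \<rho> t) (at \<rho> within {s..r})"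
    if "\<rho> \<in> {s..r}" for \<rho> t
  proof -
    have 1: "((\<lambda>\<rho>. \<i> * of_real \<rho> * cis t) has_vector_derivative \<i> * cis t) (at \<rho> within {s..r})"
      by (auto intro!: derivative_eq_intros simp: has_vector_derivative_def scaleR_conv_of_real)
    have i: "((\<lambda>\<rho>. \<mu> + of_real \<rho> * cis t) has_derivative (\<lambda>h. of_real h * cis t)) (at \<rho> within {s..r})"
      by (auto intro!: derivative_eq_intros)
    have 2: "((\<lambda>\<rho>. f (\<mu> + of_real \<rho> * cis t)) has_vector_derivative cis t *\<^sub>C f' (\<mu> + of_real \<rho> * cis t)) (at \<rho> within {s..r})"
      using has_derivative_compose[OF i der[OF mem[OF that]]]
      by (simp add: has_vector_derivative_def scaleR_scaleC scaleC_scaleC)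
    show ?thesis
      using bounded_bilinear.has_vector_derivative[OF bounded_bilinear_scaleC 1 2] by (simp add: D_def add.commute)
  qed
  note compc = continuous_on_annulus_param[OF _ _ _ s(1)]
  have contD: "continuous_on ({s..r} \<times> cbox 0 (2 * pi)) (\<lambda>(\<rho>, t). D \<rho> t)"
  proof -
    let ?S = "{s..r} \<times> cbox 0 (2 * pi)"
    have "continuous_on ?S (\<lambda>x. f (\<mu> + of_real (fst x) * cis (snd x)))"
      by (rule compc[OF contf continuous_on_fst[OF continuous_on_id] continuous_on_snd[OF continuous_on_id]]) auto
    moreover have "continuous_on ?S (\<lambda>x. f' (\<mu> + of_real (fst x) * cis (snd x)))"
      by (rule compc[OF cont continuous_on_fst[OF continuous_on_id] continuous_on_snd[OF continuous_on_id]]) auto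
    moreover have c: "continuous_on ?S (\<lambda>x. cis (snd x))"
      by (intro continuous_on_cis continuous_on_snd continuous_on_id)
    moreover have "continuous_on ?S (\<lambda>x. \<i> * cis (snd x))"
      by (intro continuous_on_mult c continuous_on_const)
    moreover have "continuous_on ?S (\<lambda>x. \<i> * of_real (fst x) * cis (snd x))"
      by (intro continuous_on_mult c continuous_on_const continuous_on_of_real continuous_on_fst continuous_on_id)
    ultimately show ?thesis
      unfolding D_def split_beta by (safe intro!: continuous_on_add bs)
  qed
  have zero: "integral (cbox 0 (2 * pi)) (D \<rho>) = 0" if \<rho>: "\<rho> \<in> {s..r}" for \<rho>
  proof -
    have "(D \<rho> has_integral (cis (2 * pi) *\<^sub>C f (\<mu> + of_real \<rho> * cis (2 * pi)) - cis 0 *\<^sub>C f (\<mu> + of_real \<rho> * cis 0))) {0..2 * pi}"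
    proof (rule fundamental_theorem_of_calculus)
      fix t assume "t \<in> {0..2 * pi}"
      have 1: "(cis has_vector_derivative \<i> * cis t) (at t within {0..2*pi})"
        by (auto intro!: derivative_eq_intros simp: has_vector_derivative_def cis_conv_exp scaleR_conv_of_real)
      have i: "((\<lambda>t. \<mu> + of_real \<rho> * cis t) has_derivative (\<lambda>h. of_real h * (\<i> * of_real \<rho> * cis t))) (at t within {0..2*pi})"
      proof -
        have "(cis has_derivative (\<lambda>h. of_real h * (\<i> * cis t))) (at t within {0..2*pi})"
          using 1 by (simp add: has_vector_derivative_def scaleR_conv_of_real)
        from has_derivative_add[OF has_derivative_const[of \<mu>] has_derivative_mult_right[OF this, of "of_real \<rho>"]]
        show ?thesis by (simp add: mult_ac)
      qed
      have 2: "((\<lambda>t. f (\<mu> + of_real \<rho> * cis t)) has_vector_derivative (\<i> * of_real \<rho> * cis t) *\<^sub>C f' (\<mu> + of_real \<rho> * cis t)) (at t within {0..2*pi})"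
        using has_derivative_compose[OF i der[OF mem[OF \<rho>]]]
        by (simp add: has_vector_derivative_def scaleR_scaleC scaleC_scaleC)
      show "((\<lambda>t. cis t *\<^sub>C f (\<mu> + of_real \<rho> * cis t)) has_vector_derivative D \<rho> t) (at t within {0..2*pi})"
        using bounded_bilinear.has_vector_derivative[OF bounded_bilinear_scaleC 1 2]
        by (simp add: D_def add.commute scaleC_scaleC mult_ac)
    qed auto
    then show ?thesis by (simp add: integral_unique)
  qed
  have "((\<lambda>\<rho>. circle_integral f \<mu> \<rho>) has_vector_derivative 0) (at \<rho> within {s..r})" if \<rho>: "\<rho> \<in> {s..r}" for \<rho>
  proof -
    have "((\<lambda>\<rho>. integral (cbox 0 (2 * pi)) (\<lambda>t. (\<i> * of_real \<rho> * cis t) *\<^sub>C f (\<mu> + of_real \<rho> * cis t)))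
        has_vector_derivative integral (cbox 0 (2 * pi)) (D \<rho>)) (at \<rho> within {s..r})"
    proof (rule leibniz_rule_vector_derivative[OF dist _ contD \<rho>])
      fix x assume "x \<in> {s..r}"
      then show "(\<lambda>t. (\<i> * of_real x * cis t) *\<^sub>C f (\<mu> + of_real x * cis t)) integrable_on cbox 0 (2 * pi)"
        using compc[OF contf, of "cbox 0 (2 * pi)" "\<lambda>_. x" "\<lambda>t. t"]
        by (intro integrable_continuous bs continuous_intros) (auto intro: continuous_on_id)
    qed auto
    then show ?thesis using zero[OF \<rho>] by (simp add: circle_integral_def[abs_def])
  qed
  then obtain c where "\<And>\<rho>. \<rho> \<in> {s..r} \<Longrightarrow> circle_integral f \<mu> \<rho> = c"
    using has_vector_derivative_zero_constant[of "{s..r}" "circle_integral f \<mu>"] by auto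
  then show ?thesis using s by auto
qed

section \<open>Isolated points of the spectrum and Riesz projections\<close>

lemma cis_integral_zero:
  assumes "m \<noteq> (0::int)"
  shows "((\<lambda>t. cis (of_int m * t)) has_integral 0) {0..2 * pi}"
proof -
  let ?F = "\<lambda>t. cis (of_int m * t) / (\<i> * of_int m)"
  have "((\<lambda>t. cis (of_int m * t)) has_integral (?F (2 * pi) - ?F 0)) {0..2 * pi}"
  proof (rule fundamental_theorem_of_calculus)
    fix t :: real
    have c: "(cis has_derivative (\<lambda>h. of_real h * (\<i> * cis x))) (at x)" for x
    proof -
      have "(cis has_vector_derivative \<i> * cis x) (at x)"
        by (auto intro!: derivative_eq_intros simp: has_vector_derivative_def cis_conv_exp scaleR_conv_of_real)
      then show ?thesis by (simp add: has_vector_derivative_def scaleR_conv_of_real)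
    qed
    have "((\<lambda>t. of_int m * t) has_derivative (\<lambda>h. of_int m * h)) (at t within {0..2*pi})"
      by (auto intro!: derivative_eq_intros)
    from has_derivative_compose[OF this c]
    have "((\<lambda>t. cis (of_int m * t)) has_derivative (\<lambda>h. of_real (of_int m * h) * (\<i> * cis (of_int m * t)))) (at t within {0..2*pi})" .
    from has_derivative_mult_right[OF this, of "1 / (\<i> * of_int m)"]
    show "(?F has_vector_derivative cis (of_int m * t)) (at t within {0..2*pi})"
      using assms by (simp add: has_vector_derivative_def scaleR_conv_of_real mult_ac)
  qed auto
  moreover have "cis (of_int m * (2 * pi)) = 1"
    using cis_multiple_2pi[of "of_int m"] by (simp add: mult_ac)
  ultimately show ?thesis by simp
qed

lemma integral_vector_scaleC:
  assumes "f integrable_on S"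
  shows "integral S (\<lambda>t. f t *\<^sub>C x) = integral S f *\<^sub>C (x :: 'a::cbanach)"
  using integral_linear[OF assms bounded_bilinear.bounded_linear_left[OF bounded_bilinear_scaleC, of x]]
  by (simp add: o_def)

lemma integral_blinfun_apply:
  assumes "f integrable_on S"
  shows "blinfun_apply (integral S f) x = integral S (\<lambda>t. blinfun_apply (f t) x)"
  using integral_linear[OF assms bounded_bilinear.bounded_linear_left[OF bounded_bilinear_blinfun_apply, of x]]
  by (simp add: o_def)

lemma blinfun_apply_integral:
  assumes "f integrable_on S"
  shows "blinfun_apply A (integral S f) = integral S (\<lambda>t. blinfun_apply A (f t))"
  using integral_linear[OF assms blinfun.bounded_linear_right[of A]] by (simp add: o_def)

text \<open>
  \<open>Proj\<close> is the Riesz projection, and \<open>Red = 1/(2\<pi>i) \<integral> (z - \<mu>)\<^sup>-\<^sup>1 (z - L)\<^sup>-\<^sup>1 dz\<close> the reduced resolvent, which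
  inverts \<open>\<mu> - L\<close> on the kernel of \<open>Proj\<close>. The moments \<open>mom s j x = 1/(2\<pi>i) \<integral> (z - \<mu>)\<^sup>j (z - L)\<^sup>-\<^sup>1 x dz\<close> are the
  Laurent coefficients of the principal part of the resolvent at \<open>\<mu>\<close>; multiplication by
  \<open>T = L - \<mu>\<close> shifts them by one.
\<close>

locale isolated_spectral_point =
  fixes L :: "'a::cbanach \<Rightarrow>\<^sub>L 'a" and \<mu> :: complex and r :: real
  assumes L: "L \<in> bounded_ops" and r: "0 < r" and spec: "op_spectrum L \<inter> cball \<mu> r \<subseteq> {\<mu>}"
begin

definition T :: "'a \<Rightarrow>\<^sub>L 'a" where "T = L - \<mu> *\<^sub>C id_blinfun"
definition Proj :: "'a \<Rightarrow>\<^sub>L 'a" where "Proj = circle_resolvent_integral L \<mu> r"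
definition Red :: "'a \<Rightarrow>\<^sub>L 'a" where
  "Red = (1 / (2 * of_real pi)) *\<^sub>C integral {0..2 * pi} (\<lambda>t. op_resolvent L (\<mu> + of_real r * cis t))"
definition mom :: "real \<Rightarrow> nat \<Rightarrow> 'a \<Rightarrow> 'a" where
  "mom s j x = (1 / (2 * complex_of_real pi * \<i>)) *\<^sub>C
     integral {0..2 * pi} (\<lambda>t. (\<i> * (of_real s * cis t) ^ Suc j) *\<^sub>C op_resolvent L (\<mu> + of_real s * cis t) x)"

lemma T_apply: "T x = L x - \<mu> *\<^sub>C x"
  by (simp add: T_def blinfun.diff_left)

lemma T_bounded_ops: "T \<in> bounded_ops"
  using L by (simp add: T_def)

lemma not_spec: "z \<in> cball \<mu> r \<Longrightarrow> z \<noteq> \<mu> \<Longrightarrow> z \<notin> op_spectrum L"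
  using spec by blast

lemma resolvent: "z \<in> cball \<mu> r \<Longrightarrow> z \<noteq> \<mu> \<Longrightarrow> is_resolvent_at L z (op_resolvent L z)"
  using not_spec op_resolvent_works by blast

lemma circle_mem:
  assumes "0 < s" "s \<le> r"
  shows "\<mu> + of_real s * cis t \<in> cball \<mu> r" "\<mu> + of_real s * cis t \<noteq> \<mu>"
  using assms by (auto simp: dist_norm norm_mult)

lemma T_resolvent:
  assumes "z \<in> cball \<mu> r" "z \<noteq> \<mu>"
  shows "T (op_resolvent L z x) = (z - \<mu>) *\<^sub>C op_resolvent L z x - x"
    "op_resolvent L z (T x) = (z - \<mu>) *\<^sub>C op_resolvent L z x - x"
proof -
  note R = resolvent[OF assms]
  show 1: "T (op_resolvent L z x) = (z - \<mu>) *\<^sub>C op_resolvent L z x - x"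
    using resolvent_right[OF R, of x] by (simp add: T_apply complex_vs.scale_left_diff_distrib algebra_simps)
  show "op_resolvent L z (T x) = (z - \<mu>) *\<^sub>C op_resolvent L z x - x"
    using 1 resolvent_commute[OF L R, of x] bounded_opsD[OF resolvent_bounded_ops[OF R]]
    by (simp add: T_apply blinfun.diff_right)
qed

lemma continuous_resolvent: "continuous_on (cball \<mu> r - {\<mu>}) (op_resolvent L)"
  using resolvent_isCont[OF L not_spec] by (intro continuous_at_imp_continuous_on) auto

lemma continuous_circle:
  assumes "0 < s" "s \<le> r"
  shows "continuous_on A (\<lambda>t. op_resolvent L (\<mu> + of_real s * cis t))"
  by (rule continuous_on_annulus_param[OF continuous_resolvent, where s = s]) (use assms in \<open>auto intro: continuous_intros\<close>)

lemma continuous_circle_apply: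
  assumes "0 < s" "s \<le> r"
  shows "continuous_on A (\<lambda>t. op_resolvent L (\<mu> + of_real s * cis t) x)"
  by (intro bounded_bilinear.continuous_on[OF bounded_bilinear_blinfun_apply] continuous_circle[OF assms] continuous_on_const)

lemma integrable_circle:
  assumes "0 < s" "s \<le> r" "continuous_on {0..2 * pi} f"
  shows "(\<lambda>t. f t *\<^sub>C op_resolvent L (\<mu> + of_real s * cis t) x) integrable_on {0..2 * pi}"
  by (intro integrable_continuous_interval bounded_bilinear.continuous_on[OF bounded_bilinear_scaleC]
      continuous_circle_apply assms)

lemma integrable_circle':
  assumes "0 < s" "s \<le> r" "continuous_on {0..2 * pi} f"
  shows "(\<lambda>t. f t *\<^sub>C op_resolvent L (\<mu> + of_real s * cis t)) integrable_on {0..2 * pi}"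
  by (intro integrable_continuous_interval bounded_bilinear.continuous_on[OF bounded_bilinear_scaleC]
      continuous_circle assms)

lemma Proj_apply: "Proj x = mom r 0 x"
proof -
  have "(\<lambda>t. (\<i> * of_real r * cis t) *\<^sub>C op_resolvent L (\<mu> + of_real r * cis t)) integrable_on {0..2 * pi}"
    by (rule integrable_circle') (use r in \<open>auto intro!: continuous_intros\<close>)
  from integral_blinfun_apply[OF this, of x] show ?thesis
    by (simp add: Proj_def circle_resolvent_integral_def mom_def mult.assoc)
qed

lemma Red_apply: "Red x = (1 / (2 * of_real pi)) *\<^sub>C integral {0..2 * pi} (\<lambda>t. op_resolvent L (\<mu> + of_real r * cis t) x)"
proof -
  have "(\<lambda>t. op_resolvent L (\<mu> + of_real r * cis t)) integrable_on {0..2 * pi}"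
    by (intro integrable_continuous_interval continuous_circle) (use r in auto)
  from integral_blinfun_apply[OF this, of x] show ?thesis by (simp add: Red_def)
qed

lemma integral_power_zero: "integral {0..2 * pi} (\<lambda>t. \<i> * (of_real s * cis t) ^ Suc j) = 0"
proof -
  have "((\<lambda>t. (\<i> * of_real s ^ Suc j) * cis (of_int (int (Suc j)) * t)) has_integral (\<i> * of_real s ^ Suc j) * 0) {0..2 * pi}"
    by (intro has_integral_mult_right cis_integral_zero) auto
  moreover have "(\<lambda>t. (\<i> * of_real s ^ Suc j) * cis (of_int (int (Suc j)) * t)) = (\<lambda>t. \<i> * (of_real s * cis t) ^ Suc j)"
  proof
    fix t
    have "(of_real s * cis t) ^ Suc j = of_real s ^ Suc j * cis (of_int (int (Suc j)) * t)"
      by (simp only: power_mult_distrib Complex.DeMoivre of_int_of_nat_eq)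
    then show "(\<i> * of_real s ^ Suc j) * cis (of_int (int (Suc j)) * t) = \<i> * (of_real s * cis t) ^ Suc j"
      by (simp only: mult.assoc)
  qed
  ultimately have "((\<lambda>t. \<i> * (of_real s * cis t) ^ Suc j) has_integral 0) {0..2 * pi}" by simp
  then show ?thesis by (rule integral_unique)
qed

text \<open>
  Since \<open>T (z - L)\<^sup>-\<^sup>1 = (z - \<mu>) (z - L)\<^sup>-\<^sup>1 - 1\<close>, the two integrands differ by a polynomial in \<open>z - \<mu>\<close>, whose
  integral over the circle vanishes.
\<close>

lemma mom_Suc:
  assumes s: "0 < s" "s \<le> r"
  shows "T (mom s j x) = mom s (Suc j) x" "mom s j (T x) = mom s (Suc j) x"
proof -
  let ?w = "\<lambda>t. of_real s * cis t" and ?R = "\<lambda>t. op_resolvent L (\<mu> + of_real s * cis t)"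
  have c: "continuous_on {0..2 * pi} (\<lambda>t. \<i> * (of_real s * cis t) ^ j)" for j
    by (intro continuous_intros)
  have eq: "integral {0..2 * pi} (\<lambda>t. (\<i> * ?w t ^ Suc j) *\<^sub>C (?w t *\<^sub>C ?R t x - x))
      = integral {0..2 * pi} (\<lambda>t. (\<i> * ?w t ^ Suc (Suc j)) *\<^sub>C ?R t x)"
  proof -
    have "integral {0..2 * pi} (\<lambda>t. (\<i> * ?w t ^ Suc j) *\<^sub>C (?w t *\<^sub>C ?R t x - x))
      = integral {0..2 * pi} (\<lambda>t. (\<i> * ?w t ^ Suc (Suc j)) *\<^sub>C ?R t x - (\<i> * ?w t ^ Suc j) *\<^sub>C x)"
      by (intro integral_cong) (simp add: complex_vs.scale_right_diff_distrib scaleC_scaleC mult_ac)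
    also have "\<dots> = integral {0..2 * pi} (\<lambda>t. (\<i> * ?w t ^ Suc (Suc j)) *\<^sub>C ?R t x)
        - integral {0..2 * pi} (\<lambda>t. (\<i> * ?w t ^ Suc j) *\<^sub>C x)"
      by (intro Henstock_Kurzweil_Integration.integral_diff integrable_circle s c
          integrable_continuous_interval bounded_bilinear.continuous_on[OF bounded_bilinear_scaleC] continuous_on_const)
    also have "integral {0..2 * pi} (\<lambda>t. (\<i> * ?w t ^ Suc j) *\<^sub>C x) = 0"
      by (simp only: integral_vector_scaleC[OF integrable_continuous_interval[OF c]] integral_power_zero complex_vs.scale_zero_left)
    finally show ?thesis by simp
  qed
  have "T (mom s j x) = (1 / (2 * complex_of_real pi * \<i>)) *\<^sub>C
      integral {0..2 * pi} (\<lambda>t. T ((\<i> * ?w t ^ Suc j) *\<^sub>C ?R t x))"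
    unfolding mom_def bounded_opsD[OF T_bounded_ops] by (simp only: blinfun_apply_integral[OF integrable_circle[OF s c]] bounded_opsD[OF T_bounded_ops])
  also have "(\<lambda>t. T ((\<i> * ?w t ^ Suc j) *\<^sub>C ?R t x)) = (\<lambda>t. (\<i> * ?w t ^ Suc j) *\<^sub>C (?w t *\<^sub>C ?R t x - x))"
    using T_resolvent(1)[OF circle_mem[OF s]] by (simp add: bounded_opsD[OF T_bounded_ops])
  finally show "T (mom s j x) = mom s (Suc j) x" unfolding eq by (simp only: mom_def)
  have "(\<lambda>t. (\<i> * ?w t ^ Suc j) *\<^sub>C ?R t (T x)) = (\<lambda>t. (\<i> * ?w t ^ Suc j) *\<^sub>C (?w t *\<^sub>C ?R t x - x))"
    using T_resolvent(2)[OF circle_mem[OF s]] by simp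
  then have "mom s j (T x) = (1 / (2 * complex_of_real pi * \<i>)) *\<^sub>C
      integral {0..2 * pi} (\<lambda>t. (\<i> * ?w t ^ Suc j) *\<^sub>C (?w t *\<^sub>C ?R t x - x))"
    by (simp only: mom_def)
  then show "mom s j (T x) = mom s (Suc j) x" unfolding eq by (simp only: mom_def)
qed

lemma T_Proj: "T (Proj x) = Proj (T x)"
  using mom_Suc[of r 0 x] r by (simp add: Proj_apply)

lemma T_power_Proj: "(blinfun_apply T ^^ N) (Proj x) = mom r N x"
  by (induction N) (use r in \<open>auto simp: Proj_apply mom_Suc\<close>)

text \<open>
  The same computation as in \<open>mom_Suc\<close> for the exponent \<open>-1\<close>, where the remaining term
  \<open>(z - \<mu>)\<^sup>-\<^sup>1 x\<close> integrates to \<open>x\<close> instead of \<open>0\<close>.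
\<close>

lemma Red_T:
  "T (Red x) = Proj x - x" "Red (T x) = Proj x - x"
proof -
  let ?w = "\<lambda>t. of_real r * cis t" and ?R = "\<lambda>t. op_resolvent L (\<mu> + of_real r * cis t)"
  have rr: "0 < r" "r \<le> r" using r by auto
  have c: "continuous_on {0..2 * pi} (\<lambda>t. of_real r * cis t)"
    by (intro continuous_intros)
  have eq: "(1 / (2 * of_real pi)) *\<^sub>C integral {0..2 * pi} (\<lambda>t. ?w t *\<^sub>C ?R t x - x) = Proj x - x"
  proof -
    have "integral {0..2 * pi} (\<lambda>t. ?w t *\<^sub>C ?R t x - x)
        = integral {0..2 * pi} (\<lambda>t. ?w t *\<^sub>C ?R t x) - integral {0..2 * pi} (\<lambda>t. x)"
      by (intro Henstock_Kurzweil_Integration.integral_diff integrable_circle rr c integrable_const_ivl)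
    also have "integral {0..2 * pi} (\<lambda>t. x) = (2 * of_real pi) *\<^sub>C x"
      by (simp add: scaleR_scaleC)
    finally have 1: "(1 / (2 * of_real pi)) *\<^sub>C integral {0..2 * pi} (\<lambda>t. ?w t *\<^sub>C ?R t x - x)
       = (1 / (2 * of_real pi)) *\<^sub>C integral {0..2 * pi} (\<lambda>t. ?w t *\<^sub>C ?R t x) - x"
      by (simp add: complex_vs.scale_right_diff_distrib scaleC_scaleC scaleC_one)
    have "integral {0..2 * pi} (\<lambda>t. (\<i> * ?w t) *\<^sub>C ?R t x) = integral {0..2 * pi} (\<lambda>t. \<i> *\<^sub>C (?w t *\<^sub>C ?R t x))"
      by (simp add: scaleC_scaleC)
    also have "\<dots> = \<i> *\<^sub>C integral {0..2 * pi} (\<lambda>t. ?w t *\<^sub>C ?R t x)"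
      using integral_linear[OF integrable_circle[OF rr c] bounded_linear_scaleC[of \<i>], of x] by (simp add: o_def)
    finally have "Proj x = (1 / (2 * of_real pi)) *\<^sub>C integral {0..2 * pi} (\<lambda>t. ?w t *\<^sub>C ?R t x)"
      by (simp add: Proj_apply mom_def scaleC_scaleC)
    then show ?thesis using 1 by simp
  qed
  have "T (Red x) = (1 / (2 * of_real pi)) *\<^sub>C integral {0..2 * pi} (\<lambda>t. T (?R t x))"
    unfolding Red_apply bounded_opsD[OF T_bounded_ops]
    by (subst blinfun_apply_integral) (use r in \<open>auto intro: integrable_continuous_interval continuous_circle_apply\<close>)
  also have "(\<lambda>t. T (?R t x)) = (\<lambda>t. ?w t *\<^sub>C ?R t x - x)"
    using T_resolvent(1)[OF circle_mem[OF rr]] by simp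
  finally show "T (Red x) = Proj x - x" using eq by simp
  have "(\<lambda>t. ?R t (T x)) = (\<lambda>t. ?w t *\<^sub>C ?R t x - x)"
    using T_resolvent(2)[OF circle_mem[OF rr]] by simp
  then show "Red (T x) = Proj x - x" using eq by (simp add: Red_apply)
qed

lemma integral_bounded_ops:
  assumes "f integrable_on S" "\<And>t. t \<in> S \<Longrightarrow> f t \<in> bounded_ops"
  shows "integral S f \<in> (bounded_ops :: ('a \<Rightarrow>\<^sub>L 'a) set)"
proof -
  have "integral S f (c *\<^sub>C x) = c *\<^sub>C integral S f x" for c x
  proof -
    have "integral S f (c *\<^sub>C x) = integral S (\<lambda>t. c *\<^sub>C f t x)"
      unfolding integral_blinfun_apply[OF assms(1)]
      by (intro integral_cong) (simp add: bounded_opsD[OF assms(2)])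
    also have "\<dots> = c *\<^sub>C integral S (\<lambda>t. f t x)"
      using integral_linear[OF integrable_linear[OF assms(1) bounded_bilinear.bounded_linear_left[OF bounded_bilinear_blinfun_apply, of x]]
          bounded_linear_scaleC[of c]] by (simp add: o_def)
    finally show ?thesis by (simp add: integral_blinfun_apply[OF assms(1)])
  qed
  then show ?thesis by (simp add: bounded_ops_def)
qed

lemma Proj_bounded_ops: "Proj \<in> bounded_ops"
  unfolding Proj_def circle_resolvent_integral_def
  by (intro bounded_ops_scaleC integral_bounded_ops integrable_circle')
    (use r resolvent[OF circle_mem] in \<open>auto intro!: continuous_intros bounded_ops_scaleC dest: resolvent_bounded_ops\<close>)

lemma Red_bounded_ops: "Red \<in> bounded_ops"
  unfolding Red_def
  by (intro bounded_ops_scaleC integral_bounded_ops integrable_continuous_interval continuous_circle)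
    (use r resolvent[OF circle_mem] in \<open>auto dest: resolvent_bounded_ops\<close>)

text \<open>
  On a generalized eigenvector the resolvent is the finite sum \<open>\<Sum> (z - \<mu>)\<^sup>-\<^sup>i\<^sup>-\<^sup>1 T\<^sup>i x\<close>, so only the term
  \<open>i = 0\<close> has a residue.
\<close>

lemma Proj_generalized_eigenvector:
  assumes "(blinfun_apply T ^^ N) x = 0"
  shows "Proj x = x"
proof -
  let ?w = "\<lambda>t. of_real r * cis t" and ?R = "\<lambda>t. op_resolvent L (\<mu> + of_real r * cis t)"
  let ?T = "\<lambda>i. (blinfun_apply T ^^ i) x"
  have w0: "?w t \<noteq> 0" for t using r by simp
  have mip: "w * inverse w ^ Suc i = inverse w ^ i" if "w \<noteq> 0" for w :: complex and i
    using that by simp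
  have mip2: "(c * w) * inverse w ^ Suc i = c * inverse w ^ i" if "w \<noteq> 0" for c w :: complex and i
    using that by simp
  have Rx: "?R t x = (\<Sum>i<N. inverse (?w t) ^ Suc i *\<^sub>C ?T i)" for t
  proof -
    define y where "y = (\<Sum>i<N. inverse (?w t) ^ Suc i *\<^sub>C ?T i)"
    note R = resolvent[OF circle_mem, of r t]
    have "(\<mu> + ?w t) *\<^sub>C y - L y = ?w t *\<^sub>C y - T y"
      by (simp add: T_apply scaleC_add_left)
    also have "\<dots> = (\<Sum>i<N. inverse (?w t) ^ i *\<^sub>C ?T i - inverse (?w t) ^ Suc i *\<^sub>C ?T (Suc i))"
      unfolding y_def complex_vs.scale_sum_right blinfun.sum_right sum_subtractf[symmetric]
      by (intro sum.cong refl arg_cong2[where f = "(-)"])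
        (simp_all only: scaleC_scaleC mip[OF w0] bounded_opsD[OF T_bounded_ops] funpow.simps comp_apply)
    also have "\<dots> = inverse (?w t) ^ 0 *\<^sub>C ?T 0 - inverse (?w t) ^ N *\<^sub>C ?T N"
      by (rule sum_lessThan_telescope')
    also have "\<dots> = x" using assms by (simp add: scaleC_one)
    finally show ?thesis using resolvent_left[OF R, of y] r by (simp add: y_def)
  qed
  have ci: "(\<lambda>t. \<i> * inverse (?w t) ^ i) integrable_on {0..2 * pi}" for i
    using w0 by (intro integrable_continuous_interval continuous_intros) auto
  have I: "integral {0..2 * pi} (\<lambda>t. \<i> * inverse (?w t) ^ i) = (if i = 0 then 2 * of_real pi * \<i> else 0)" for i
  proof (cases "i = 0")
    case False
    have "((\<lambda>t. (\<i> * inverse (of_real r) ^ i) * cis (of_int (- int i) * t)) has_integral (\<i> * inverse (of_real r) ^ i) * 0) {0..2 * pi}"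
      using False by (intro has_integral_mult_right cis_integral_zero) auto
    moreover have "(\<lambda>t. (\<i> * inverse (of_real r) ^ i) * cis (of_int (- int i) * t)) = (\<lambda>t. \<i> * inverse (?w t) ^ i)"
      by (rule ext) (simp add: power_mult_distrib Complex.DeMoivre mult.assoc)
    ultimately have "((\<lambda>t. \<i> * inverse (?w t) ^ i) has_integral 0) {0..2 * pi}" by simp
    then show ?thesis using False by (simp only: integral_unique if_False)
  qed (simp add: scaleR_conv_of_real)
  have "integral {0..2 * pi} (\<lambda>t. (\<i> * ?w t) *\<^sub>C ?R t x)
      = integral {0..2 * pi} (\<lambda>t. \<Sum>i<N. (\<i> * inverse (?w t) ^ i) *\<^sub>C ?T i)"
    unfolding Rx complex_vs.scale_sum_right
    by (intro integral_cong sum.cong refl) (simp only: scaleC_scaleC mip2[OF w0])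
  also have "\<dots> = (\<Sum>i<N. integral {0..2 * pi} (\<lambda>t. (\<i> * inverse (?w t) ^ i) *\<^sub>C ?T i))"
    using w0 by (intro integral_sum integrable_continuous_interval bounded_bilinear.continuous_on[OF bounded_bilinear_scaleC] continuous_intros) auto
  also have "\<dots> = (\<Sum>i<N. (if i = 0 then 2 * of_real pi * \<i> else 0) *\<^sub>C ?T i)"
    by (simp only: integral_vector_scaleC[OF ci] I)
  also have "\<dots> = (2 * of_real pi * \<i>) *\<^sub>C x"
  proof (cases N)
    case 0
    then show ?thesis using assms by simp
  next
    case (Suc M)
    show ?thesis unfolding Suc sum.lessThan_Suc_shift by (simp add: complex_vs.scale_zero_left)
  qed
  finally show ?thesis by (simp add: Proj_apply mom_def scaleC_scaleC scaleC_one)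
qed

text \<open>
  If the resolvent has a pole of order at most \<open>N\<close>, then \<open>(z - \<mu>)\<^sup>N (z - L)\<^sup>-\<^sup>1 x\<close> is bounded near \<open>\<mu>\<close>, and shrinking
  the circle shows that its contour integral vanishes. This integral is \<open>T\<^sup>N Proj x\<close>.
\<close>

lemma T_power_Proj_zero:
  assumes bd: "eventually (\<lambda>z. norm ((z - \<mu>) ^ N *\<^sub>C op_resolvent L z) \<le> C) (at \<mu>)"
  shows "(blinfun_apply T ^^ N) (Proj x) = 0"
proof -
  define f where "f z = (z - \<mu>) ^ N *\<^sub>C op_resolvent L z x" for z
  define f' where "f' z = (z - \<mu>) ^ N *\<^sub>C (- op_resolvent L z (op_resolvent L z x))
      + (of_nat N * (z - \<mu>) ^ (N - 1)) *\<^sub>C op_resolvent L z x" for z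
  have der: "(f has_derivative (\<lambda>h. h *\<^sub>C f' z)) (at z)" if "z \<in> cball \<mu> r - {\<mu>}" for z
  proof -
    have 1: "((\<lambda>z. (z - \<mu>) ^ N) has_derivative (\<lambda>h. h * (of_nat N * (z - \<mu>) ^ (N - 1)))) (at z)"
      by (auto intro!: derivative_eq_intros simp: mult_ac)
    have "(op_resolvent L has_derivative (\<lambda>h. h *\<^sub>C (- (op_resolvent L z o\<^sub>L op_resolvent L z)))) (at z)"
      by (rule resolvent_has_derivative[OF L]) (use that not_spec in auto)
    from bounded_linear.has_derivative[OF bounded_bilinear.bounded_linear_left[OF bounded_bilinear_blinfun_apply, of x] this]
    have 2: "((\<lambda>z. op_resolvent L z x) has_derivative (\<lambda>h. h *\<^sub>C (- op_resolvent L z (op_resolvent L z x)))) (at z)"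
      by (simp add: blinfun.minus_left)
    have "(\<lambda>h. (z - \<mu>) ^ N *\<^sub>C h *\<^sub>C (- op_resolvent L z (op_resolvent L z x))
        + (h * (of_nat N * (z - \<mu>) ^ (N - 1))) *\<^sub>C op_resolvent L z x) = (\<lambda>h. h *\<^sub>C f' z)"
      by (rule ext) (simp only: f'_def scaleC_scaleC scaleC_add_right mult.commute mult.left_commute)
    then show ?thesis
      using bounded_bilinear.FDERIV[OF bounded_bilinear_scaleC 1 2] unfolding f_def[abs_def] by simp
  qed
  have cont: "continuous_on (cball \<mu> r - {\<mu>}) f'"
    unfolding f'_def
    by (intro continuous_on_add continuous_on_minus bounded_bilinear.continuous_on[OF bounded_bilinear_scaleC]
        bounded_bilinear.continuous_on[OF bounded_bilinear_blinfun_apply] continuous_resolvent continuous_intros)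
  have contf: "continuous_on (cball \<mu> r - {\<mu>}) f"
    unfolding f_def
    by (intro bounded_bilinear.continuous_on[OF bounded_bilinear_scaleC]
        bounded_bilinear.continuous_on[OF bounded_bilinear_blinfun_apply] continuous_resolvent continuous_intros)
  have mom_eq: "mom s N x = (1 / (2 * complex_of_real pi * \<i>)) *\<^sub>C circle_integral f \<mu> s" for s
    by (simp add: mom_def circle_integral_def f_def scaleC_scaleC mult_ac)
  obtain d where d: "d > 0" "\<And>z. z \<noteq> \<mu> \<Longrightarrow> dist z \<mu> < d \<Longrightarrow> norm ((z - \<mu>) ^ N *\<^sub>C op_resolvent L z) \<le> C"
    using bd unfolding eventually_at by auto
  have small: "norm (circle_integral f \<mu> r) \<le> s * (C * norm x * (2 * pi))" if s: "0 < s" "s < d" "s \<le> r" for s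
  proof -
    have "norm (circle_integral f \<mu> s) \<le> (s * (C * norm x)) * (2 * pi - 0)"
      unfolding circle_integral_def
    proof (rule integral_bound)
      show "continuous_on {0..2 * pi} (\<lambda>t. (\<i> * of_real s * cis t) *\<^sub>C f (\<mu> + of_real s * cis t))"
        by (intro bounded_bilinear.continuous_on[OF bounded_bilinear_scaleC] continuous_intros
            continuous_on_annulus_param[OF contf _ _ s(1)]) (use s in auto)
      fix t
      let ?z = "\<mu> + of_real s * cis t"
      have "norm (f ?z) \<le> norm ((?z - \<mu>) ^ N *\<^sub>C op_resolvent L ?z) * norm x"
        using norm_blinfun[of "(?z - \<mu>) ^ N *\<^sub>C op_resolvent L ?z" x] by (simp add: f_def)
      also have "\<dots> \<le> C * norm x"
        using s by (intro mult_right_mono d(2)) (auto simp: dist_norm norm_mult)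
      finally show "norm ((\<i> * of_real s * cis t) *\<^sub>C f ?z) \<le> s * (C * norm x)"
        using s by (simp add: norm_scaleC norm_mult mult_left_mono)
    qed auto
    then show ?thesis
      using circle_integral_const_radius[OF der cont s(1,3)] by (simp add: mult_ac)
  qed
  have "norm (circle_integral f \<mu> r) \<le> 0"
  proof (rule tendsto_lowerbound)
    show "((\<lambda>s. s * (C * norm x * (2 * pi))) \<longlongrightarrow> 0) (at_right 0)"
      by (auto intro!: tendsto_eq_intros)
    have "eventually (\<lambda>s. s \<in> {0<..<min d r}) (at_right 0)"
      using d(1) r by (intro eventually_at_right_real) auto
    then show "eventually (\<lambda>s. norm (circle_integral f \<mu> r) \<le> s * (C * norm x * (2 * pi))) (at_right 0)"
      by eventually_elim (use small in auto)
  qed auto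
  then show ?thesis by (simp add: T_power_Proj mom_eq)
qed

lemma Proj_idem:
  assumes "\<And>x. (blinfun_apply T ^^ N) (Proj x) = 0"
  shows "Proj (Proj x) = Proj x"
  using Proj_generalized_eigenvector[OF assms] .

lemma L_Proj: "L (Proj x) = Proj (L x)"
  using T_Proj[of x] by (simp add: T_apply blinfun.diff_right bounded_opsD[OF Proj_bounded_ops])

text \<open>
  With \<open>Q = 1 - Proj\<close>, the operator \<open>1 - L Q / \<mu>\<close> is the identity on the range of \<open>Proj\<close> and \<open>(\<mu> - L) / \<mu>\<close> on the
  range of \<open>Q\<close>, where \<open>\<mu> Red\<close> inverts it.
\<close>

lemma complement_left_inverse:
  assumes idem: "\<And>x. Proj (Proj x) = Proj x" and \<mu>: "\<mu> \<noteq> 0"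
  obtains V where "\<And>x. blinfun_apply V (x - inverse \<mu> *\<^sub>C L (x - Proj x)) = x"
proof -
  define Q where "Q = id_blinfun - Proj"
  have Q: "Q x = x - Proj x" for x by (simp add: Q_def blinfun.diff_left)
  have RP: "Proj (Proj x - x) = 0" for x using idem by (simp add: blinfun.diff_right)
  define V where "V = \<mu> *\<^sub>C (Q o\<^sub>L Red o\<^sub>L Q) + Proj"
  have V: "V x = \<mu> *\<^sub>C Q (Red (Q x)) + Proj x" for x by (simp add: V_def blinfun.add_left)
  have QQ: "Q (Q x) = Q x" and QP: "Q (Proj x) = 0" and PQ: "Proj (Q x) = 0" for x
    using idem by (simp_all add: Q blinfun.diff_right)
  have Qb: "Q \<in> bounded_ops" using Proj_bounded_ops by (simp add: Q_def)
  show ?thesis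
  proof (rule that)
    fix x
    let ?y = "x - inverse \<mu> *\<^sub>C L (Q x)"
    have LQ: "L (Q x) = Q (L x)" by (simp add: Q L_Proj blinfun.diff_right)
    have "\<mu> *\<^sub>C ?y = \<mu> *\<^sub>C x - L (Q x)"
      using \<mu> by (simp add: complex_vs.scale_right_diff_distrib scaleC_scaleC scaleC_one)
    then have "\<mu> *\<^sub>C Q ?y = \<mu> *\<^sub>C Q x - Q (L (Q x))"
      by (metis blinfun.diff_right bounded_opsD[OF Qb])
    also have "Q (L (Q x)) = L (Q x)" by (simp add: LQ QQ)
    also have "\<mu> *\<^sub>C Q x - L (Q x) = - T (Q x)" by (simp add: T_apply)
    finally have Qy: "\<mu> *\<^sub>C Q ?y = - T (Q x)" .
    have "\<mu> *\<^sub>C Q (Red (Q ?y)) = Q (Red (\<mu> *\<^sub>C Q ?y))"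
      by (simp add: bounded_opsD[OF Qb] bounded_opsD[OF Red_bounded_ops])
    also have "\<dots> = Q (- Red (T (Q x)))" unfolding Qy by (simp add: blinfun.minus_right)
    also have "\<dots> = Q (Q x)" by (simp add: Red_T PQ)
    finally have 1: "\<mu> *\<^sub>C Q (Red (Q ?y)) = Q x" by (simp add: QQ)
    have "Proj ?y = Proj x - inverse \<mu> *\<^sub>C Proj (L (Q x))"
      by (simp add: blinfun.diff_right bounded_opsD[OF Proj_bounded_ops])
    also have "Proj (L (Q x)) = 0" by (simp add: LQ PQ)
    finally have "Proj ?y = Proj x" by simp
    then have "V ?y = x" unfolding V 1 by (simp add: Q)
    then show "V (x - inverse \<mu> *\<^sub>C L (x - Proj x)) = x" by (simp add: Q)
  qed
qed

end

section \<open>Finite rank perturbations and the analytic Fredholm theorem\<close>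

text \<open>
  Coordinates on a finite dimensional subspace are bounded. In the induction step the new vector \<open>a\<close>
  has positive distance from the span of the others: otherwise some combinations would converge to
  \<open>a\<close>, their coefficients would be Cauchy by the induction hypothesis, and \<open>a\<close> would lie in that span.
\<close>

lemma finite_coefficient_bound:
  fixes B :: "'a::cbanach set"
  assumes "finite B" "complex_vs.independent B"
  shows "\<exists>C\<ge>0. \<forall>c. \<forall>b\<in>B. norm (c b) \<le> C * norm (\<Sum>b\<in>B. c b *\<^sub>C b)"
  using assms
proof (induction B rule: finite_induct)
  case empty
  then show ?case by auto
next
  case (insert a B)
  have ind: "complex_vs.independent B" and a: "a \<notin> complex_vs.span B"
    using insert.prems insert.hyps by (auto simp: complex_vs.independent_insert)
  obtain C where C: "C \<ge> 0" "\<And>c b. b \<in> B \<Longrightarrow> norm (c b) \<le> C * norm (\<Sum>b\<in>B. c b *\<^sub>C b)"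
    using insert.IH[OF ind] by blast
  have "\<exists>d>0. \<forall>c. norm (a - (\<Sum>b\<in>B. c b *\<^sub>C b)) \<ge> d"
  proof (rule ccontr)
    assume "\<not> ?thesis"
    then have "\<exists>c. norm (a - (\<Sum>b\<in>B. c b *\<^sub>C b)) < e" if "e > 0" for e
      using that by (meson not_le)
    then have "\<forall>n. \<exists>c. norm (a - (\<Sum>b\<in>B. c b *\<^sub>C b)) < 1 / real (Suc n)"
      by (simp del: of_nat_Suc)
    then obtain c where c: "\<And>n. norm (a - (\<Sum>b\<in>B. c n b *\<^sub>C b)) < 1 / real (Suc n)" by metis
    define s where "s n = (\<Sum>b\<in>B. c n b *\<^sub>C b)" for n
    have "(\<lambda>n. a - s n) \<longlonglongrightarrow> 0"
    proof (rule Lim_null_comparison)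
      show "\<forall>\<^sub>F n in sequentially. norm (a - s n) \<le> 1 / real (Suc n)"
        using c by (auto intro!: always_eventually less_imp_le simp: s_def simp del: of_nat_Suc)
      show "(\<lambda>n. 1 / real (Suc n)) \<longlonglongrightarrow> 0" by (rule LIMSEQ_Suc[OF lim_1_over_n])
    qed
    then have sa: "s \<longlonglongrightarrow> a" using tendsto_diff[OF tendsto_const[of a], of "\<lambda>n. a - s n" 0] by simp
    have "\<exists>l. (\<lambda>n. c n b) \<longlonglongrightarrow> l" if b: "b \<in> B" for b
    proof -
      have diff: "norm (c m b - c n b) \<le> C * norm (s m - s n)" for m n
        using C(2)[OF b, of "\<lambda>b. c m b - c n b"]
        by (simp add: s_def complex_vs.scale_left_diff_distrib sum_subtractf)
      have "Cauchy (\<lambda>n. c n b)"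
      proof (rule metric_CauchyI)
        fix e :: real assume "e > 0"
        then have e': "e / (C + 1) > 0" using C(1) by simp
        have "Cauchy s" using sa by (rule LIMSEQ_imp_Cauchy)
        then obtain M where M: "\<And>m n. m \<ge> M \<Longrightarrow> n \<ge> M \<Longrightarrow> dist (s m) (s n) < e / (C + 1)"
          using metric_CauchyD[OF _ e'] by blast
        have "dist (c m b) (c n b) < e" if "m \<ge> M" "n \<ge> M" for m n
        proof -
          have "dist (c m b) (c n b) \<le> C * dist (s m) (s n)" using diff[of m n] by (simp add: dist_norm)
          also have "\<dots> \<le> (C + 1) * dist (s m) (s n)" by (intro mult_right_mono) auto
          also have "\<dots> < (C + 1) * (e / (C + 1))" using M[OF that] C(1) by (intro mult_strict_left_mono) auto
          also have "\<dots> = e" using C(1) by simp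
          finally show ?thesis .
        qed
        then show "\<exists>M. \<forall>m\<ge>M. \<forall>n\<ge>M. dist (c m b) (c n b) < e" by blast
      qed
      then show ?thesis using Cauchy_convergent convergent_def by blast
    qed
    then obtain l where l: "\<And>b. b \<in> B \<Longrightarrow> (\<lambda>n. c n b) \<longlonglongrightarrow> l b" by metis
    have "s \<longlonglongrightarrow> (\<Sum>b\<in>B. l b *\<^sub>C b)"
      unfolding s_def using l by (intro tendsto_sum bounded_bilinear.tendsto[OF bounded_bilinear_scaleC] tendsto_const)
    then have "a = (\<Sum>b\<in>B. l b *\<^sub>C b)" using sa LIMSEQ_unique by blast
    also have "\<dots> \<in> complex_vs.span B"
      by (intro complex_vs.span_sum complex_vs.span_scale complex_vs.span_base)
    finally show False using a by simp
  qed
  then obtain d where d: "d > 0" "\<And>c. norm (a - (\<Sum>b\<in>B. c b *\<^sub>C b)) \<ge> d" by blast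
  define K where "K = max (1 / d) (C * (1 + norm a / d))"
  have ca: "norm (c a) \<le> norm (\<Sum>b\<in>insert a B. c b *\<^sub>C b) / d" for c
  proof (cases "c a = 0")
    case False
    have "(\<Sum>b\<in>insert a B. c b *\<^sub>C b) = c a *\<^sub>C (a - (\<Sum>b\<in>B. (- c b / c a) *\<^sub>C b))"
    proof -
      have "(\<Sum>b\<in>B. c a *\<^sub>C (- c b / c a) *\<^sub>C b) = (\<Sum>b\<in>B. - (c b *\<^sub>C b))"
        using False by (intro sum.cong) (simp_all add: scaleC_scaleC complex_vs.scale_minus_left)
      then have "c a *\<^sub>C (a - (\<Sum>b\<in>B. (- c b / c a) *\<^sub>C b)) = c a *\<^sub>C a - (\<Sum>b\<in>B. - (c b *\<^sub>C b))"
        by (simp only: complex_vs.scale_right_diff_distrib complex_vs.scale_sum_right)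
      then show ?thesis using insert.hyps by (simp add: sum_negf)
    qed
    then have "norm (\<Sum>b\<in>insert a B. c b *\<^sub>C b) = norm (c a) * norm (a - (\<Sum>b\<in>B. (- c b / c a) *\<^sub>C b))"
      by (simp add: norm_scaleC)
    also have "\<dots> \<ge> norm (c a) * d" by (intro mult_left_mono d) auto
    finally show ?thesis using d(1) by (simp add: field_simps)
  qed (use d in auto)
  have "norm (c b) \<le> K * norm (\<Sum>b\<in>insert a B. c b *\<^sub>C b)" if "b \<in> insert a B" for b c
  proof (cases "b = a")
    case True
    have "norm (c a) \<le> 1 / d * norm (\<Sum>b\<in>insert a B. c b *\<^sub>C b)" using ca[of c] by simp
    also have "\<dots> \<le> K * norm (\<Sum>b\<in>insert a B. c b *\<^sub>C b)" by (intro mult_right_mono) (auto simp: K_def)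
    finally show ?thesis using True by simp
  next
    case False
    define x where "x = (\<Sum>b\<in>insert a B. c b *\<^sub>C b)"
    have "(\<Sum>b\<in>B. c b *\<^sub>C b) = x - c a *\<^sub>C a" using insert.hyps by (simp add: x_def)
    then have "norm (\<Sum>b\<in>B. c b *\<^sub>C b) \<le> norm x + norm (c a) * norm a"
      using norm_triangle_ineq4[of x "c a *\<^sub>C a"] by (simp add: norm_scaleC)
    also have "\<dots> \<le> norm x + (norm x / d) * norm a"
      using ca[of c] by (intro add_left_mono mult_right_mono) (auto simp: x_def)
    finally have 1: "norm (\<Sum>b\<in>B. c b *\<^sub>C b) \<le> (1 + norm a / d) * norm x" by (simp add: algebra_simps)
    have "norm (c b) \<le> C * norm (\<Sum>b\<in>B. c b *\<^sub>C b)" using that False by (intro C) auto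
    also have "\<dots> \<le> C * ((1 + norm a / d) * norm x)" using 1 C(1) by (intro mult_left_mono) auto
    also have "\<dots> \<le> K * norm x" unfolding mult.assoc[symmetric] by (intro mult_right_mono) (auto simp: K_def)
    finally show ?thesis by (simp add: x_def)
  qed
  moreover have "K \<ge> 0"
  proof -
    have "1 / d \<le> K" by (simp add: K_def)
    moreover have "0 \<le> 1 / d" using d(1) by simp
    ultimately show ?thesis by linarith
  qed
  ultimately show ?case by blast
qed

definition cfunctional :: "('a::cbanach \<Rightarrow> complex) \<Rightarrow> bool" where
  "cfunctional \<phi> \<longleftrightarrow> (\<forall>x y. \<phi> (x + y) = \<phi> x + \<phi> y) \<and> (\<forall>c x. \<phi> (c *\<^sub>C x) = c * \<phi> x) \<and>
     (\<exists>K. \<forall>x. norm (\<phi> x) \<le> norm x * K)"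

lemma cfunctional_bounded_linear: "cfunctional \<phi> \<Longrightarrow> bounded_linear \<phi>"
  unfolding cfunctional_def
  by (auto intro!: bounded_linear_intro simp: scaleR_scaleC scaleR_conv_of_real)

lemma coord_bounded:
  assumes bs: "basis_list bs"
  obtains K where "\<And>x i. x \<in> lspan bs \<Longrightarrow> i < length bs \<Longrightarrow> norm (coord bs i x) \<le> norm x * K"
proof -
  obtain C where C: "C \<ge> 0" "\<And>c b. b \<in> set bs \<Longrightarrow> norm (c b) \<le> C * norm (\<Sum>b\<in>set bs. c b *\<^sub>C b)"
    using finite_coefficient_bound[of "set bs"] bs by (auto simp: basis_list_def)
  show ?thesis
  proof (rule that)
    fix x i assume x: "x \<in> lspan bs" and i: "i < length bs"
    have "(\<Sum>b\<in>set bs. complex_vs.representation (set bs) x b *\<^sub>C b) = x"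
      using bs x by (intro complex_vs.sum_representation_eq) (auto simp: basis_list_def)
    then show "norm (coord bs i x) \<le> norm x * C"
      using C(2)[of "bs ! i" "complex_vs.representation (set bs) x"] i by (simp add: coord_def mult.commute)
  qed
qed

text \<open>
  A range contained in a finite dimensional space suffices, as then it is the span of a finite set itself.
\<close>

lemma finite_rank_opsI:
  assumes F: "F \<in> bounded_ops" and sub: "range (blinfun_apply F) \<subseteq> complex_vs.span B" and fin: "finite B"
  shows "F \<in> finite_rank_ops"
  using range_basis_works[OF clinear_map_bounded_ops[OF F] sub fin] F
  unfolding finite_rank_ops_def by (auto intro!: exI[of _ "set (range_basis (blinfun_apply F))"])

lemma finite_rank_opsE:
  assumes "F \<in> finite_rank_ops"
  obtains bs where "basis_list bs" "lspan bs = range (blinfun_apply F)" "F \<in> bounded_ops"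
proof -
  obtain B where "F \<in> bounded_ops" "finite B" "range (blinfun_apply F) = complex_vs.span B"
    using assms by (auto simp: finite_rank_ops_def)
  then show ?thesis using range_basis_works[OF clinear_map_bounded_ops[of F], of B] that by auto
qed

lemma finite_rank_bounded_ops: "F \<in> finite_rank_ops \<Longrightarrow> F \<in> bounded_ops"
  by (simp add: finite_rank_ops_def)

lemma cfunctional_coord:
  assumes bs: "basis_list bs" and F: "F \<in> bounded_ops" and sub: "range (blinfun_apply F) \<subseteq> lspan bs" and i: "i < length bs"
  shows "cfunctional (\<lambda>x. coord bs i (F x))"
proof -
  obtain K where K: "\<And>x i. x \<in> lspan bs \<Longrightarrow> i < length bs \<Longrightarrow> norm (coord bs i x) \<le> norm x * K"
    using coord_bounded[OF bs] by blast
  have mem: "F x \<in> lspan bs" for x using sub by auto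
  have "norm (coord bs i (F x)) \<le> norm x * (norm F * \<bar>K\<bar>)" for x
  proof -
    have "norm (coord bs i (F x)) \<le> norm (F x) * K" by (rule K[OF mem i])
    also have "\<dots> \<le> norm (F x) * \<bar>K\<bar>" by (intro mult_left_mono) auto
    also have "\<dots> \<le> (norm F * norm x) * \<bar>K\<bar>" by (intro mult_right_mono norm_blinfun) auto
    finally show ?thesis by (simp add: mult_ac)
  qed
  then show ?thesis
    unfolding cfunctional_def
    by (auto simp: blinfun.add_right coord_add[OF bs] coord_scale[OF bs] mem bounded_opsD[OF F])
qed

lemma det_mat_holomorphic:
  assumes "\<And>i j. i < m \<Longrightarrow> j < m \<Longrightarrow> e i j holomorphic_on S"
  shows "(\<lambda>z. Determinant.det (mat m m (\<lambda>(i, j). e i j z))) holomorphic_on S"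
proof -
  have pi: "p i < m" if "p permutes {0..<m}" "i < m" for p i
    using permutes_in_image[OF that(1), of i] that(2) by simp
  have "(\<lambda>z. \<Sum>p\<in>{p. p permutes {0..<m}}. signof p * (\<Prod>i = 0..<m. e i (p i) z)) holomorphic_on S"
    by (intro holomorphic_intros assms) (auto simp: pi)
  moreover have "Determinant.det (mat m m (\<lambda>(i, j). e i j z)) = (\<Sum>p\<in>{p. p permutes {0..<m}}. signof p * (\<Prod>i = 0..<m. e i (p i) z))" for z
    unfolding Determinant.det_def by (auto intro!: sum.cong prod.cong simp: pi)
  ultimately show ?thesis by simp
qed

definition rank_one :: "('a::cbanach \<Rightarrow> complex) \<Rightarrow> 'a \<Rightarrow> 'a \<Rightarrow>\<^sub>L 'a" where
  "rank_one \<phi> b = Blinfun (\<lambda>x. \<phi> x *\<^sub>C b)"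

lemma rank_one_apply: "cfunctional \<phi> \<Longrightarrow> rank_one \<phi> b x = \<phi> x *\<^sub>C b"
  unfolding rank_one_def
  by (subst bounded_linear_Blinfun_apply)
    (auto intro: bounded_linear_compose[OF bounded_bilinear.bounded_linear_left[OF bounded_bilinear_scaleC]] cfunctional_bounded_linear)

lemma rank_one_bounded_ops: "cfunctional \<phi> \<Longrightarrow> rank_one \<phi> b \<in> bounded_ops"
  by (auto simp: bounded_ops_def rank_one_apply scaleC_scaleC) (simp add: cfunctional_def)

lemma norm_rank_one:
  assumes "cfunctional \<phi>" "\<And>x. norm (\<phi> x) \<le> norm x * K" "K \<ge> 0"
  shows "norm (rank_one \<phi> b) \<le> K * norm b"
proof (rule norm_blinfun_bound)
  fix x
  have "norm (\<phi> x) * norm b \<le> (norm x * K) * norm b" by (intro mult_right_mono assms) auto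
  then show "norm (rank_one \<phi> b x) \<le> K * norm b * norm x"
    by (simp add: rank_one_apply[OF assms(1)] norm_scaleC mult_ac)
qed (use assms in auto)

lemma cfunctional_compose:
  assumes "cfunctional \<phi>" "A \<in> bounded_ops" shows "cfunctional (\<lambda>x. \<phi> (blinfun_apply A x))"
proof -
  obtain K where K: "\<And>x. norm (\<phi> x) \<le> norm x * K" using assms(1) unfolding cfunctional_def by blast
  have "norm (\<phi> (A x)) \<le> norm x * (norm A * \<bar>K\<bar>)" for x
  proof -
    have "norm (\<phi> (A x)) \<le> norm (A x) * K" by (rule K)
    also have "\<dots> \<le> norm (A x) * \<bar>K\<bar>" by (intro mult_left_mono) auto
    also have "\<dots> \<le> (norm A * norm x) * \<bar>K\<bar>" by (intro mult_right_mono norm_blinfun) auto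
    finally show ?thesis by (simp add: mult_ac)
  qed
  then show ?thesis using assms unfolding cfunctional_def by (auto simp: blinfun.add_right bounded_opsD)
qed

lemma cfunctional_sum: "cfunctional \<phi> \<Longrightarrow> \<phi> (\<Sum>i\<in>I. c i *\<^sub>C x i) = (\<Sum>i\<in>I. c i * \<phi> (x i))"
  using linear_sum[OF bounded_linear.linear[OF cfunctional_bounded_linear], of \<phi> "\<lambda>i. c i *\<^sub>C x i" I]
  by (simp add: cfunctional_def)

lemma finite_rank_expansion:
  assumes "F \<in> finite_rank_ops"
  obtains m :: nat and \<phi> b where "\<And>i. i < m \<Longrightarrow> cfunctional (\<phi> i)"
    "\<And>x. blinfun_apply F x = (\<Sum>i<m. \<phi> i x *\<^sub>C b i)"
proof -
  obtain bs where bs: "basis_list bs" "lspan bs = range (blinfun_apply F)" "F \<in> bounded_ops"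
    by (rule finite_rank_opsE[OF assms])
  have "cfunctional (\<lambda>x. coord bs i (F x))" if "i < length bs" for i
    using cfunctional_coord[OF bs(1,3) _ that] bs(2) by simp
  moreover have "F x = (\<Sum>i<length bs. coord bs i (F x) *\<^sub>C bs ! i)" for x
    using coord_expand[OF bs(1), of "F x"] bs(2) by simp
  ultimately show ?thesis using that[of "length bs" "\<lambda>i x. coord bs i (F x)" "\<lambda>i. bs ! i"] by simp
qed

lemma sum_indicator_mult:
  fixes f :: "nat \<Rightarrow> complex"
  assumes "k < m" shows "(\<Sum>j<m. (if k = j then a else 0) * f j) = a * f k"
proof -
  have "(\<Sum>j<m. (if k = j then a else 0) * f j) = (\<Sum>j<m. if j = k then a * f j else 0)"
    by (intro sum.cong) auto
  then show ?thesis using assms by (simp add: sum.delta)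
qed

text \<open>
  Outside the disc of radius \<open>\<parallel>L - F\<parallel>\<close> the operator \<open>z - (L - F)\<close> is invertible by a Neumann series, so that
  \<open>z - L = (z - (L - F)) - F\<close> is invertible up to a finite dimensional problem. \<open>G\<close> is the resolvent of
  \<open>L - F\<close> on this region \<open>\<Omega>\<close>.
\<close>

locale finite_rank_perturbation =
  fixes L F :: "'a::cbanach \<Rightarrow>\<^sub>L 'a" and \<mu> :: complex
  assumes L: "L \<in> bounded_ops" and F: "F \<in> finite_rank_ops" and small: "norm (L - F) < norm \<mu>"
begin

definition \<Omega> :: "complex set" where "\<Omega> = {z. norm (L - F) < norm z}"
definition G :: "complex \<Rightarrow> 'a \<Rightarrow>\<^sub>L 'a" where "G = op_resolvent (L - F)"

lemma Rb: "L - F \<in> bounded_ops"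
  using L F by (auto simp: finite_rank_ops_def)

lemma \<Omega>_open: "open \<Omega>"
  unfolding \<Omega>_def by (intro open_Collect_less continuous_intros)

lemma \<Omega>_connected: "connected \<Omega>"
proof -
  have "\<Omega> = - cball 0 (norm (L - F))" by (auto simp: \<Omega>_def)
  show ?thesis unfolding \<open>\<Omega> = _\<close> by (rule connected_complement_bounded_convex) auto
qed

lemma \<mu>_\<Omega>: "\<mu> \<in> \<Omega>" using small by (simp add: \<Omega>_def)

lemma G: "z \<in> \<Omega> \<Longrightarrow> is_resolvent_at (L - F) z (G z)"
  unfolding G_def by (intro op_resolvent_works resolvent_outside Rb) (simp add: \<Omega>_def)

lemma G_bounded_ops: "z \<in> \<Omega> \<Longrightarrow> G z \<in> bounded_ops"
  using G resolvent_bounded_ops by blast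

lemma G_right: "z \<in> \<Omega> \<Longrightarrow> z *\<^sub>C G z x - L (G z x) = x - F (G z x)"
  using resolvent_right[OF G, of z x] by (simp add: blinfun.diff_left algebra_simps)

lemma G_left: "z \<in> \<Omega> \<Longrightarrow> G z (z *\<^sub>C x - L x) = x - G z (F x)"
  using resolvent_left[OF G, of z x] by (simp add: blinfun.diff_left blinfun.diff_right blinfun.add_right algebra_simps)

lemma G_isCont: "z \<in> \<Omega> \<Longrightarrow> isCont G z"
  unfolding G_def by (intro resolvent_isCont Rb resolvent_outside) (simp add: \<Omega>_def)

lemma functional_G_holomorphic:
  assumes "cfunctional \<phi>" shows "(\<lambda>z::complex. \<phi> (G z x)) holomorphic_on \<Omega>"
proof (subst holomorphic_on_open[OF \<Omega>_open], intro ballI)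
  fix z assume z: "z \<in> \<Omega>"
  have "(G has_derivative (\<lambda>h. h *\<^sub>C (- (G z o\<^sub>L G z)))) (at z)"
    unfolding G_def by (rule resolvent_has_derivative[OF Rb resolvent_outside[OF Rb]]) (use z in \<open>simp add: \<Omega>_def\<close>)
  from bounded_linear.has_derivative[OF bounded_linear_compose[OF cfunctional_bounded_linear[OF assms]
      bounded_bilinear.bounded_linear_left[OF bounded_bilinear_blinfun_apply, of x]] this]
  have "((\<lambda>z::complex. \<phi> (G z x)) has_derivative (\<lambda>h. h * \<phi> (- G z (G z x)))) (at z)"
    using assms by (simp only: scaleC_blinfun_apply blinfun.minus_left blinfun_apply_blinfun_compose cfunctional_def)
  then show "\<exists>f'. ((\<lambda>z::complex. \<phi> (G z x)) has_field_derivative f') (at z)"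
    by (auto simp: has_field_derivative_def mult_commute_abs)
qed

text \<open>
  With \<open>y = (L - \<mu>) x\<close> one has \<open>x = G(\<mu>) (F x - y)\<close>, and inductively \<open>y\<close> ranges over a finite
  dimensional space.
\<close>

lemma kernel_power_finite_dim: "\<exists>Y. finite Y \<and> {x. (blinfun_apply (L - \<mu> *\<^sub>C id_blinfun) ^^ N) x = 0} \<subseteq> complex_vs.span Y"
proof (induction N)
  case 0
  show ?case by (intro exI[of _ "{}"]) (auto simp: complex_vs.span_empty)
next
  case (Suc N)
  then obtain Y where Y: "finite Y" "{x. (blinfun_apply (L - \<mu> *\<^sub>C id_blinfun) ^^ N) x = 0} \<subseteq> complex_vs.span Y" by blast
  obtain B where B: "finite B" "range (blinfun_apply F) = complex_vs.span B" using F by (auto simp: finite_rank_ops_def)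
  have img: "G \<mu> y \<in> complex_vs.span (blinfun_apply (G \<mu>) ` S)" if "y \<in> complex_vs.span S" for y S
    using that
  proof (induction rule: complex_vs.span_induct_alt)
    case base
    show ?case by (simp add: complex_vs.span_zero)
  next
    case (step c x y)
    have "G \<mu> (c *\<^sub>C x + y) = c *\<^sub>C G \<mu> x + G \<mu> y"
      by (simp add: blinfun.add_right bounded_opsD[OF G_bounded_ops[OF \<mu>_\<Omega>]])
    then show ?case
      using step by (simp add: complex_vs.span_add complex_vs.span_scale complex_vs.span_base)
  qed
  have "x \<in> complex_vs.span (blinfun_apply (G \<mu>) ` (B \<union> Y))"
    if "(blinfun_apply (L - \<mu> *\<^sub>C id_blinfun) ^^ Suc N) x = 0" for x
  proof -
    define y where "y = (L - \<mu> *\<^sub>C id_blinfun) x"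
    have "y \<in> complex_vs.span Y" using that Y(2) by (auto simp: y_def funpow_swap1)
    then have 1: "y \<in> complex_vs.span (B \<union> Y)" using complex_vs.span_mono[of Y "B \<union> Y"] by auto
    have 2: "F x \<in> complex_vs.span (B \<union> Y)" using B(2) complex_vs.span_mono[of B "B \<union> Y"] by auto
    have "x = G \<mu> (F x) + G \<mu> (\<mu> *\<^sub>C x - L x)" using G_left[OF \<mu>_\<Omega>, of x] by simp
    also have "\<mu> *\<^sub>C x - L x = - y" by (simp add: y_def blinfun.diff_left)
    finally have x: "x = G \<mu> (F x - y)" by (simp add: blinfun.diff_right blinfun.minus_right)
    have "G \<mu> (F x - y) \<in> complex_vs.span (blinfun_apply (G \<mu>) ` (B \<union> Y))"
      by (rule img[OF complex_vs.span_diff[OF 2 1]])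
    then show ?thesis using x by simp
  qed
  then show ?case using B(1) Y(1) by (intro exI[of _ "blinfun_apply (G \<mu>) ` (B \<union> Y)"]) auto
qed

text \<open>
  Writing \<open>F = \<Sum> \<phi>\<^sub>i(\<cdot>) b\<^sub>i\<close>, the operator \<open>1 - F G(z)\<close> is governed by the \<open>m \<times> m\<close> matrix
  \<open>A(z) = (\<delta>\<^sub>i\<^sub>j - \<phi>\<^sub>i(G(z) b\<^sub>j))\<close>, which is holomorphic in \<open>z\<close>. Where \<open>d = det A\<close> does not vanish, Cramer's rule
  gives the resolvent of \<open>L\<close> explicitly, with denominator \<open>d\<close>; where it vanishes, a kernel vector of \<open>A(z)\<close>
  gives an eigenvector of \<open>L\<close>. As \<open>d\<close> does not vanish identically on the connected set \<open>\<Omega>\<close>, its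
  zero at \<open>\<mu>\<close>, if any, has finite order, which bounds the order of the pole of the resolvent.
\<close>

lemma analytic_fredholm:
  obtains N C \<delta> where "\<delta> > 0" "\<And>z. z \<noteq> \<mu> \<Longrightarrow> norm (z - \<mu>) < \<delta> \<Longrightarrow> z \<notin> op_spectrum L"
    "eventually (\<lambda>z. norm ((z - \<mu>) ^ N *\<^sub>C op_resolvent L z) \<le> C) (at \<mu>)"
    "\<mu> \<in> op_spectrum L \<Longrightarrow> \<exists>x. x \<noteq> 0 \<and> L x = \<mu> *\<^sub>C x"
proof -
  obtain m :: nat and \<phi> b where \<phi>: "\<And>i. i < m \<Longrightarrow> cfunctional (\<phi> i)" and Fx: "\<And>x. blinfun_apply F x = (\<Sum>i<m. \<phi> i x *\<^sub>C b i)"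
    using finite_rank_expansion[OF F] by blast
  define e where "e i j z = (if i = j then 1 else 0) - \<phi> i (G z (b j))" for i j z
  define A where "A z = mat m m (\<lambda>(i, j). e i j z)" for z
  define d where "d z = Determinant.det (A z)" for z
  have A: "A z \<in> carrier_mat m m" for z by (simp add: A_def)
  have ehol: "e i j holomorphic_on \<Omega>" if "i < m" for i j
    unfolding e_def by (intro holomorphic_intros functional_G_holomorphic \<phi> that)
  have dhol: "d holomorphic_on \<Omega>"
    unfolding d_def A_def by (rule det_mat_holomorphic) (use ehol in auto)
  have GF: "G z (F x) = (\<Sum>i<m. \<phi> i x *\<^sub>C G z (b i))" if "z \<in> \<Omega>" for z x
    unfolding Fx blinfun.sum_right by (simp add: bounded_opsD[OF G_bounded_ops[OF that]])
  have zL: "z *\<^sub>C G z x - L (G z x) = x - (\<Sum>k<m. \<phi> k (G z x) *\<^sub>C b k)" if "z \<in> \<Omega>" for z x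
    using G_right[OF that, of x] by (simp add: Fx)
  have eigen: "\<exists>x. x \<noteq> 0 \<and> L x = z *\<^sub>C x" if z: "z \<in> \<Omega>" and d0: "d z = 0" for z
  proof -
    obtain v where v: "v \<in> carrier_vec m" "v \<noteq> 0\<^sub>v m" "A z *\<^sub>v v = 0\<^sub>v m"
      using det_0_iff_vec_prod_zero_field[OF A[of z]] d0 by (auto simp: d_def)
    obtain i0 where i0: "i0 < m" "vec_index v i0 \<noteq> 0"
      using v(1,2) by (metis carrier_vecD eq_vecI index_zero_vec(1) zero_carrier_vec)
    define u where "u = (\<Sum>j<m. vec_index v j *\<^sub>C b j)"
    have comb: "(\<Sum>j<m. e i j z * vec_index v j) = 0" if "i < m" for i
    proof -
      have "vec_index (A z *\<^sub>v v) i = 0" using v(3) that by simp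
      then show ?thesis using that v(1) by (simp add: A_def scalar_prod_def lessThan_atLeast0)
    qed
    have \<phi>u: "\<phi> i (G z u) = vec_index v i" if "i < m" for i
    proof -
      have "\<phi> i (G z u) = (\<Sum>j<m. vec_index v j * \<phi> i (G z (b j)))"
        unfolding u_def using cfunctional_sum[OF cfunctional_compose[OF \<phi>[OF that] G_bounded_ops[OF z]]] .
      moreover have "(\<Sum>j<m. e i j z * vec_index v j) = vec_index v i - (\<Sum>j<m. vec_index v j * \<phi> i (G z (b j)))"
      proof -
        have "(\<Sum>j<m. (if i = j then 1 else 0) * vec_index v j) = vec_index v i"
          using that by (simp add: sum_indicator_mult)
        moreover have "(\<Sum>j<m. \<phi> i (G z (b j)) * vec_index v j) = (\<Sum>j<m. vec_index v j * \<phi> i (G z (b j)))"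
          by (simp only: mult.commute)
        ultimately show ?thesis by (simp only: e_def left_diff_distrib sum_subtractf)
      qed
      ultimately show ?thesis using comb[OF that] by simp
    qed
    have "z *\<^sub>C G z u - L (G z u) = 0"
      unfolding zL[OF z] by (simp add: \<phi>u) (simp add: u_def)
    moreover have "G z u \<noteq> 0"
    proof
      assume "G z u = 0"
      then have "\<phi> i0 0 = vec_index v i0" using \<phi>u[OF i0(1)] by simp
      moreover have "\<phi> i0 0 = 0" using \<phi>[OF i0(1)] cfunctional_bounded_linear linear_simps(3) by blast
      ultimately show False using i0(2) by simp
    qed
    ultimately show ?thesis by (intro exI[of _ "G z u"]) simp
  qed
  (* Norm bounds of the functionals, for the size of the rank one terms in the resolvent. *)
  define K where "K i = (SOME K. \<forall>x. norm (\<phi> i x) \<le> norm x * K)" for i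
  have K: "norm (\<phi> i x) \<le> norm x * \<bar>K i\<bar>" if "i < m" for i x
  proof -
    have "\<exists>K. \<forall>x. norm (\<phi> i x) \<le> norm x * K" using \<phi>[OF that] by (simp add: cfunctional_def)
    then have "norm (\<phi> i x) \<le> norm x * K i" unfolding K_def by (rule someI2_ex) blast
    also have "\<dots> \<le> norm x * \<bar>K i\<bar>" by (intro mult_left_mono) auto
    finally show ?thesis .
  qed
  define adj where "adj i j z = adj_mat (A z) $$ (i, j)" for i j z
  have adj_hol: "adj i j holomorphic_on \<Omega>" if ij: "i < m" "j < m" for i j
  proof -
    let ?s = "\<lambda>i' j' z. e (if i' < j then i' else Suc i') (if j' < i then j' else Suc j') z"
    have "(\<lambda>z. (- 1) ^ (j + i) * Determinant.det (mat (m - 1) (m - 1) (\<lambda>(i', j'). ?s i' j' z))) holomorphic_on \<Omega>"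
      by (intro holomorphic_intros det_mat_holomorphic ehol) auto
    moreover have "mat_delete (A z) j i = mat (m - 1) (m - 1) (\<lambda>(i', j'). ?s i' j' z)" for z
      by (rule eq_matI) (use ij in \<open>auto simp: mat_delete_def A_def\<close>)
    ultimately show ?thesis
      using ij by (simp add: adj_def[abs_def] adj_mat_def cofactor_def A_def[abs_def])
  qed
  have adjA: "(\<Sum>k<m. adj i k z * e k j z) = (if i = j then d z else 0)"
    and Aadj: "(\<Sum>k<m. e i k z * adj k j z) = (if i = j then d z else 0)" if ij: "i < m" "j < m" for i j z
  proof -
    note am = adj_mat[OF A[of z]]
    have "(adj_mat (A z) * A z) $$ (i, j) = (if i = j then d z else 0)"
      using am(3) ij by (simp add: d_def)
    then show "(\<Sum>k<m. adj i k z * e k j z) = (if i = j then d z else 0)"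
      using ij am(1) by (simp add: scalar_prod_def adj_def A_def lessThan_atLeast0)
    have "(A z * adj_mat (A z)) $$ (i, j) = (if i = j then d z else 0)"
      using am(2) ij by (simp add: d_def)
    then show "(\<Sum>k<m. e i k z * adj k j z) = (if i = j then d z else 0)"
      using ij am(1) by (simp add: scalar_prod_def adj_def A_def lessThan_atLeast0)
  qed
  (* The Woodbury formula for the inverse of (z - (L - F)) - F: G + G B A^(-1) Phi G, where B and Phi
     are built from the vectors b i and the functionals and A^(-1) is adj / d. *)
  define V where "V z = G z + (\<Sum>i<m. \<Sum>j<m. rank_one (\<lambda>x. \<phi> j (G z x)) ((adj i j z / d z) *\<^sub>C G z (b i)))" for z
  have cf: "cfunctional (\<lambda>x. \<phi> j (G z x))" if "z \<in> \<Omega>" "j < m" for z j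
    by (rule cfunctional_compose[OF \<phi>[OF that(2)] G_bounded_ops[OF that(1)]])
  have Vx: "V z x = G z (x + (\<Sum>i<m. (\<Sum>j<m. (adj i j z / d z) * \<phi> j (G z x)) *\<^sub>C b i))" if z: "z \<in> \<Omega>" for z x
  proof -
    have "V z x = G z x + (\<Sum>i<m. \<Sum>j<m. \<phi> j (G z x) *\<^sub>C (adj i j z / d z) *\<^sub>C G z (b i))"
      unfolding V_def by (simp add: blinfun.add_left blinfun.sum_left rank_one_apply[OF cf[OF z]])
    also have "\<dots> = G z x + (\<Sum>i<m. (\<Sum>j<m. (adj i j z / d z) * \<phi> j (G z x)) *\<^sub>C G z (b i))"
      by (simp add: complex_vs.scale_sum_left scaleC_scaleC mult.commute)
    finally show ?thesis
      by (simp add: blinfun.add_right blinfun.sum_right bounded_opsD[OF G_bounded_ops[OF z]])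
  qed
  have resolv: "is_resolvent_at L z (V z)" if z: "z \<in> \<Omega>" and dz: "d z \<noteq> 0" for z
  proof (rule is_resolventI)
    show "V z \<in> bounded_ops"
      unfolding V_def by (intro bounded_ops_add bounded_ops_sum rank_one_bounded_ops cf z G_bounded_ops) auto
    fix x
    define c where "c y i = (\<Sum>j<m. (adj i j z / d z) * \<phi> j (G z y))" for y i
    have Vc: "V z y = G z (y + (\<Sum>i<m. c y i *\<^sub>C b i))" for y using Vx[OF z] by (simp add: c_def)
    have \<phi>sum: "\<phi> k (G z (y + (\<Sum>i<m. a i *\<^sub>C b i))) = \<phi> k (G z y) + (\<Sum>i<m. a i * \<phi> k (G z (b i)))" if "k < m" for k y a
      using cfunctional_sum[OF cf[OF z that], of a b "{..<m}"] cf[OF z that] by (simp add: cfunctional_def)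
    have esum: "(\<Sum>i<m. a i * \<phi> k (G z (b i))) = a k - (\<Sum>i<m. e k i z * a i)" if "k < m" for k and a :: "nat \<Rightarrow> complex"
    proof -
      have "(\<Sum>i<m. (if k = i then 1 else 0) * a i) = a k"
        using that by (simp add: sum_indicator_mult)
      moreover have "(\<Sum>i<m. \<phi> k (G z (b i)) * a i) = (\<Sum>i<m. a i * \<phi> k (G z (b i)))"
        by (simp only: mult.commute)
      ultimately show ?thesis by (simp add: e_def left_diff_distrib sum_subtractf del: sum.delta sum.delta' mult_delta_left)
    qed
    have ec: "(\<Sum>i<m. e k i z * c x i) = \<phi> k (G z x)" if "k < m" for k x
    proof -
      have "(\<Sum>i<m. e k i z * c x i) = (\<Sum>i<m. \<Sum>j<m. (e k i z * adj i j z) * (\<phi> j (G z x) / d z))"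
        by (simp add: c_def sum_distrib_left mult_ac)
      also have "\<dots> = (\<Sum>j<m. (\<Sum>i<m. e k i z * adj i j z) * (\<phi> j (G z x) / d z))"
        by (subst sum.swap) (simp only: sum_distrib_right)
      also have "\<dots> = (\<Sum>j<m. (if k = j then d z else 0) * (\<phi> j (G z x) / d z))"
        by (intro sum.cong) (use Aadj that in auto)
      also have "\<dots> = \<phi> k (G z x)"
        using that dz by (simp only: sum_indicator_mult) simp
      finally show ?thesis .
    qed
    have "z *\<^sub>C V z x - L (V z x) = x + (\<Sum>i<m. c x i *\<^sub>C b i) - (\<Sum>k<m. (\<phi> k (G z x) + (c x k - \<phi> k (G z x))) *\<^sub>C b k)"
      unfolding Vc zL[OF z] by (simp add: \<phi>sum esum ec)
    then show "z *\<^sub>C V z x - L (V z x) = x" by simp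
    define y where "y = z *\<^sub>C x - L x"
    have Gy: "G z y = x - G z (F x)" unfolding y_def by (rule G_left[OF z])
    have \<phi>Gy: "\<phi> k (G z y) = (\<Sum>i<m. e k i z * \<phi> i x)" if "k < m" for k
    proof -
      have "\<phi> k (G z y) = \<phi> k x - \<phi> k (G z (F x))"
        unfolding Gy using linear_diff[OF bounded_linear.linear[OF cfunctional_bounded_linear[OF \<phi>[OF that]]]] .
      also have "\<phi> k (G z (F x)) = (\<Sum>i<m. \<phi> i x * \<phi> k (G z (b i)))"
        unfolding GF[OF z] by (rule cfunctional_sum[OF \<phi>[OF that]])
      finally show ?thesis using esum[OF that, of "\<lambda>i. \<phi> i x"] by simp
    qed
    have "c y i = \<phi> i x" if "i < m" for i
    proof -
      have "c y i = (\<Sum>j<m. \<Sum>k<m. (adj i j z * e j k z) * (\<phi> k x / d z))"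
        by (simp add: c_def \<phi>Gy sum_distrib_left mult_ac)
      also have "\<dots> = (\<Sum>k<m. (\<Sum>j<m. adj i j z * e j k z) * (\<phi> k x / d z))"
        by (subst sum.swap) (simp only: sum_distrib_right)
      also have "\<dots> = (\<Sum>k<m. (if i = k then d z else 0) * (\<phi> k x / d z))"
        by (intro sum.cong) (use adjA that in auto)
      also have "\<dots> = \<phi> i x"
        using that dz by (simp only: sum_indicator_mult) simp
      finally show ?thesis .
    qed
    then have "V z y = G z y + G z (F x)" unfolding Vc by (simp add: Fx blinfun.add_right)
    then show "V z (z *\<^sub>C x - L x) = x" using Gy by (simp add: y_def)
  qed
  (* Beyond the norm of L there are no eigenvalues, so d is not identically zero. *)
  define z1 where "z1 = complex_of_real (norm L + norm (L - F) + 1)"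
  have "norm z1 = norm L + norm (L - F) + 1"
    unfolding z1_def norm_of_real by (intro abs_of_nonneg add_nonneg_nonneg) auto
  then have z1: "norm z1 > norm L" "norm z1 > norm (L - F)"
    using norm_ge_zero[of L] norm_ge_zero[of "L - F"] by (linarith, linarith)
  have "d z1 \<noteq> 0"
  proof
    assume "d z1 = 0"
    then obtain x where x: "x \<noteq> 0" "L x = z1 *\<^sub>C x" using eigen[of z1] z1 by (auto simp: \<Omega>_def)
    have "norm z1 * norm x \<le> norm L * norm x" using norm_blinfun[of L x] x by (simp add: norm_scaleC)
    then show False using x(1) z1(1) by simp
  qed
  then have "\<exists>w\<in>\<Omega>. d w \<noteq> 0" using z1 by (auto simp: \<Omega>_def)
  from zorder_exist_zero[OF dhol \<Omega>_open \<Omega>_connected \<mu>_\<Omega> this]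
  obtain r0 where r0: "r0 > 0" "cball \<mu> r0 \<subseteq> \<Omega>" "zor_poly d \<mu> holomorphic_on cball \<mu> r0"
    "\<And>w. w \<in> cball \<mu> r0 \<Longrightarrow> d w = zor_poly d \<mu> w * (w - \<mu>) ^ nat (zorder d \<mu>) \<and> zor_poly d \<mu> w \<noteq> 0" by blast
  define N where "N = nat (zorder d \<mu>)"
  define k where "k = zor_poly d \<mu>"
  have dk: "d w = k w * (w - \<mu>) ^ N" "k w \<noteq> 0" if "w \<in> cball \<mu> r0" for w using r0(4)[OF that] by (auto simp: k_def N_def)
  have out: "z \<notin> op_spectrum L" if "z \<noteq> \<mu>" "norm (z - \<mu>) < r0" for z
  proof -
    have "z \<in> cball \<mu> r0" using that by (simp add: dist_norm norm_minus_commute)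
    then have "z \<in> \<Omega>" "d z \<noteq> 0" using dk r0(2) that by auto
    then show ?thesis using resolv not_in_spectrumI by blast
  qed
  (* A bound for (z - \<mu>)^N times the resolvent that stays continuous at \<mu>, as the factor
     (z - \<mu>)^N cancels the zero of d. *)
  define H where "H z = norm (z - \<mu>) ^ N * norm (G z) + (\<Sum>i<m. \<Sum>j<m. norm (adj i j z / k z) * norm (G z (b i)) * (norm (G z) * \<bar>K j\<bar>))" for z
  have bound: "norm ((z - \<mu>) ^ N *\<^sub>C op_resolvent L z) \<le> H z" if z: "z \<in> cball \<mu> r0" "z \<noteq> \<mu>" for z
  proof -
    have z\<Omega>: "z \<in> \<Omega>" using z r0(2) by auto
    have "d z \<noteq> 0" using dk[OF z(1)] z(2) by simp
    then have R: "op_resolvent L z = V z" using resolv[OF z\<Omega>] op_resolventI by blast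
    have r1: "norm (rank_one (\<lambda>x. \<phi> j (G z x)) ((adj i j z / d z) *\<^sub>C G z (b i))) \<le> (norm (G z) * \<bar>K j\<bar>) * (norm (adj i j z / d z) * norm (G z (b i)))"
      if "i < m" "j < m" for i j
    proof -
      have "norm (\<phi> j (G z x)) \<le> norm x * (norm (G z) * \<bar>K j\<bar>)" for x
      proof -
        have "norm (\<phi> j (G z x)) \<le> norm (G z x) * \<bar>K j\<bar>" by (rule K[OF that(2)])
        also have "\<dots> \<le> (norm (G z) * norm x) * \<bar>K j\<bar>" by (intro mult_right_mono norm_blinfun) auto
        finally show ?thesis by (simp add: mult_ac)
      qed
      from norm_rank_one[OF cf[OF z\<Omega> that(2)] this, of "(adj i j z / d z) *\<^sub>C G z (b i)"]
      show ?thesis by (simp add: norm_scaleC)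
    qed
    have "norm (V z) \<le> norm (G z) + (\<Sum>i<m. \<Sum>j<m. (norm (G z) * \<bar>K j\<bar>) * (norm (adj i j z / d z) * norm (G z (b i))))"
      unfolding V_def
      by (rule order_trans[OF norm_triangle_ineq add_left_mono[OF order_trans[OF norm_sum sum_mono[OF order_trans[OF norm_sum sum_mono]]]]])
        (use r1 in auto)
    then have "norm ((z - \<mu>) ^ N *\<^sub>C op_resolvent L z) \<le> norm (z - \<mu>) ^ N * (norm (G z) + (\<Sum>i<m. \<Sum>j<m. (norm (G z) * \<bar>K j\<bar>) * (norm (adj i j z / d z) * norm (G z (b i)))))"
      unfolding R norm_scaleC norm_power by (intro mult_left_mono) auto
    also have "\<dots> = H z"
    proof -
      have cancel: "norm (z - \<mu>) ^ N * norm (adj i j z / d z) = norm (adj i j z / k z)" for i j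
        using dk[OF z(1)] z(2) by (simp add: norm_divide norm_mult norm_power)
      have ac: "a * ((g * c) * (w * y)) = (a * w) * y * (g * c)" for a g c w y :: real
        by (simp only: mult_ac)
      have "norm (z - \<mu>) ^ N * ((norm (G z) * \<bar>K j\<bar>) * (norm (adj i j z / d z) * norm (G z (b i))))
          = norm (adj i j z / k z) * norm (G z (b i)) * (norm (G z) * \<bar>K j\<bar>)" for i j
        unfolding ac cancel ..
      then show ?thesis by (simp only: H_def distrib_left sum_distrib_left)
    qed
    finally show ?thesis .
  qed
  have "isCont H \<mu>"
  proof -
    have "isCont (adj i j) \<mu>" if "i < m" "j < m" for i j
      using holomorphic_on_imp_continuous_on[OF adj_hol[OF that]] \<Omega>_open \<mu>_\<Omega> by (simp add: continuous_on_eq_continuous_at)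
    moreover have "isCont k \<mu>"
    proof -
      have "continuous_on (ball \<mu> r0) k"
        unfolding k_def by (rule holomorphic_on_imp_continuous_on[OF holomorphic_on_subset[OF r0(3)]]) auto
      then show ?thesis using r0(1) by (simp add: continuous_on_eq_continuous_at)
    qed
    moreover have "k \<mu> \<noteq> 0" using dk(2)[of \<mu>] r0(1) by simp
    moreover have "isCont G \<mu>" by (rule G_isCont[OF \<mu>_\<Omega>])
    moreover have "isCont (\<lambda>z. G z x) \<mu>" for x
      using bounded_bilinear.tendsto[OF bounded_bilinear_blinfun_apply _ tendsto_const, of G "G \<mu>" "at \<mu>" x] G_isCont[OF \<mu>_\<Omega>]
      by (simp add: isCont_def)
    ultimately show ?thesis
      unfolding H_def
      by (intro continuous_intros) auto
  qed
  then have "(H \<longlongrightarrow> H \<mu>) (at \<mu>)" by (simp add: isCont_def)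
  then have "eventually (\<lambda>z. H z < H \<mu> + 1) (at \<mu>)" by (rule order_tendstoD) simp
  moreover have "eventually (\<lambda>z. z \<in> ball \<mu> r0 - {\<mu>}) (at \<mu>)"
    using r0(1) by (intro eventually_at_in_open) auto
  ultimately have "eventually (\<lambda>z. norm ((z - \<mu>) ^ N *\<^sub>C op_resolvent L z) \<le> H \<mu> + 1) (at \<mu>)"
  proof eventually_elim
    case (elim z)
    then have "norm ((z - \<mu>) ^ N *\<^sub>C op_resolvent L z) \<le> H z" by (intro bound) auto
    then show ?case using elim(1) by linarith
  qed
  moreover have "\<exists>x. x \<noteq> 0 \<and> L x = \<mu> *\<^sub>C x" if "\<mu> \<in> op_spectrum L"
  proof (rule eigen[OF \<mu>_\<Omega>])
    show "d \<mu> = 0" using resolv[OF \<mu>_\<Omega>] that not_in_spectrumI by blast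
  qed
  ultimately show ?thesis using that r0(1) out by blast
qed

end

section \<open>Bounding an entire function by its zeros\<close>

text \<open>
  Schwarz's lemma for a zero of order \<open>n\<close>: apply the maximum principle to \<open>\<phi>(z) / z\<^sup>n\<close>.
\<close>

lemma schwarz_vanishing:
  fixes \<phi> :: "complex \<Rightarrow> complex"
  assumes hol: "\<phi> holomorphic_on ball 0 r" and bd: "\<And>z. z \<in> ball 0 r \<Longrightarrow> norm (\<phi> z) \<le> M"
    and van: "eventually (\<lambda>z. norm (\<phi> z) \<le> C * norm z ^ n) (nhds 0)" and w: "w \<in> ball 0 r"
  shows "norm (\<phi> w) \<le> M * (norm w / r) ^ n"
proof (cases "w = 0")
  case True
  show ?thesis
  proof (cases "n = 0")
    case False
    then show ?thesis using eventually_nhds_x_imp_x[OF van] True by (simp add: power_0_left)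
  qed (use bd[OF w] in simp)
next
  case False
  have wr: "norm w < r" using w by simp
  then have r: "r > 0" "norm w < r" using norm_ge_zero[of w] by (auto simp del: norm_ge_zero)
  define \<psi>0 where "\<psi>0 = (\<lambda>z. \<phi> z / z ^ n)"
  have hol0: "\<psi>0 holomorphic_on ball 0 r - {0}"
    unfolding \<psi>0_def by (intro holomorphic_intros holomorphic_on_subset[OF hol]) auto
  have "eventually (\<lambda>z. norm (\<psi>0 z) \<le> C) (at 0)"
  proof -
    have "eventually (\<lambda>z. norm (\<phi> z) \<le> C * norm z ^ n) (at 0)"
      unfolding eventually_at_filter using van by (rule eventually_mono) simp
    moreover have "eventually (\<lambda>z. z \<noteq> (0::complex)) (at 0)" by (rule eventually_neq_at_within)
    ultimately show ?thesis
    proof eventually_elim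
      case (elim z)
      then show ?case by (simp add: \<psi>0_def norm_divide norm_power pos_divide_le_eq)
    qed
  qed
  then obtain \<psi> where hol\<psi>: "\<psi> holomorphic_on ball 0 r" and \<psi>: "\<And>z. z \<in> ball 0 r - {0} \<Longrightarrow> \<psi> z = \<psi>0 z"
    using holomorphic_on_extend_bounded[OF hol0] r by (auto simp: interior_open)
  have *: "norm (\<phi> w) \<le> M * norm w ^ n / s ^ n" if s: "norm w < s" "s < r" for s
  proof -
    have s0: "s > 0" using s False by (meson norm_ge_zero order_le_less_trans)
    have "norm (\<psi> w) \<le> M / s ^ n"
    proof (rule maximum_modulus_frontier[of \<psi> "cball 0 s"])
      show "\<psi> holomorphic_on interior (cball 0 s)"
        by (rule holomorphic_on_subset[OF hol\<psi>]) (use s in auto)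
      show "continuous_on (closure (cball 0 s)) \<psi>"
        by (rule holomorphic_on_imp_continuous_on, rule holomorphic_on_subset[OF hol\<psi>]) (use s in auto)
      show "norm (\<psi> z) \<le> M / s ^ n" if "z \<in> frontier (cball 0 s)" for z
      proof -
        have z: "norm z = s" using that s0 by auto
        then have "z \<noteq> 0" using s0 by auto
        then have "\<psi> z = \<phi> z / z ^ n" using \<psi>[of z] s z by (auto simp: \<psi>0_def)
        then show ?thesis
          using bd[of z] z s s0 by (simp add: norm_divide norm_power divide_right_mono)
      qed
    qed (use s in auto)
    then show ?thesis using \<psi>[of w] r False s0 by (simp add: \<psi>0_def norm_divide norm_power pos_divide_le_eq)
  qed
  have "norm (\<phi> w) \<le> M * norm w ^ n / r ^ n"
  proof (rule tendsto_lowerbound)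
    show "((\<lambda>s. M * norm w ^ n / s ^ n) \<longlongrightarrow> M * norm w ^ n / r ^ n) (at_left r)"
      using r by (intro tendsto_intros) auto
    show "eventually (\<lambda>s. norm (\<phi> w) \<le> M * norm w ^ n / s ^ n) (at_left r)"
      using eventually_at_left_real[OF r(2)] by eventually_elim (use * in auto)
  qed auto
  then show ?thesis by (simp add: power_divide)
qed

text \<open>
  Borel-Caratheodory for a zero of order \<open>n\<close>. The Moebius map \<open>h \<mapsto> h / (2 A - h)\<close> sends the half plane
  \<open>Re h \<le> A\<close> into the closed unit disc, where \<open>schwarz_vanishing\<close> applies.
\<close>

lemma borel_caratheodory_vanishing:
  fixes H :: "complex \<Rightarrow> complex"
  assumes hol: "H holomorphic_on ball 0 r" and A: "A > 0" and re: "\<And>z. z \<in> ball 0 r \<Longrightarrow> Re (H z) \<le> A"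
    and van: "eventually (\<lambda>z. norm (H z) \<le> C * norm z ^ n) (nhds 0)"
    and r: "r > 1" "r ^ n \<ge> 2"
  shows "norm (H 1) \<le> 4 * A / r ^ n"
proof -
  define \<phi> where "\<phi> = (\<lambda>z. H z / (2 * complex_of_real A - H z))"
  have nz: "2 * complex_of_real A - H z \<noteq> 0" if "z \<in> ball 0 r" for z
  proof
    assume "2 * complex_of_real A - H z = 0"
    then have "Re (H z) = 2 * A" by (metis Re_complex_of_real eq_iff_diff_eq_0 of_real_mult of_real_numeral)
    then show False using re[OF that] A by simp
  qed
  have hol\<phi>: "\<phi> holomorphic_on ball 0 r"
    unfolding \<phi>_def by (intro holomorphic_intros hol) (use nz in auto)
  have le: "norm (H z) \<le> norm (2 * complex_of_real A - H z)" if "z \<in> ball 0 r" for z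
  proof -
    have "(Re (H z))\<^sup>2 \<le> (2 * A - Re (H z))\<^sup>2"
      using re[OF that] A by (simp add: power2_eq_square algebra_simps)
    then show ?thesis
      unfolding cmod_def by (intro real_sqrt_le_mono) (simp add: power2_eq_square)
  qed
  have \<phi>1: "norm (\<phi> z) \<le> 1" if "z \<in> ball 0 r" for z
    using le[OF that] nz[OF that] by (simp add: \<phi>_def norm_divide divide_simps)
  have den: "norm (2 * complex_of_real A - H z) \<ge> A" if "z \<in> ball 0 r" for z
  proof -
    have "A \<le> Re (2 * complex_of_real A - H z)" using re[OF that] by simp
    also have "\<dots> \<le> norm (2 * complex_of_real A - H z)" by (rule complex_Re_le_cmod)
    finally show ?thesis .
  qed
  have "eventually (\<lambda>z. norm (\<phi> z) \<le> (C / A) * norm z ^ n) (nhds 0)"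
  proof -
    have "eventually (\<lambda>z. z \<in> ball 0 r) (nhds (0::complex))"
      using r by (intro eventually_nhds_in_open) auto
    with van show ?thesis
    proof eventually_elim
      case (elim z)
      have "norm (\<phi> z) = norm (H z) / norm (2 * complex_of_real A - H z)"
        by (simp add: \<phi>_def norm_divide)
      also have "\<dots> \<le> (C * norm z ^ n) / A"
        using elim den[of z] A order_trans[OF norm_ge_zero, of "H z" "C * norm z ^ n"]
        by (intro frac_le) auto
      finally show ?case by simp
    qed
  qed
  from schwarz_vanishing[OF hol\<phi> \<phi>1 this, of 1] r have \<phi>r: "norm (\<phi> 1) \<le> 1 / r ^ n"
    by (simp add: power_divide)
  have 1: "(1::complex) \<in> ball 0 r" using r by simp
  have "norm (H 1) = norm (\<phi> 1) * norm (2 * complex_of_real A - H 1)"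
    using nz[OF 1] by (simp add: \<phi>_def norm_divide)
  also have "\<dots> \<le> (1 / r ^ n) * (2 * A + norm (H 1))"
  proof (rule mult_mono[OF \<phi>r])
    show "norm (2 * complex_of_real A - H 1) \<le> 2 * A + norm (H 1)"
      using norm_triangle_ineq4[of "2 * complex_of_real A" "H 1"] A by (simp add: norm_mult)
  qed (use r in auto)
  finally have "norm (H 1) * r ^ n \<le> 2 * A + norm (H 1)"
    using r by (simp add: field_simps)
  moreover have "2 * norm (H 1) \<le> norm (H 1) * r ^ n"
    using r mult_left_mono[of 2 "r ^ n" "norm (H 1)"] by (simp add: mult.commute)
  ultimately have "norm (H 1) * r ^ n \<le> 4 * A" by linarith
  then show ?thesis using r by (simp add: field_simps)
qed

definition one_plus_O :: "nat \<Rightarrow> (complex \<Rightarrow> complex) \<Rightarrow> bool" where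
  "one_plus_O n f \<longleftrightarrow> (\<exists>C\<ge>0. eventually (\<lambda>z. norm (f z - 1) \<le> C * norm z ^ n) (nhds 0))"

lemma one_plus_O_const: "one_plus_O n (\<lambda>z. 1)"
  unfolding one_plus_O_def by (intro exI[of _ 0]) auto

lemma one_plus_O_small:
  assumes "one_plus_O n f" "n > 0" "e > 0"
  shows "eventually (\<lambda>z. norm (f z - 1) \<le> e) (nhds 0)"
proof -
  obtain C where C: "C \<ge> 0" "eventually (\<lambda>z. norm (f z - 1) \<le> C * norm z ^ n) (nhds 0)"
    using assms(1) unfolding one_plus_O_def by auto
  have "((\<lambda>z::complex. C * norm z ^ n) \<longlongrightarrow> C * norm (0::complex) ^ n) (nhds 0)"
    by (intro tendsto_intros filterlim_ident)
  then have "((\<lambda>z::complex. C * norm z ^ n) \<longlongrightarrow> 0) (nhds 0)"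
    using assms(2) by (simp add: power_0_left)
  then have "eventually (\<lambda>z::complex. C * norm z ^ n < e) (nhds 0)"
    using assms by (intro order_tendstoD(2)[of _ 0]) auto
  with C(2) show ?thesis by eventually_elim linarith
qed

lemma one_plus_O_mult:
  assumes f: "one_plus_O n f" and g: "one_plus_O n g" and n: "n > 0"
  shows "one_plus_O n (\<lambda>z. f z * g z)"
proof -
  obtain C where C: "C \<ge> 0" "eventually (\<lambda>z. norm (f z - 1) \<le> C * norm z ^ n) (nhds 0)"
    using f unfolding one_plus_O_def by auto
  obtain D where D: "D \<ge> 0" "eventually (\<lambda>z. norm (g z - 1) \<le> D * norm z ^ n) (nhds 0)"
    using g unfolding one_plus_O_def by auto
  have "eventually (\<lambda>z. norm (f z * g z - 1) \<le> (2 * C + D) * norm z ^ n) (nhds 0)"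
    using C(2) D(2) one_plus_O_small[OF g n, of 1, simplified]
  proof eventually_elim
    case (elim z)
    have "norm (g z) \<le> 2" using elim(3) norm_triangle_ineq[of "g z - 1" 1] by simp
    have "f z * g z - 1 = (f z - 1) * g z + (g z - 1)" by (simp add: algebra_simps)
    then have "norm (f z * g z - 1) \<le> norm (f z - 1) * norm (g z) + norm (g z - 1)"
      by (metis norm_mult norm_triangle_ineq)
    also have "\<dots> \<le> (C * norm z ^ n) * 2 + D * norm z ^ n"
      using elim \<open>norm (g z) \<le> 2\<close> C by (intro add_mono mult_mono) auto
    finally show ?case by (simp add: algebra_simps)
  qed
  then show ?thesis using C(1) D(1) unfolding one_plus_O_def by (intro exI[of _ "2 * C + D"]) auto
qed

lemma one_plus_O_inverse:
  assumes f: "one_plus_O n f" and n: "n > 0"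
  shows "one_plus_O n (\<lambda>z. inverse (f z))"
proof -
  obtain C where C: "C \<ge> 0" "eventually (\<lambda>z. norm (f z - 1) \<le> C * norm z ^ n) (nhds 0)"
    using f unfolding one_plus_O_def by auto
  have "eventually (\<lambda>z. norm (inverse (f z) - 1) \<le> (2 * C) * norm z ^ n) (nhds 0)"
    using C(2) one_plus_O_small[OF f n, of "1/2", simplified]
  proof eventually_elim
    case (elim z)
    have "norm (f z) \<ge> 1/2" using elim(2) norm_triangle_ineq2[of 1 "1 - f z"]
      by (simp add: norm_minus_commute)
    then have nz: "f z \<noteq> 0" by auto
    have "norm (inverse (f z) - 1) = norm (f z - 1) / norm (f z)"
      using nz by (simp add: norm_minus_commute field_simps flip: norm_divide norm_mult)
    also have "\<dots> \<le> (C * norm z ^ n) / (1/2)"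
      using elim \<open>norm (f z) \<ge> 1/2\<close> C by (intro frac_le) auto
    finally show ?case by simp
  qed
  then show ?thesis using C(1) unfolding one_plus_O_def by (intro exI[of _ "2 * C"]) auto
qed

lemma one_plus_O_prod:
  assumes "\<And>i. i \<in> I \<Longrightarrow> one_plus_O n (f i)" "n > 0"
  shows "one_plus_O n (\<lambda>z. \<Prod>i\<in>I. f i z)"
  using assms(1)
  by (induction I rule: infinite_finite_induct) (auto simp: one_plus_O_const intro!: one_plus_O_mult assms(2))

lemma one_plus_O_power: "one_plus_O n f \<Longrightarrow> n > 0 \<Longrightarrow> one_plus_O n (\<lambda>z. f z ^ m)"
  by (induction m) (auto simp: one_plus_O_const intro!: one_plus_O_mult)

lemma one_plus_O_weierstrass_factor: "one_plus_O (Suc k) (\<lambda>z. weierstrass_factor k (c * z))"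
proof -
  have "((\<lambda>z::complex. norm (c * z)) \<longlongrightarrow> norm (c * 0)) (nhds 0)"
    by (intro tendsto_intros filterlim_ident)
  then have "eventually (\<lambda>z::complex. norm (c * z) < 1/2) (nhds 0)"
    by (intro order_tendstoD(2)[of _ 0]) auto
  then have "eventually (\<lambda>z. norm (weierstrass_factor k (c * z) - 1) \<le> (3 * norm c ^ Suc k) * norm z ^ Suc k) (nhds 0)"
  proof eventually_elim
    case (elim z)
    then show ?case
      using weierstrass_factor_bound[of "c * z" k] by (simp add: norm_mult power_mult_distrib mult_ac)
  qed
  then show ?thesis unfolding one_plus_O_def by (intro exI[of _ "3 * norm c ^ Suc k"]) auto
qed

text \<open>
  Dividing out one zero at a time; the order of \<open>g\<close> at a further point is not changed by factors that do
  not vanish there.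
\<close>

lemma factor_out_zeros:
  fixes g :: "complex \<Rightarrow> complex"
  assumes hol: "g holomorphic_on UNIV" and nz: "g w0 \<noteq> 0" and fin: "finite Z"
  obtains u where "u holomorphic_on UNIV" "\<And>z. g z = (\<Prod>a\<in>Z. (z - a) ^ nat (zorder g a)) * u z"
    "\<And>a. a \<in> Z \<Longrightarrow> u a \<noteq> 0"
proof -
  have "\<exists>u. u holomorphic_on UNIV \<and> (\<forall>z. g z = (\<Prod>a\<in>Z. (z - a) ^ nat (zorder g a)) * u z) \<and> (\<forall>a\<in>Z. u a \<noteq> 0)"
    using fin
  proof (induction Z)
    case empty
    then show ?case using hol by auto
  next
    case (insert a Z)
    then obtain u where u: "u holomorphic_on UNIV" "\<And>z. g z = (\<Prod>a\<in>Z. (z - a) ^ nat (zorder g a)) * u z"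
      "\<And>a. a \<in> Z \<Longrightarrow> u a \<noteq> 0" by auto
    define P where "P = (\<lambda>z. \<Prod>a\<in>Z. (z - a) ^ nat (zorder g a))"
    have Pa: "P a \<noteq> 0" using insert.hyps by (auto simp: P_def)
    have Phol: "P holomorphic_on UNIV" unfolding P_def by (intro holomorphic_intros)
    have "u w0 \<noteq> 0" using nz u(2)[of w0] by auto
    then have *: "(if u a = 0 then zorder u a > 0 else zorder u a = 0) \<and>
        (\<exists>r>0. cball a r \<subseteq> UNIV \<and> zor_poly u a holomorphic_on cball a r \<and>
          (\<forall>w\<in>cball a r. u w = zor_poly u a w * (w - a) ^ nat (zorder u a) \<and> zor_poly u a w \<noteq> 0))"
      by (intro zorder_exist_zero[OF u(1)]) auto
    obtain r where r: "r > 0" "zor_poly u a holomorphic_on cball a r"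
      "\<And>w. w \<in> cball a r \<Longrightarrow> u w = zor_poly u a w * (w - a) ^ nat (zorder u a) \<and> zor_poly u a w \<noteq> 0"
      using * by blast
    have ord0: "zorder u a \<ge> 0" using * by (auto split: if_splits)
    (* Near a, g is the invertible factor P times u. *)
    have ord: "zorder g a = zorder u a"
    proof (rule zorder_eqI)
      have cont: "continuous_on UNIV P" using Phol by (rule holomorphic_on_imp_continuous_on)
      have "open (P -` (- {0}))" using cont by (intro open_vimage) auto
      then show "open (ball a r \<inter> P -` (- {0}))" by auto
      show "a \<in> ball a r \<inter> P -` (- {0})" using r Pa by auto
      show "(\<lambda>w. P w * zor_poly u a w) holomorphic_on ball a r \<inter> P -` (- {0})"
        using r Phol by (intro holomorphic_intros) (auto elim: holomorphic_on_subset)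
      show "P a * zor_poly u a a \<noteq> 0" using r(3)[of a] r(1) Pa by auto
      show "g w = P w * zor_poly u a w * (w - a) powi zorder u a"
        if "w \<in> ball a r \<inter> P -` (- {0})" "w \<noteq> a" for w
        using that r(3)[of w] ord0 u(2)[of w] by (simp add: P_def power_int_def)
    qed
    (* The quotient of u by its zero at a, glued from the local factorization and the honest quotient. *)
    define v where "v = (\<lambda>w. if w \<in> ball a r then zor_poly u a w else u w / (w - a) ^ nat (zorder u a))"
    have v_eq: "u w = (w - a) ^ nat (zorder u a) * v w" for w
      using r(3)[of w] r(1) by (auto simp: v_def)
    have "v holomorphic_on ball a r \<union> (- {a})"
    proof (rule holomorphic_on_Un)
      show "v holomorphic_on ball a r"
        by (rule holomorphic_transform[OF holomorphic_on_subset[OF r(2)]]) (auto simp: v_def)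
      have "(\<lambda>w. u w / (w - a) ^ nat (zorder u a)) holomorphic_on - {a}"
        by (intro holomorphic_intros holomorphic_on_subset[OF u(1)]) auto
      then show "v holomorphic_on - {a}"
      proof (rule holomorphic_transform)
        fix w assume "w \<in> - {a}"
        then show "u w / (w - a) ^ nat (zorder u a) = v w"
          using v_eq[of w] by simp
      qed
    qed auto
    moreover have "ball a r \<union> (- {a}) = UNIV" using r(1) by auto
    ultimately have vhol: "v holomorphic_on UNIV" by simp
    have va: "v a \<noteq> 0" using r(3)[of a] r(1) by (auto simp: v_def)
    show ?case
    proof (intro exI conjI allI ballI)
      show "v holomorphic_on UNIV" by fact
      show "g z = (\<Prod>a\<in>insert a Z. (z - a) ^ nat (zorder g a)) * v z" for z
        using insert.hyps u(2)[of z] v_eq[of z] ord by simp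
      show "v b \<noteq> 0" if "b \<in> insert a Z" for b
        using that va u(3)[of b] v_eq[of b] by auto
    qed
  qed
  then show ?thesis using that by blast
qed

lemma summable_tail_finite:
  fixes f :: "'a \<Rightarrow> real"
  assumes nonneg: "\<And>x. x \<in> A \<Longrightarrow> f x \<ge> 0" and bd: "\<And>F. finite F \<Longrightarrow> F \<subseteq> A \<Longrightarrow> sum f F \<le> S" and e: "e > 0"
  obtains F0 where "finite F0" "F0 \<subseteq> A" "\<And>F. finite F \<Longrightarrow> F \<subseteq> A - F0 \<Longrightarrow> sum f F \<le> e"
proof -
  define s where "s = Sup (sum f ` {F. finite F \<and> F \<subseteq> A})"
  have bdd: "bdd_above (sum f ` {F. finite F \<and> F \<subseteq> A})"
    using bd by (auto intro!: bdd_aboveI)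
  have "s - e < s" using e by simp
  then obtain F0 where F0: "finite F0" "F0 \<subseteq> A" "s - e < sum f F0"
    unfolding s_def by (subst (asm) less_cSUP_iff) (use bdd in auto)
  show ?thesis
  proof (rule that[OF F0(1,2)])
    fix F assume F: "finite F" "F \<subseteq> A - F0"
    have "sum f (F0 \<union> F) \<le> s"
      unfolding s_def by (rule cSUP_upper[OF _ bdd]) (use F F0 in auto)
    moreover have "sum f (F0 \<union> F) = sum f F0 + sum f F"
      by (rule sum.union_disjoint) (use F F0 in auto)
    ultimately show "sum f F \<le> e" using F0 by linarith
  qed
qed

lemma norm_weierstrass_factor_ge:
  assumes "norm u \<ge> 2"
  shows "norm (weierstrass_factor k u) \<ge> exp (- (\<Sum>j=1..k. norm u ^ j))"
proof -
  have 1: "norm (1 - u) \<ge> 1"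
    using assms norm_triangle_ineq2[of u 1] by (simp add: norm_minus_commute)
  have "norm (\<Sum>j=1..k. u ^ j / of_nat j) \<le> (\<Sum>j=1..k. norm u ^ j)"
  proof (rule sum_norm_le)
    fix j assume "j \<in> {1..k}"
    then have "norm u ^ j / real j \<le> norm u ^ j / 1"
      by (intro divide_left_mono) auto
    then show "norm (u ^ j / of_nat j) \<le> norm u ^ j"
      by (simp add: norm_divide norm_power)
  qed
  then have "- (\<Sum>j=1..k. norm u ^ j) \<le> Re (\<Sum>j=1..k. u ^ j / of_nat j)"
    using abs_Re_le_cmod[of "\<Sum>j=1..k. u ^ j / of_nat j"] by linarith
  then have "exp (- (\<Sum>j=1..k. norm u ^ j)) \<le> norm (exp (\<Sum>j=1..k. u ^ j / of_nat j))"
    by (simp add: norm_exp_eq_Re)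
  also have "\<dots> \<le> norm (1 - u) * \<dots>"
    using mult_right_mono[OF 1, of "norm (exp (\<Sum>j=1..k. u ^ j / of_nat j))"] by simp
  finally show ?thesis by (simp add: weierstrass_factor_def norm_mult)
qed

lemma sum_powers_le:
  fixes x :: real assumes "x \<ge> 2" shows "(\<Sum>j=1..k. x ^ j) \<le> x ^ Suc k"
proof (induction k)
  case (Suc k)
  have "(\<Sum>j=1..Suc k. x ^ j) \<le> x ^ Suc k + x ^ Suc k" using Suc by simp
  also have "\<dots> = 2 * x ^ Suc k" by simp
  also have "\<dots> \<le> x * x ^ Suc k" using assms by (intro mult_right_mono) auto
  finally show ?case by simp
qed (use assms in auto)

text \<open>
  In the Hadamard factorization of \<open>g\<close> only the Weierstrass product \<open>\<Prod> E(z / a)\<close> over the zeros survives: an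
  additional factor would be \<open>e\<^sup>P\<close> with a polynomial \<open>P\<close> of degree at most \<open>k + 1\<close>, and \<open>g = 1 + O(z\<^sup>k\<^sup>+\<^sup>1)\<close> excludes
  the lower coefficients, minimal type the leading one.

  The proof is a quantitative form of this that needs no infinite product. Let \<open>W\<close> be the product over the
  zeros in the disc of radius \<open>R / 2\<close> and \<open>h = g / W\<close>. On the circle of radius \<open>R\<close> the growth of \<open>g\<close> and
  a lower bound for \<open>W\<close> show \<open>|h| \<le> exp(3 \<epsilon> R\<^sup>k\<^sup>+\<^sup>1)\<close>. In the disc of radius \<open>R / 2\<close> the function \<open>h\<close> has a
  logarithm, which vanishes to order \<open>k + 1\<close> at \<open>0\<close> and has real part at most \<open>3 \<epsilon> R\<^sup>k\<^sup>+\<^sup>1\<close>, so by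
  \<open>borel_caratheodory_vanishing\<close> it is \<open>O(\<epsilon>)\<close> at \<open>1\<close>, uniformly in \<open>R\<close>.
\<close>

lemma entire_bound_by_zeros:
  fixes g :: "complex \<Rightarrow> complex" and k :: nat and p \<Gamma> S :: real
  assumes hol: "g holomorphic_on UNIV" and p: "0 < p" "p \<le> Suc k" and \<Gamma>: "\<Gamma> \<ge> 0"
    and ord: "one_plus_O (Suc k) g"
    and type: "\<And>\<epsilon>. \<epsilon> > 0 \<Longrightarrow> \<exists>C. \<forall>z. norm (g z) \<le> C * exp (\<epsilon> * norm z ^ Suc k)"
    and zeros: "\<And>Z. finite Z \<Longrightarrow> Z \<subseteq> {a. g a = 0} \<Longrightarrow> (\<Sum>a\<in>Z. nat (zorder g a) * norm a powr (-p)) \<le> S"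
    and E: "\<And>u. norm (weierstrass_factor k u) \<le> exp (\<Gamma> * norm u powr p)"
  shows "norm (g 1) \<le> exp (\<Gamma> * S)"
proof -
  define n where "n = Suc k"
  have n_pos: "n > 0" by (simp add: n_def)
  define m where "m = (\<lambda>a. nat (zorder g a))"
  obtain C0 where "eventually (\<lambda>z. norm (g z - 1) \<le> C0 * norm z ^ Suc k) (nhds 0)"
    using ord unfolding one_plus_O_def by auto
  from eventually_nhds_x_imp_x[OF this] have g0: "g 0 = 1" by simp
  have fin: "finite {a\<in>cball 0 R. g a = 0}" for R
  proof (cases "g constant_on UNIV")
    case True
    then have "g a = g 0" for a unfolding constant_on_def by (metis UNIV_I)
    then show ?thesis using g0 by simp
  next
    case False
    then show ?thesis
      by (intro holomorphic_compact_finite_zeros[OF hol]) auto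
  qed
  have a0: "a \<noteq> 0" if "g a = 0" for a using that g0 by auto
  have key: "norm (g 1) \<le> exp (\<Gamma> * S + 12 * 2 ^ n * \<epsilon>)" if \<epsilon>: "\<epsilon> > 0" for \<epsilon>
  proof -
    obtain F0 where F0: "finite F0" "F0 \<subseteq> {a. g a = 0}"
      "\<And>F. finite F \<Longrightarrow> F \<subseteq> {a. g a = 0} - F0 \<Longrightarrow> (\<Sum>a\<in>F. m a * norm a powr (-p)) \<le> \<epsilon>"
      using summable_tail_finite[of "{a. g a = 0}" "\<lambda>a. m a * norm a powr (-p)" S \<epsilon>] zeros \<epsilon>
      unfolding m_def by auto
    (* Finitely many zeros Z0 carry all but \<epsilon> of the sum over all zeros. Small zeros are included in
       Z0, so that |a|^(-n) is at most |a|^(-p) for the remaining ones. *)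
    define Z0 where "Z0 = F0 \<union> {a\<in>cball 0 1. g a = 0}"
    have Z0: "finite Z0" "Z0 \<subseteq> {a. g a = 0}" using F0 fin by (auto simp: Z0_def)
    obtain C where C: "\<And>z. norm (g z) \<le> C * exp (\<epsilon> * norm z ^ n)"
      using type[OF \<epsilon>] unfolding n_def by auto
    have C1: "C \<ge> 1" using C[of 0] g0 by (simp add: n_def)
    define K where "K = (\<Sum>a\<in>Z0. m a * (\<Sum>j=1..k. inverse (norm a) ^ j))"
    have K: "K \<ge> 0" unfolding K_def by (intro sum_nonneg mult_nonneg_nonneg) auto
    (* R is so large that the constants ln C and K are absorbed by \<epsilon> R. *)
    define R where "R = max 8 ((ln C + K) / \<epsilon>)"
    have R8: "R \<ge> 8" by (simp add: R_def)
    have RK: "ln C + K \<le> \<epsilon> * R"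
      using \<epsilon> by (simp add: R_def max_def field_simps)
    define Z where "Z = {a\<in>cball 0 (R / 2). g a = 0}"
    have Zfin: "finite Z" unfolding Z_def by (rule fin)
    obtain u where u: "u holomorphic_on UNIV" "\<And>z. g z = (\<Prod>a\<in>Z. (z - a) ^ m a) * u z"
      "\<And>a. a \<in> Z \<Longrightarrow> u a \<noteq> 0"
      using factor_out_zeros[OF hol, of 0 Z] g0 Zfin unfolding m_def by auto
    define W where "W = (\<lambda>z. \<Prod>a\<in>Z. weierstrass_factor k (inverse a * z) ^ m a)"
    define h where "h = (\<lambda>z. (\<Prod>a\<in>Z. (- a * exp (- (\<Sum>j=1..k. (inverse a * z) ^ j / of_nat j))) ^ m a) * u z)"
    have gWh: "g z = W z * h z" for z
    proof -
      have "(z - a) ^ m a = weierstrass_factor k (inverse a * z) ^ m a *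
              (- a * exp (- (\<Sum>j=1..k. (inverse a * z) ^ j / of_nat j))) ^ m a" if "a \<in> Z" for a
      proof -
        have "a \<noteq> 0" using that a0 by (auto simp: Z_def)
        then have "z - a = (1 - inverse a * z) * (- a)" by (simp add: field_simps)
        also have "\<dots> = weierstrass_factor k (inverse a * z) *
              (- a * exp (- (\<Sum>j=1..k. (inverse a * z) ^ j / of_nat j)))"
          unfolding weierstrass_factor_def by (simp add: exp_minus)
        finally show ?thesis by (simp only: power_mult_distrib)
      qed
      then have "(\<Prod>a\<in>Z. (z - a) ^ m a) = W z * (\<Prod>a\<in>Z. (- a * exp (- (\<Sum>j=1..k. (inverse a * z) ^ j / of_nat j))) ^ m a)"
        unfolding W_def by (simp add: prod.distrib)
      then show ?thesis using u(2)[of z] by (simp add: h_def)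
    qed
    have hhol: "h holomorphic_on UNIV"
      unfolding h_def by (intro holomorphic_intros u(1)) auto
    have unz: "u z \<noteq> 0" if "z \<in> cball 0 (R/2)" for z
    proof (cases "z \<in> Z")
      case False
      then have "g z \<noteq> 0" using that by (auto simp: Z_def)
      then show ?thesis using u(2)[of z] by auto
    qed (use u(3) in auto)
    have hnz: "h z \<noteq> 0" if "z \<in> cball 0 (R/2)" for z
      using unz[OF that] Zfin a0 by (auto simp: h_def Z_def)
    have W0: "W 0 = 1" by (simp add: W_def)
    have h0: "h 0 = 1" using gWh[of 0] g0 W0 by simp
    have WO: "one_plus_O n W"
      unfolding W_def n_def
      by (intro one_plus_O_prod one_plus_O_power one_plus_O_weierstrass_factor) auto
    have hO: "one_plus_O n h"
    proof -
      have "one_plus_O n (\<lambda>z. g z * inverse (W z))"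
        using ord WO by (intro one_plus_O_mult one_plus_O_inverse) (auto simp: n_def)
      then obtain D where D: "D \<ge> 0" "eventually (\<lambda>z. norm (g z * inverse (W z) - 1) \<le> D * norm z ^ n) (nhds 0)"
        unfolding one_plus_O_def by auto
      have "eventually (\<lambda>z. norm (h z - 1) \<le> D * norm z ^ n) (nhds 0)"
        using D(2) one_plus_O_small[OF WO n_pos, of "1/2", simplified]
      proof eventually_elim
        case (elim z)
        have "W z \<noteq> 0" using elim(2) by auto
        then have "g z * inverse (W z) = h z" using gWh[of z] by simp
        then show ?case using elim by simp
      qed
      then show ?thesis using D(1) unfolding one_plus_O_def by auto
    qed
    (* On the circle of radius R the zeros in Z satisfy R / norm a \<ge> 2, which bounds their factors from
       below. *)
    have sphere: "norm (h z) \<le> exp (3 * \<epsilon> * R ^ n)" if z: "norm z = R" for z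
    proof -
      define w where "w = (\<lambda>a::complex. \<Sum>j=1..k. (R / norm a) ^ j)"
      have wpos: "w a \<ge> 0" for a unfolding w_def using R8 by (intro sum_nonneg) auto
      have ratio: "R / norm a \<ge> 2" if "a \<in> Z" for a
      proof -
        have "a \<noteq> 0" "norm a \<le> R / 2" using that a0 by (auto simp: Z_def)
        then show ?thesis by (simp add: field_simps)
      qed
      have Wge: "norm (W z) \<ge> exp (- (\<Sum>a\<in>Z. m a * w a))"
      proof -
        have "exp (- (\<Sum>a\<in>Z. m a * w a)) = (\<Prod>a\<in>Z. exp (- w a) ^ m a)"
          using Zfin by (simp add: exp_sum sum_negf[symmetric] exp_of_nat_mult[symmetric])
        also have "\<dots> \<le> (\<Prod>a\<in>Z. norm (weierstrass_factor k (inverse a * z)) ^ m a)"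
        proof (intro prod_mono conjI power_mono)
          fix a assume a: "a \<in> Z"
          have na: "norm (inverse a * z) = R / norm a"
            using z by (simp add: norm_mult norm_inverse divide_inverse mult.commute)
          show "exp (- w a) \<le> norm (weierstrass_factor k (inverse a * z))"
            using norm_weierstrass_factor_ge[of "inverse a * z" k] ratio[OF a] na by (simp add: w_def)
        qed auto
        also have "\<dots> = norm (W z)" by (simp add: W_def norm_power prod_norm[symmetric])
        finally show ?thesis .
      qed
      have sum_le: "(\<Sum>a\<in>Z. m a * w a) \<le> K * R ^ k + \<epsilon> * R ^ n"
      proof -
        have "(\<Sum>a\<in>Z. m a * w a) = (\<Sum>a\<in>Z \<inter> Z0. m a * w a) + (\<Sum>a\<in>Z - Z0. m a * w a)"
          using Zfin by (simp add: sum.Int_Diff)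
        also have "(\<Sum>a\<in>Z \<inter> Z0. m a * w a) \<le> (\<Sum>a\<in>Z0. m a * w a)"
          by (rule sum_mono2) (use Z0 wpos in auto)
        also have "\<dots> \<le> (\<Sum>a\<in>Z0. m a * ((\<Sum>j=1..k. inverse (norm a) ^ j) * R ^ k))"
        proof (intro sum_mono mult_left_mono)
          fix a
          show "w a \<le> (\<Sum>j=1..k. inverse (norm a) ^ j) * R ^ k"
            unfolding w_def sum_distrib_right
          proof (rule sum_mono)
            fix j assume "j \<in> {1..k}"
            then have "R ^ j \<le> R ^ k" using R8 by (intro power_increasing) auto
            then have "inverse (norm a) ^ j * R ^ j \<le> inverse (norm a) ^ j * R ^ k"
              by (intro mult_left_mono) auto
            then show "(R / norm a) ^ j \<le> inverse (norm a) ^ j * R ^ k"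
              by (simp add: divide_inverse power_mult_distrib mult.commute)
          qed
        qed auto
        also have "\<dots> = K * R ^ k" by (simp add: K_def sum_distrib_right mult.assoc)
        also have "(\<Sum>a\<in>Z - Z0. m a * w a) \<le> (\<Sum>a\<in>Z - Z0. R ^ n * (m a * norm a powr (-p)))"
        proof (rule sum_mono)
          fix a assume a: "a \<in> Z - Z0"
          then have na: "norm a > 1" by (auto simp: Z_def Z0_def)
          have "w a \<le> (R / norm a) ^ n"
            unfolding w_def n_def by (rule sum_powers_le) (use a ratio in auto)
          also have "\<dots> = R ^ n * norm a powr (- real n)"
          proof -
            have "norm a powr (- real n) = inverse (norm a ^ n)"
              using powr_realpow[of "norm a" n] na by (cases "a = 0") (simp_all add: powr_minus)
            then show ?thesis by (simp add: divide_inverse power_mult_distrib power_inverse)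
          qed
          also have "\<dots> \<le> R ^ n * norm a powr (-p)"
            using na R8 p by (intro mult_left_mono powr_mono) (auto simp: n_def)
          finally have "m a * w a \<le> m a * (R ^ n * norm a powr (-p))"
            by (intro mult_left_mono) auto
          then show "m a * w a \<le> R ^ n * (m a * norm a powr (-p))" by (simp add: mult_ac)
        qed
        also have "\<dots> = R ^ n * (\<Sum>a\<in>Z - Z0. m a * norm a powr (-p))"
          by (simp add: sum_distrib_left)
        also have "\<dots> \<le> R ^ n * \<epsilon>"
          using R8 by (intro mult_left_mono F0(3)) (use Zfin in \<open>auto simp: Z_def Z0_def\<close>)
        finally show ?thesis by (simp add: mult.commute)
      qed
      have "norm (W z) * norm (h z) = norm (g z)" using gWh[of z] by (simp add: norm_mult)
      also have "\<dots> \<le> exp (ln C) * exp (\<epsilon> * R ^ n)" using C[of z] z C1 by simp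
      finally have "exp (- (K * R ^ k + \<epsilon> * R ^ n)) * norm (h z) \<le> exp (ln C) * exp (\<epsilon> * R ^ n)"
        using Wge sum_le by (meson dual_order.trans exp_le_cancel_iff mult_right_mono neg_le_iff_le norm_ge_zero)
      have exp_cancel: "exp x * (exp (- x) * y) = y" for x y :: real by (simp add: exp_minus)
      from \<open>exp (- (K * R ^ k + \<epsilon> * R ^ n)) * norm (h z) \<le> exp (ln C) * exp (\<epsilon> * R ^ n)\<close>
      have "exp (K * R ^ k + \<epsilon> * R ^ n) * (exp (- (K * R ^ k + \<epsilon> * R ^ n)) * norm (h z))
          \<le> exp (K * R ^ k + \<epsilon> * R ^ n) * (exp (ln C) * exp (\<epsilon> * R ^ n))"
        by (intro mult_left_mono) auto
      then have "norm (h z) \<le> exp (ln C) * exp (\<epsilon> * R ^ n) * exp (K * R ^ k + \<epsilon> * R ^ n)"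
        unfolding exp_cancel by (simp add: mult_ac)
      also have "\<dots> = exp (ln C + K * R ^ k + 2 * \<epsilon> * R ^ n)"
        by (simp add: algebra_simps flip: exp_add)
      also have "\<dots> \<le> exp (3 * \<epsilon> * R ^ n)"
      proof -
        have Rk: "R ^ k \<ge> 1" using R8 by simp
        have "ln C * 1 \<le> ln C * R ^ k" using Rk C1 by (intro mult_left_mono) auto
        then have "ln C + K * R ^ k \<le> (ln C + K) * R ^ k" by (simp add: algebra_simps)
        also have "\<dots> \<le> \<epsilon> * R * R ^ k" using RK Rk by (intro mult_right_mono) auto
        also have "\<epsilon> * R * R ^ k = \<epsilon> * R ^ n" by (simp add: n_def)
        finally have "ln C + K * R ^ k \<le> \<epsilon> * R ^ n" .
        moreover have "3 * \<epsilon> * R ^ n = \<epsilon> * R ^ n + 2 * \<epsilon> * R ^ n" by (simp add: algebra_simps)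
        ultimately show ?thesis by simp
      qed
      finally show ?thesis .
    qed
    have disc: "norm (h z) \<le> exp (3 * \<epsilon> * R ^ n)" if "z \<in> cball 0 R" for z
      by (rule maximum_modulus_frontier[of h "cball 0 R"])
        (use that sphere R8 hhol in \<open>auto intro: holomorphic_on_subset holomorphic_on_imp_continuous_on\<close>)
    obtain H0 where H0: "H0 holomorphic_on ball 0 (R/2)" "\<And>z. z \<in> ball 0 (R/2) \<Longrightarrow> exp (H0 z) = h z"
      using holomorphic_logarithm_exists[of "ball 0 (R/2)" h 0] hnz R8 hhol
      by (auto intro: holomorphic_on_subset)
    define H where "H = (\<lambda>z. H0 z - H0 0)"
    have H: "H holomorphic_on ball 0 (R/2)" unfolding H_def by (intro holomorphic_intros H0)
    have expH: "exp (H z) = h z" if "z \<in> ball 0 (R/2)" for z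
      using H0(2)[OF that] H0(2)[of 0] h0 R8 by (simp add: H_def exp_diff)
    have HRe: "Re (H z) \<le> 3 * \<epsilon> * R ^ n" if "z \<in> ball 0 (R/2)" for z
    proof -
      have "exp (Re (H z)) = norm (h z)" using expH[OF that] by (metis norm_exp_eq_Re)
      also have "\<dots> \<le> exp (3 * \<epsilon> * R ^ n)" using that R8 by (intro disc) auto
      finally show ?thesis by simp
    qed
    obtain D where D: "D \<ge> 0" "eventually (\<lambda>z. norm (h z - 1) \<le> D * norm z ^ n) (nhds 0)"
      using hO unfolding one_plus_O_def by auto
    have Hvan: "eventually (\<lambda>z. norm (H z) \<le> (2 * D) * norm z ^ n) (nhds 0)"
    proof -
      have "continuous_on (ball 0 (R/2)) H" by (rule holomorphic_on_imp_continuous_on[OF H])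
      then have "isCont H 0" using R8 by (simp add: continuous_on_eq_continuous_at)
      then have "(H \<longlongrightarrow> H 0) (nhds 0)" by (simp add: tendsto_at_iff_tendsto_nhds isCont_def)
      then have "((\<lambda>z. norm (H z)) \<longlongrightarrow> 0) (nhds 0)"
        using tendsto_norm by (fastforce simp: H_def)
      then have "eventually (\<lambda>z. norm (H z) < 1/2) (nhds 0)"
        by (rule order_tendstoD(2)) auto
      moreover have "eventually (\<lambda>z. z \<in> ball 0 (R/2)) (nhds (0::complex))"
        using R8 by (intro eventually_nhds_in_open) auto
      ultimately show ?thesis using D(2)
      proof eventually_elim
        case (elim z)
        have "1/2 * norm (H z) \<le> norm (exp (H z) - 1)"
          using elim(1) by (intro norm_exp_bounds) auto
        then show ?case using elim expH[of z] by simp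
      qed
    qed
    have r: "R / 2 > 1" "(R/2) ^ n \<ge> 2"
    proof -
      have "(R/2) ^ 1 \<le> (R/2) ^ n" using R8 by (intro power_increasing) (auto simp: n_def)
      then show "(R/2) ^ n \<ge> 2" using R8 by simp
    qed (use R8 in auto)
    have "norm (H 1) \<le> 4 * (3 * \<epsilon> * R ^ n) / (R/2) ^ n"
      by (rule borel_caratheodory_vanishing[OF H _ HRe Hvan r]) (use \<epsilon> R8 in auto)
    also have "\<dots> = 12 * 2 ^ n * \<epsilon>" using R8 by (simp add: power_divide)
    finally have H1: "norm (H 1) \<le> 12 * 2 ^ n * \<epsilon>" .
    have "norm (h 1) = exp (Re (H 1))"
      using expH[of 1] R8 by (metis norm_exp_eq_Re mem_ball_0 norm_one r(1))
    also have "\<dots> \<le> exp (12 * 2 ^ n * \<epsilon>)"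
      using H1 complex_Re_le_cmod[of "H 1"] by simp
    finally have h1: "norm (h 1) \<le> exp (12 * 2 ^ n * \<epsilon>)" .
    have "norm (W 1) = (\<Prod>a\<in>Z. norm (weierstrass_factor k (inverse a)) ^ m a)"
      by (simp add: W_def norm_power prod_norm[symmetric])
    also have "\<dots> \<le> (\<Prod>a\<in>Z. exp (\<Gamma> * norm (inverse a) powr p) ^ m a)"
      by (intro prod_mono conjI power_mono E) auto
    also have "\<dots> = exp (\<Gamma> * (\<Sum>a\<in>Z. m a * norm a powr (-p)))"
    proof -
      have "exp (\<Gamma> * norm (inverse a) powr p) ^ m a = exp (\<Gamma> * (m a * norm a powr (-p)))" for a
      proof -
        have "norm (inverse a) powr p = norm a powr (-p)"
          by (simp add: norm_inverse powr_minus inverse_powr)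
        then show ?thesis by (simp add: mult_ac flip: exp_of_nat_mult)
      qed
      then show ?thesis using Zfin by (simp add: sum_distrib_left exp_sum)
    qed
    also have "\<dots> \<le> exp (\<Gamma> * S)"
      using zeros[of Z] Zfin \<Gamma> by (auto simp: Z_def m_def intro!: mult_left_mono)
    finally have W1: "norm (W 1) \<le> exp (\<Gamma> * S)" .
    have "norm (g 1) = norm (W 1) * norm (h 1)" using gWh[of 1] by (simp add: norm_mult)
    also have "\<dots> \<le> exp (\<Gamma> * S) * exp (12 * 2 ^ n * \<epsilon>)"
      by (intro mult_mono W1 h1) auto
    finally show ?thesis by (simp add: exp_add)
  qed
  show ?thesis
  proof (rule tendsto_lowerbound)
    show "((\<lambda>\<epsilon>. exp (\<Gamma> * S + 12 * 2 ^ n * \<epsilon>)) \<longlongrightarrow> exp (\<Gamma> * S)) (at_right 0)"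
      by (auto intro!: tendsto_eq_intros)
    show "eventually (\<lambda>\<epsilon>. norm (g 1) \<le> exp (\<Gamma> * S + 12 * 2 ^ n * \<epsilon>)) (at_right 0)"
      using eventually_at_right_less[of "0::real"] by eventually_elim (rule key)
  qed auto
qed

section \<open>Regularized determinants of finite rank operators\<close>

lemma maps_spanI:
  assumes "A \<in> bounded_ops" "range (blinfun_apply A) \<subseteq> lspan bs"
  shows "maps_span bs (blinfun_apply A)"
  using assms clinear_map_bounded_ops by (auto simp: maps_span_def)

lemma finite_rank_ops_span:
  assumes "F \<in> finite_rank_ops" obtains B where "finite B" "range (blinfun_apply F) = complex_vs.span B"
  using assms by (auto simp: finite_rank_ops_def)

lemma finite_rank_ops_add [intro]:
  assumes "F \<in> finite_rank_ops" "G \<in> finite_rank_ops" shows "F + G \<in> finite_rank_ops"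
proof -
  obtain A B where A: "finite A" "range (blinfun_apply F) = complex_vs.span A" and B: "finite B" "range (blinfun_apply G) = complex_vs.span B"
    using assms by (meson finite_rank_ops_span)
  show ?thesis
  proof (rule finite_rank_opsI[where B = "A \<union> B"])
    show "range (blinfun_apply (F + G)) \<subseteq> complex_vs.span (A \<union> B)"
    proof clarify
      fix x
      have "F x \<in> complex_vs.span (A \<union> B)" using A(2) complex_vs.span_mono[of A "A \<union> B"] by auto
      moreover have "G x \<in> complex_vs.span (A \<union> B)" using B(2) complex_vs.span_mono[of B "A \<union> B"] by auto
      ultimately show "(F + G) x \<in> complex_vs.span (A \<union> B)" by (simp add: blinfun.add_left complex_vs.span_add)
    qed
  qed (use A B assms in \<open>auto simp: finite_rank_bounded_ops\<close>)
qed

lemma finite_rank_ops_scaleC [intro]: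
  assumes "F \<in> finite_rank_ops" shows "c *\<^sub>C F \<in> finite_rank_ops"
proof -
  obtain A where A: "finite A" "range (blinfun_apply F) = complex_vs.span A" by (rule finite_rank_ops_span[OF assms])
  show ?thesis
    by (rule finite_rank_opsI[where B = A]) (use A assms in \<open>auto simp: finite_rank_bounded_ops intro!: complex_vs.span_scale\<close>)
qed

lemma finite_rank_ops_diff [intro]:
  assumes "F \<in> finite_rank_ops" "G \<in> finite_rank_ops" shows "F - G \<in> finite_rank_ops"
proof -
  have "F - G = F + (-1) *\<^sub>C G" by (simp add: complex_vs.scale_minus_left)
  then show ?thesis
    using finite_rank_ops_add[OF assms(1) finite_rank_ops_scaleC[OF assms(2), of "-1"]] by metis
qed

lemma finite_rank_ops_compose_right [intro]:
  assumes "F \<in> finite_rank_ops" "A \<in> bounded_ops" shows "F o\<^sub>L A \<in> finite_rank_ops"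
proof -
  obtain B where B: "finite B" "range (blinfun_apply F) = complex_vs.span B" by (rule finite_rank_ops_span[OF assms(1)])
  show ?thesis
    by (rule finite_rank_opsI[where B = B]) (use B assms in \<open>auto simp: finite_rank_bounded_ops\<close>)
qed

lemma finite_rank_ops_compose_left [intro]:
  assumes "F \<in> finite_rank_ops" "A \<in> bounded_ops" shows "A o\<^sub>L F \<in> finite_rank_ops"
proof -
  obtain bs where bs: "basis_list bs" "lspan bs = range (blinfun_apply F)" by (rule finite_rank_opsE[OF assms(1)])
  show ?thesis
  proof (rule finite_rank_opsI[where B = "blinfun_apply A ` set bs"])
    show "range (blinfun_apply (A o\<^sub>L F)) \<subseteq> complex_vs.span (blinfun_apply A ` set bs)"
    proof clarify
      fix x
      have "F x = (\<Sum>i<length bs. coord bs i (F x) *\<^sub>C bs ! i)" using coord_expand[OF bs(1), of "F x"] bs(2) by simp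
      then have "A (F x) = (\<Sum>i<length bs. coord bs i (F x) *\<^sub>C A (bs ! i))"
        using clinear_map_sum[OF clinear_map_bounded_ops[OF assms(2)]] by metis
      also have "\<dots> \<in> complex_vs.span (blinfun_apply A ` set bs)"
        by (intro complex_vs.span_sum complex_vs.span_scale complex_vs.span_base) auto
      finally show "(A o\<^sub>L F) x \<in> complex_vs.span (blinfun_apply A ` set bs)" by simp
    qed
  qed (use assms in \<open>auto simp: finite_rank_bounded_ops\<close>)
qed

lemma zero_finite_rank: "0 \<in> finite_rank_ops"
  by (rule finite_rank_opsI[where B = "{}"]) (auto simp: complex_vs.span_zero)

lemma common_basis:
  assumes F: "F \<in> finite_rank_ops" and G: "G \<in> finite_rank_ops" and as: "basis_list as" "set as \<subseteq> range (blinfun_apply F)"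
  obtains bs where "basis_list (as @ bs)" "range (blinfun_apply F) \<subseteq> lspan (as @ bs)" "range (blinfun_apply G) \<subseteq> lspan (as @ bs)"
proof -
  obtain A where A: "finite A" "range (blinfun_apply F) = complex_vs.span A" by (rule finite_rank_ops_span[OF F])
  obtain B where B: "finite B" "range (blinfun_apply G) = complex_vs.span B" by (rule finite_rank_ops_span[OF G])
  have sub: "complex_vs.span A \<subseteq> complex_vs.span (A \<union> B)" "complex_vs.span B \<subseteq> complex_vs.span (A \<union> B)"
    using complex_vs.span_mono[of A "A \<union> B"] complex_vs.span_mono[of B "A \<union> B"] by auto
  have fin: "finite (A \<union> B)" using A B by simp
  have asS: "set as \<subseteq> complex_vs.span (A \<union> B)" using as(2) A(2) sub by auto
  obtain bs where "basis_list (as @ bs)" "lspan (as @ bs) = complex_vs.span (A \<union> B)"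
    by (rule exists_basis_list[OF complex_vs.subspace_span order_refl fin as(1) asS])
  then show ?thesis using that A(2) B(2) sub by auto
qed

definition reg_order :: "real \<Rightarrow> nat" where "reg_order p = nat \<lceil>p\<rceil> - 1"

definition mat_detp :: "nat \<Rightarrow> complex mat \<Rightarrow> complex" where
  "mat_detp K M = Determinant.det (1\<^sub>m (dim_row M) - M) * exp (\<Sum>k = 1..K. 1 / of_nat k * mat_trace (M ^\<^sub>m k))"

lemma funpow_range:
  fixes f :: "'a \<Rightarrow> 'a"
  shows "k > 0 \<Longrightarrow> range (f ^^ k) \<subseteq> range f"
  by (cases k) auto

lemma range_trace_power:
  assumes bs: "basis_list bs" and F: "F \<in> bounded_ops" "range (blinfun_apply F) \<subseteq> lspan bs" and k: "k > 0"
  shows "range_trace (blinfun_apply F ^^ k) = mat_trace (matrix_wrt bs (blinfun_apply F) ^\<^sub>m k)"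
proof -
  have "range (blinfun_apply F ^^ k) \<subseteq> lspan bs" using funpow_range[OF k, of "blinfun_apply F"] F(2) by blast
  then have "range_trace (blinfun_apply F ^^ k) = mat_trace (matrix_wrt bs (blinfun_apply F ^^ k))"
    by (intro range_trace_basis bs clinear_map_funpow clinear_map_bounded_ops F(1))
  then show ?thesis by (simp add: matrix_wrt_funpow[OF bs maps_spanI[OF F]])
qed

lemma detp_basis:
  assumes bs: "basis_list bs" and F: "F \<in> bounded_ops" "range (blinfun_apply F) \<subseteq> lspan bs"
  shows "detp_one_minus p F = mat_detp (reg_order p) (matrix_wrt bs (blinfun_apply F))"
  unfolding detp_one_minus_def mat_detp_def reg_order_def
  using det_one_minus_basis[OF bs clinear_map_bounded_ops[OF F(1)] F(2)] range_trace_power[OF bs F]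
  by simp

lemma matrix_wrt_scaleC_blinfun:
  assumes bs: "basis_list bs" and F: "F \<in> bounded_ops" "range (blinfun_apply F) \<subseteq> lspan bs"
  shows "matrix_wrt bs (blinfun_apply (z *\<^sub>C F)) = z \<cdot>\<^sub>m matrix_wrt bs (blinfun_apply F)"
  using matrix_wrt_scale[OF bs maps_spanI[OF F], of z] by (simp add: scaleC_blinfun.rep_eq)

lemma smult_mat_power:
  fixes M :: "complex mat" assumes "M \<in> carrier_mat n n"
  shows "(z \<cdot>\<^sub>m M) ^\<^sub>m k = z ^ k \<cdot>\<^sub>m (M ^\<^sub>m k)"
proof (induction k)
  case 0
  show ?case using assms by (intro eq_matI) auto
next
  case (Suc k)
  have c: "M ^\<^sub>m k \<in> carrier_mat n n" using assms by (rule pow_carrier_mat)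
  have "(z \<cdot>\<^sub>m M) ^\<^sub>m Suc k = (z ^ k \<cdot>\<^sub>m (M ^\<^sub>m k)) * (z \<cdot>\<^sub>m M)" using Suc by simp
  also have "\<dots> = z \<cdot>\<^sub>m ((z ^ k \<cdot>\<^sub>m (M ^\<^sub>m k)) * M)"
    by (rule mult_smult_distrib) (use c assms in auto)
  also have "(z ^ k \<cdot>\<^sub>m (M ^\<^sub>m k)) * M = z ^ k \<cdot>\<^sub>m (M ^\<^sub>m k * M)"
    by (rule mult_smult_assoc_mat[OF c assms])
  finally show ?case using c assms by (intro eq_matI) auto
qed

lemma mat_trace_smult: "mat_trace (z \<cdot>\<^sub>m M) = z * mat_trace M" if "dim_row M = dim_col M"
  using that by (simp add: mat_trace_def sum_distrib_left)

text \<open>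
  With eigenvalues \<open>\<mu>\<^sub>i\<close> of \<open>F\<close>, the determinant contributes \<open>1 - z \<mu>\<^sub>i\<close> and the trace terms
  contribute the exponential of a Weierstrass factor.
\<close>

lemma detp_weierstrass_product:
  assumes F: "F \<in> finite_rank_ops" and bs: "basis_list bs" "range (blinfun_apply F) \<subseteq> lspan bs"
  obtains \<mu> where "\<And>z. detp_one_minus p (z *\<^sub>C F) = (\<Prod>i<length bs. weierstrass_factor (reg_order p) (z * \<mu> i))"
proof -
  note Fb = finite_rank_bounded_ops[OF F]
  define M where "M = matrix_wrt bs (blinfun_apply F)"
  define n where "n = length bs"
  have M: "M \<in> carrier_mat n n" by (simp add: M_def n_def)
  obtain \<mu> where \<mu>: "\<And>z. Determinant.det (1\<^sub>m n - z \<cdot>\<^sub>m M) = (\<Prod>i<n. 1 - z * \<mu> i)"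
    "\<And>k. mat_trace (M ^\<^sub>m k) = (\<Sum>i<n. \<mu> i ^ k)"
    using mat_eigenvalue_list[OF M] by blast
  have "detp_one_minus p (z *\<^sub>C F) = (\<Prod>i<n. weierstrass_factor (reg_order p) (z * \<mu> i))" for z
  proof -
    have "range (blinfun_apply (z *\<^sub>C F)) \<subseteq> lspan bs"
      using bs(2) by (auto intro!: complex_vs.span_scale)
    then have "detp_one_minus p (z *\<^sub>C F) = mat_detp (reg_order p) (z \<cdot>\<^sub>m M)"
      using detp_basis[OF bs(1) bounded_ops_scaleC[OF Fb]] matrix_wrt_scaleC_blinfun[OF bs(1) Fb bs(2)] by (simp add: M_def)
    also have "\<dots> = (\<Prod>i<n. 1 - z * \<mu> i) * exp (\<Sum>k = 1..reg_order p. 1 / of_nat k * (z ^ k * (\<Sum>i<n. \<mu> i ^ k)))"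
    proof -
      have "mat_trace ((z \<cdot>\<^sub>m M) ^\<^sub>m k) = z ^ k * (\<Sum>i<n. \<mu> i ^ k)" for k
      proof -
        have "dim_row (M ^\<^sub>m k) = dim_col (M ^\<^sub>m k)"
          using carrier_matD[OF pow_carrier_mat[OF M, of k]] by (simp only:)
        then show ?thesis by (simp only: smult_mat_power[OF M] mat_trace_smult \<mu>(2))
      qed
      moreover have "dim_row (z \<cdot>\<^sub>m M) = n" using M by simp
      ultimately show ?thesis by (simp only: mat_detp_def \<mu>(1))
    qed
    also have "(\<Sum>k = 1..reg_order p. 1 / of_nat k * (z ^ k * (\<Sum>i<n. \<mu> i ^ k)))
        = (\<Sum>i<n. \<Sum>k = 1..reg_order p. (z * \<mu> i) ^ k / of_nat k)"
      by (subst sum.swap) (simp add: sum_distrib_left power_mult_distrib sum_divide_distrib)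
    finally show ?thesis by (simp add: exp_sum weierstrass_factor_def prod.distrib)
  qed
  then show ?thesis using that[of \<mu>] by (simp add: n_def)
qed

lemma holomorphic_matrix_power:
  assumes "\<And>z. A z \<in> carrier_mat n n" "\<And>i j. i < n \<Longrightarrow> j < n \<Longrightarrow> (\<lambda>z. A z $$ (i, j)) holomorphic_on S"
  shows "i < n \<Longrightarrow> j < n \<Longrightarrow> (\<lambda>z. (A z ^\<^sub>m k) $$ (i, j)) holomorphic_on S"
proof (induction k arbitrary: i j)
  case 0
  then have "(A z ^\<^sub>m 0) $$ (i, j) = (if i = j then 1 else 0)" for z using assms(1)[of z] by simp
  then show ?case by simp
next
  case (Suc k)
  have "(A z ^\<^sub>m Suc k) $$ (i, j) = (\<Sum>l<n. (A z ^\<^sub>m k) $$ (i, l) * A z $$ (l, j))" for z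
    using Suc.prems assms(1)[of z] pow_carrier_mat[OF assms(1)[of z], of k] by (simp add: scalar_prod_def lessThan_atLeast0)
  moreover have "(\<lambda>z. \<Sum>l<n. (A z ^\<^sub>m k) $$ (i, l) * A z $$ (l, j)) holomorphic_on S"
    using Suc.prems by (intro holomorphic_intros Suc.IH assms) auto
  ultimately show ?case by simp
qed

lemma mat_detp_holomorphic:
  assumes A: "\<And>z. A z \<in> carrier_mat n n" "\<And>i j. i < n \<Longrightarrow> j < n \<Longrightarrow> (\<lambda>z. A z $$ (i, j)) holomorphic_on S"
  shows "(\<lambda>z. mat_detp K (A z)) holomorphic_on S"
proof -
  have "1\<^sub>m n - A z = mat n n (\<lambda>(i, j). (if i = j then 1 else 0) - A z $$ (i, j))" for z
    using A(1)[of z] by (intro eq_matI) auto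
  moreover have "(\<lambda>z. Determinant.det (mat n n (\<lambda>(i, j). (if i = j then 1 else 0) - A z $$ (i, j)))) holomorphic_on S"
    by (intro det_mat_holomorphic holomorphic_intros A)
  moreover have "dim_row (A z) = n" for z using A(1)[of z] by simp
  moreover have "dim_row (A z ^\<^sub>m k) = n" for z k using carrier_matD(1)[OF pow_carrier_mat[OF A(1)[of z], of k]] .
  ultimately show ?thesis
    unfolding mat_detp_def mat_trace_def by (auto intro!: holomorphic_intros holomorphic_matrix_power[OF A])
qed

lemma matrix_wrt_line:
  assumes bs: "basis_list bs" and A: "A \<in> bounded_ops" "range (blinfun_apply A) \<subseteq> lspan bs"
    and B: "B \<in> bounded_ops" "range (blinfun_apply B) \<subseteq> lspan bs"
  shows "matrix_wrt bs (blinfun_apply (A + z *\<^sub>C B)) = matrix_wrt bs (blinfun_apply A) + z \<cdot>\<^sub>m matrix_wrt bs (blinfun_apply B)"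
proof -
  have "maps_span bs (blinfun_apply (z *\<^sub>C B))"
    using maps_span_scale[OF maps_spanI[OF B], of z] by (simp add: scaleC_blinfun.rep_eq)
  from matrix_wrt_add[OF bs maps_spanI[OF A] this] show ?thesis
    by (simp add: matrix_wrt_scaleC_blinfun[OF bs B] plus_blinfun.rep_eq)
qed

lemma range_line:
  assumes "range (blinfun_apply A) \<subseteq> lspan bs" "range (blinfun_apply B) \<subseteq> lspan bs"
  shows "range (blinfun_apply (A + z *\<^sub>C B)) \<subseteq> lspan bs"
proof clarify
  fix x
  have "A x \<in> lspan bs" "B x \<in> lspan bs" using assms by auto
  then show "(A + z *\<^sub>C B) x \<in> lspan bs" by (simp add: blinfun.add_left complex_vs.span_add complex_vs.span_scale)
qed

lemma detp_line_holomorphic: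
  assumes A: "A \<in> finite_rank_ops" and B: "B \<in> finite_rank_ops"
  shows "(\<lambda>z. detp_one_minus p (A + z *\<^sub>C B)) holomorphic_on UNIV"
proof -
  obtain bs where bs: "basis_list ([] @ bs)" "range (blinfun_apply A) \<subseteq> lspan ([] @ bs)" "range (blinfun_apply B) \<subseteq> lspan ([] @ bs)"
    using A B by (rule common_basis[where as = "[]"]) (auto simp: basis_list_def complex_vs.independent_empty)
  then have bs: "basis_list bs" "range (blinfun_apply A) \<subseteq> lspan bs" "range (blinfun_apply B) \<subseteq> lspan bs" by simp_all
  note Ab = finite_rank_bounded_ops[OF A] and Bb = finite_rank_bounded_ops[OF B]
  have "detp_one_minus p (A + z *\<^sub>C B)
      = mat_detp (reg_order p) (matrix_wrt bs (blinfun_apply A) + z \<cdot>\<^sub>m matrix_wrt bs (blinfun_apply B))" for z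
    using detp_basis[OF bs(1) _ range_line[OF bs(2,3)]] Ab Bb matrix_wrt_line[OF bs(1) Ab bs(2) Bb bs(3)] by simp
  moreover have "(\<lambda>z. mat_detp (reg_order p) (matrix_wrt bs (blinfun_apply A) + z \<cdot>\<^sub>m matrix_wrt bs (blinfun_apply B))) holomorphic_on UNIV"
    by (rule mat_detp_holomorphic[where n = "length bs"]) (auto intro!: holomorphic_intros)
  ultimately show ?thesis by simp
qed

text \<open>
  A Bernstein-Walsh inequality, by the maximum principle for the reversed polynomial.
\<close>

lemma poly_growth_outside_disc:
  fixes P :: "complex poly"
  assumes deg: "degree P \<le> m" and \<rho>: "\<rho> > 0" and bd: "\<And>w. norm w = \<rho> \<Longrightarrow> norm (poly P w) \<le> B" and w: "norm w \<ge> \<rho>"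
  shows "norm (poly P w) \<le> B * (norm w / \<rho>) ^ m"
proof -
  define R where "R = reflect_poly P"
  have w0: "w \<noteq> 0" using w \<rho> by auto
  have rev: "poly R (inverse v) = poly P v / v ^ degree P" if "v \<noteq> 0" for v
    using poly_reflect_poly_nz[of "inverse v" P] that by (simp add: R_def field_simps)
  have B0: "B \<ge> 0" using bd[of "of_real \<rho>"] \<rho> by (smt (verit) norm_ge_zero norm_of_real)
  have "norm (poly R (inverse w)) \<le> B / \<rho> ^ degree P"
  proof (rule maximum_modulus_frontier[of "poly R" "cball 0 (inverse \<rho>)"])
    fix u assume "u \<in> frontier (cball (0::complex) (inverse \<rho>))"
    then have u: "norm u = inverse \<rho>" using \<rho> by simp
    then have u0: "u \<noteq> 0" using \<rho> by auto
    have "norm (inverse u) = \<rho>" using u by (simp add: norm_inverse)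
    then show "norm (poly R u) \<le> B / \<rho> ^ degree P"
      using rev[of "inverse u"] u0 bd[of "inverse u"] \<rho> by (simp add: norm_divide norm_power divide_right_mono power_inverse norm_inverse u)
  next
    show "inverse w \<in> cball 0 (inverse \<rho>)" using w w0 \<rho> by (simp add: norm_inverse le_imp_inverse_le)
  qed (auto intro!: holomorphic_intros continuous_intros)
  then have "norm (poly P w) / norm w ^ degree P \<le> B / \<rho> ^ degree P"
    using rev[OF w0] by (simp add: norm_divide norm_power)
  then have "norm (poly P w) \<le> B / \<rho> ^ degree P * norm w ^ degree P"
    using w0 by (subst (asm) pos_divide_le_eq) auto
  then have "norm (poly P w) \<le> B * (norm w / \<rho>) ^ degree P"
    by (simp add: power_divide)
  also have "\<dots> \<le> B * (norm w / \<rho>) ^ m"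
    using deg w \<rho> B0 by (intro mult_left_mono power_increasing) auto
  finally show ?thesis .
qed

text \<open>
  In the Leibniz formula only the first \<open>m\<close> rows depend on \<open>w\<close>.
\<close>

lemma det_row_rank_polynomial:
  fixes X Y :: "complex mat"
  assumes X: "X \<in> carrier_mat n n" and Y: "Y \<in> carrier_mat n n" and rows: "\<And>i j. m \<le> i \<Longrightarrow> i < n \<Longrightarrow> j < n \<Longrightarrow> Y $$ (i, j) = 0"
  obtains P where "degree P \<le> m" "\<And>w. Determinant.det (X + w \<cdot>\<^sub>m Y) = poly P w"
proof -
  let ?S = "{p. p permutes {0..<n}}"
  define P where "P = (\<Sum>p\<in>?S. [:signof p:] * (\<Prod>i = 0..<n. [:X $$ (i, p i), Y $$ (i, p i):]))"
  have pi: "p i < n" if "p permutes {0..<n}" "i < n" for p i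
    using permutes_in_image[OF that(1), of i] that(2) by simp
  have "degree P \<le> m"
    unfolding P_def
  proof (rule degree_sum_le)
    fix p assume "p \<in> ?S"
    then have p: "p permutes {0..<n}" by simp
    have "degree ([:signof p:] * (\<Prod>i = 0..<n. [:X $$ (i, p i), Y $$ (i, p i):]) :: complex poly)
        \<le> degree [:signof p :: complex:] + degree (\<Prod>i = 0..<n. [:X $$ (i, p i), Y $$ (i, p i):])"
      by (rule degree_mult_le)
    also have "\<dots> \<le> (\<Sum>i = 0..<n. degree [:X $$ (i, p i), Y $$ (i, p i):])"
      using degree_prod_sum_le[of "{0..<n}" "\<lambda>i. [:X $$ (i, p i), Y $$ (i, p i):]"] by (simp add: o_def)
    also have "\<dots> \<le> (\<Sum>i = 0..<n. if i < m then 1 else 0)"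
      by (intro sum_mono) (use rows pi[OF p] in auto)
    also have "\<dots> = card ({0..<n} \<inter> {i. i < m})" by (simp add: sum.If_cases)
    also have "\<dots> \<le> card {0..<m}" by (intro card_mono) auto
    finally show "degree ([:signof p:] * (\<Prod>i = 0..<n. [:X $$ (i, p i), Y $$ (i, p i):]) :: complex poly) \<le> m" by simp
  qed (simp add: finite_permutations)
  moreover have "Determinant.det (X + w \<cdot>\<^sub>m Y) = poly P w" for w
  proof -
    have "Determinant.det (X + w \<cdot>\<^sub>m Y) = (\<Sum>p\<in>?S. signof p * (\<Prod>i = 0..<n. X $$ (i, p i) + w * Y $$ (i, p i)))"
      using X Y by (subst det_def'[of _ n]) (auto intro!: sum.cong prod.cong simp: pi)
    then show ?thesis by (simp add: P_def poly_sum poly_prod mult.commute)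
  qed
  ultimately show ?thesis using that by blast
qed

lemma coord_append_zero:
  assumes "basis_list (as @ bs)" "x \<in> lspan as" "length as \<le> i" "i < length (as @ bs)"
  shows "coord (as @ bs) i x = 0"
proof -
  have as: "basis_list as" using assms(1) complex_vs.independent_mono[of "set (as @ bs)" "set as"] by (auto simp: basis_list_def)
  have "coord (as @ bs) i x = coord (as @ bs) i (\<Sum>k<length as. coord as k x *\<^sub>C as ! k)"
    using coord_expand[OF as assms(2)] by simp
  also have "\<dots> = (\<Sum>k<length as. coord as k x * coord (as @ bs) i (as ! k))"
    by (rule coord_sum[OF assms(1)]) (auto intro: complex_vs.span_base)
  also have "\<dots> = 0"
  proof (rule sum.neutral, safe)
    fix k assume "k < length as"
    then have "as ! k = (as @ bs) ! k" by (simp add: nth_append)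
    then have "coord (as @ bs) i (as ! k) = 0"
      using coord_nth[OF assms(1,4), of k] \<open>k < length as\<close> assms(3) by simp
    then show "coord as k x * coord (as @ bs) i (as ! k) = 0" by simp
  qed
  finally show ?thesis .
qed

definition opow :: "('a::cbanach \<Rightarrow>\<^sub>L 'a) \<Rightarrow> nat \<Rightarrow> 'a \<Rightarrow>\<^sub>L 'a" where
  "opow A k = ((o\<^sub>L) A ^^ k) id_blinfun"

lemma opow_0 [simp]: "opow A 0 = id_blinfun" and opow_Suc: "opow A (Suc k) = A o\<^sub>L opow A k"
  by (simp_all add: opow_def)

lemma opow_apply: "blinfun_apply (opow A k) = blinfun_apply A ^^ k"
  by (induction k) (auto simp: opow_Suc)

lemma norm_opow: "norm (opow A k) \<le> norm A ^ k"
proof (induction k)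
  case 0
  show ?case by (simp add: norm_blinfun_id_le)
next
  case (Suc k)
  have "norm (opow A (Suc k)) \<le> norm A * norm (opow A k)" unfolding opow_Suc by (rule norm_blinfun_compose)
  also have "\<dots> \<le> norm A * norm A ^ k" using Suc by (intro mult_left_mono) auto
  finally show ?case by simp
qed

lemma opow_bounded_ops: "A \<in> bounded_ops \<Longrightarrow> opow A k \<in> bounded_ops"
  by (induction k) (auto simp: opow_Suc)

text \<open>
  In a fixed basis of the range of \<open>F\<close>, the diagonal entries of \<open>F S\<close> are bounded functionals of \<open>S\<close>. This makes
  trace estimates independent of the rank of \<open>S\<close>, which is unbounded along a sequence of approximants.
\<close>

lemma trace_finite_rank_bound:
  assumes F: "F \<in> finite_rank_ops"
  obtains C where "C \<ge> 0" "\<And>S. S \<in> bounded_ops \<Longrightarrow> norm (range_trace (blinfun_apply (F o\<^sub>L S))) \<le> C * norm S"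
proof -
  obtain bs where bs: "basis_list bs" "lspan bs = range (blinfun_apply F)" and Fb: "F \<in> bounded_ops"
    by (rule finite_rank_opsE[OF F])
  obtain K where K: "\<And>x i. x \<in> lspan bs \<Longrightarrow> i < length bs \<Longrightarrow> norm (coord bs i x) \<le> norm x * K"
    by (rule coord_bounded[OF bs(1)]) auto
  define C where "C = (\<Sum>i<length bs. norm F * norm (bs ! i) * \<bar>K\<bar>)"
  show ?thesis
  proof (rule that)
    show "C \<ge> 0" unfolding C_def by (intro sum_nonneg) auto
    fix S :: "'a \<Rightarrow>\<^sub>L 'a" assume S: "S \<in> bounded_ops"
    have rng: "range (blinfun_apply (F o\<^sub>L S)) \<subseteq> lspan bs" using bs(2) by auto
    have "range_trace (blinfun_apply (F o\<^sub>L S)) = (\<Sum>i<length bs. coord bs i (F (S (bs ! i))))"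
      using range_trace_basis[OF bs(1) clinear_map_bounded_ops[OF bounded_ops_compose[OF Fb S]] rng]
      by (simp add: mat_trace_def matrix_wrt_index)
    also have "norm \<dots> \<le> (\<Sum>i<length bs. norm F * norm (bs ! i) * \<bar>K\<bar> * norm S)"
    proof (rule sum_norm_le)
      fix i assume "i \<in> {..<length bs}"
      then have "norm (coord bs i (F (S (bs ! i)))) \<le> norm (F (S (bs ! i))) * K"
        using bs(2) by (intro K) auto
      also have "\<dots> \<le> norm (F (S (bs ! i))) * \<bar>K\<bar>" by (intro mult_left_mono) auto
      also have "norm (F (S (bs ! i))) \<le> norm F * (norm S * norm (bs ! i))"
        by (intro order_trans[OF norm_blinfun] mult_left_mono norm_blinfun) auto
      finally show "norm (coord bs i (F (S (bs ! i)))) \<le> norm F * norm (bs ! i) * \<bar>K\<bar> * norm S"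
        by (simp add: mult_ac mult_right_mono)
    qed
    also have "\<dots> = C * norm S" by (simp add: C_def sum_distrib_right)
    finally show "norm (range_trace (blinfun_apply (F o\<^sub>L S))) \<le> C * norm S" .
  qed
qed

lemma mat_trace_add: "A \<in> carrier_mat n n \<Longrightarrow> B \<in> carrier_mat n n \<Longrightarrow> mat_trace (A + B) = mat_trace A + mat_trace B"
  by (auto simp: mat_trace_def sum.distrib)

lemma mat_trace_diff: "A \<in> carrier_mat n n \<Longrightarrow> B \<in> carrier_mat n n \<Longrightarrow> mat_trace (A - B) = mat_trace A - mat_trace B"
  by (auto simp: mat_trace_def sum_subtractf)

text \<open>
  The induction step for \<open>trace_power_perturbation\<close>: with \<open>Z = X + W\<close>, \<open>A = Z\<^sup>k\<close> and \<open>B = X\<^sup>k\<close> it splits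
  \<open>Z\<^sup>k\<^sup>+\<^sup>1 - X\<^sup>k\<^sup>+\<^sup>1\<close> into a term with a factor \<open>W\<close>, moved to the front by cyclicity of the trace, and a
  term with \<open>Z\<^sup>k - X\<^sup>k\<close>.
\<close>

lemma mat_trace_power_step:
  assumes Z: "Z \<in> carrier_mat n n" and X: "X \<in> carrier_mat n n" and W: "W \<in> carrier_mat n n"
    and S: "S \<in> carrier_mat n n" and A: "A \<in> carrier_mat n n" and B: "B \<in> carrier_mat n n"
  shows "mat_trace ((A * (X + W) - B * X) * S) = mat_trace (W * (S * A)) + mat_trace ((A - B) * (X * S))"
proof -
  note c = mult_carrier_mat[of _ n n _ n] add_carrier_mat[of _ n n] minus_carrier_mat[of _ n n]
  have "(A * (X + W) - B * X) * S = (A * X + A * W) * S - B * X * S"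
    unfolding mult_add_distrib_mat[OF A X W]
    by (rule minus_mult_distrib_mat) (use c A X W B S in auto)
  also have "(A * X + A * W) * S = A * X * S + A * W * S"
    by (rule add_mult_distrib_mat) (use c A X W B S in auto)
  finally have "mat_trace ((A * (X + W) - B * X) * S) = mat_trace (A * X * S) + mat_trace (A * W * S) - mat_trace (B * X * S)"
    using A X W B S by (simp add: mat_trace_add[of _ n] mat_trace_diff[of _ n])
  moreover have "mat_trace (A * W * S) = mat_trace (W * (S * A))"
  proof -
    have "A * W * S = A * (W * S)" by (rule assoc_mult_mat) (use A W S in auto)
    also have "mat_trace \<dots> = mat_trace (W * S * A)" by (rule mat_trace_comm[of _ n n]) (use A W S in auto)
    also have "W * S * A = W * (S * A)" by (rule assoc_mult_mat) (use A W S in auto)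
    finally show ?thesis .
  qed
  moreover have "mat_trace ((A - B) * (X * S)) = mat_trace (A * X * S) - mat_trace (B * X * S)"
  proof -
    have "(A - B) * (X * S) = A * (X * S) - B * (X * S)"
      by (rule minus_mult_distrib_mat) (use A B X S in auto)
    also have "A * (X * S) = A * X * S" by (rule assoc_mult_mat[symmetric]) (use A X S in auto)
    also have "B * (X * S) = B * X * S" by (rule assoc_mult_mat[symmetric]) (use B X S in auto)
    finally show ?thesis using A B X S by (simp add: mat_trace_diff[of _ n])
  qed
  ultimately show ?thesis by simp
qed

text \<open>
  The difference is a sum of \<open>k\<close> terms, each of which contains \<open>w F\<close> at least once, so each is bounded by
  \<open>trace_finite_rank_bound\<close>. The bound depends on \<open>X\<close> only through its operator norm. For the induction
  one multiplies with a further operator \<open>S\<close> under the trace.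
\<close>

lemma trace_power_perturbation:
  assumes F: "F \<in> finite_rank_ops"
    and C: "C \<ge> 0" "\<And>S. S \<in> bounded_ops \<Longrightarrow> norm (range_trace (blinfun_apply (F o\<^sub>L S))) \<le> C * norm S"
    and X: "X \<in> finite_rank_ops" and a: "norm X + norm w * norm F \<le> a" and k: "k > 0"
  shows "norm (range_trace (blinfun_apply (X + w *\<^sub>C F) ^^ k) - range_trace (blinfun_apply X ^^ k)) \<le> real k * C * norm w * a ^ (k - 1)"
proof -
  obtain bs where bs: "basis_list ([] @ bs)" "range (blinfun_apply X) \<subseteq> lspan ([] @ bs)" "range (blinfun_apply F) \<subseteq> lspan ([] @ bs)"
    using X F by (rule common_basis[where as = "[]"]) (auto simp: basis_list_def complex_vs.independent_empty)
  then have bs: "basis_list bs" "range (blinfun_apply X) \<subseteq> lspan bs" "range (blinfun_apply F) \<subseteq> lspan bs" by simp_all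
  note Xb = finite_rank_bounded_ops[OF X] and Fb = finite_rank_bounded_ops[OF F]
  define n where "n = length bs"
  define Z where "Z = X + w *\<^sub>C F"
  have Zb: "Z \<in> bounded_ops" using Xb Fb by (simp add: Z_def)
  have Zr: "range (blinfun_apply Z) \<subseteq> lspan bs" unfolding Z_def by (rule range_line[OF bs(2,3)])
  define M where "M A = matrix_wrt bs (blinfun_apply A)" for A :: "'a \<Rightarrow>\<^sub>L 'a"
  have Mc: "M A \<in> carrier_mat n n" for A by (simp add: M_def n_def)
  have Mp: "M A ^\<^sub>m k \<in> carrier_mat n n" for A k by (rule pow_carrier_mat[OF Mc])
  have MZ: "M Z = M X + w \<cdot>\<^sub>m M F" unfolding M_def Z_def by (rule matrix_wrt_line[OF bs(1) Xb bs(2) Fb bs(3)])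
  have a0: "a \<ge> 0" using a by (smt (verit) mult_nonneg_nonneg norm_ge_zero)
  have Xa: "norm X \<le> a" using a by (smt (verit) mult_nonneg_nonneg norm_ge_zero)
  have Za: "norm Z \<le> a"
    using a norm_triangle_ineq[of X "w *\<^sub>C F"] by (simp add: Z_def norm_scaleC)
  have claim: "norm (mat_trace ((M Z ^\<^sub>m k - M X ^\<^sub>m k) * M S)) \<le> real k * C * norm w * a ^ (k - 1) * norm S"
    if "S \<in> bounded_ops" "maps_span bs (blinfun_apply S)" for S k
    using that
  proof (induction k arbitrary: S)
    case 0
    have "M Z ^\<^sub>m 0 - M X ^\<^sub>m 0 = 0\<^sub>m n n" using Mc[of Z] Mc[of X] by (intro eq_matI) auto
    then have "(M Z ^\<^sub>m 0 - M X ^\<^sub>m 0) * M S = 0\<^sub>m n n" using Mc[of S] by simp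
    then show ?case by (simp add: mat_trace_def)
  next
    case (Suc k)
    let ?D = "M Z ^\<^sub>m k - M X ^\<^sub>m k"
    have wF: "w \<cdot>\<^sub>m M F \<in> carrier_mat n n" using Mc[of F] by simp
    have split: "mat_trace ((M Z ^\<^sub>m Suc k - M X ^\<^sub>m Suc k) * M S)
        = mat_trace ((w \<cdot>\<^sub>m M F) * (M S * M Z ^\<^sub>m k)) + mat_trace (?D * (M X * M S))"
      using mat_trace_power_step[OF Mc[of Z] Mc[of X] wF Mc[of S] Mp[of Z k] Mp[of X k]]
      unfolding MZ[symmetric] pow_mat.simps .
    have 1: "mat_trace ((w \<cdot>\<^sub>m M F) * (M S * M Z ^\<^sub>m k)) = w * range_trace (blinfun_apply (F o\<^sub>L (S o\<^sub>L opow Z k)))"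
    proof -
      have sp: "maps_span bs (blinfun_apply (opow Z k))"
        unfolding opow_apply by (rule maps_span_funpow[OF maps_spanI[OF Zb Zr]])
      have sp2: "maps_span bs (blinfun_apply (S o\<^sub>L opow Z k))"
        using maps_span_comp[OF Suc.prems(2) sp] by (simp add: blinfun_compose.rep_eq comp_def)
      have pw: "M Z ^\<^sub>m k = matrix_wrt bs (blinfun_apply (opow Z k))"
        unfolding opow_apply M_def by (rule matrix_wrt_funpow[OF bs(1) maps_spanI[OF Zb Zr], symmetric])
      have "M S * M Z ^\<^sub>m k = matrix_wrt bs (blinfun_apply (S o\<^sub>L opow Z k))"
        unfolding pw using matrix_wrt_comp[OF bs(1) Suc.prems(2) sp] by (simp add: M_def blinfun_compose.rep_eq comp_def)
      then have all: "M F * (M S * M Z ^\<^sub>m k) = matrix_wrt bs (blinfun_apply (F o\<^sub>L (S o\<^sub>L opow Z k)))"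
        using matrix_wrt_comp[OF bs(1) maps_spanI[OF Fb bs(3)] sp2] by (simp add: M_def blinfun_compose.rep_eq comp_def)
      have "(w \<cdot>\<^sub>m M F) * (M S * M Z ^\<^sub>m k) = w \<cdot>\<^sub>m (M F * (M S * M Z ^\<^sub>m k))"
        by (rule mult_smult_assoc_mat[OF Mc mult_carrier_mat[OF Mc Mp]])
      then have "mat_trace ((w \<cdot>\<^sub>m M F) * (M S * M Z ^\<^sub>m k)) = w * mat_trace (matrix_wrt bs (blinfun_apply (F o\<^sub>L (S o\<^sub>L opow Z k))))"
        unfolding all by (simp add: mat_trace_smult)
      also have "mat_trace (matrix_wrt bs (blinfun_apply (F o\<^sub>L (S o\<^sub>L opow Z k)))) = range_trace (blinfun_apply (F o\<^sub>L (S o\<^sub>L opow Z k)))"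
      proof (rule range_trace_basis[symmetric, OF bs(1)])
        show "clinear_map (blinfun_apply (F o\<^sub>L (S o\<^sub>L opow Z k)))"
          using Fb Suc.prems(1) opow_bounded_ops[OF Zb] by (intro clinear_map_bounded_ops) auto
        show "range (blinfun_apply (F o\<^sub>L (S o\<^sub>L opow Z k))) \<subseteq> lspan bs" using bs(3) by auto
      qed
      finally show ?thesis .
    qed
    have 2: "norm (mat_trace ((w \<cdot>\<^sub>m M F) * (M S * M Z ^\<^sub>m k))) \<le> C * norm w * a ^ k * norm S"
    proof -
      have "norm (range_trace (blinfun_apply (F o\<^sub>L (S o\<^sub>L opow Z k)))) \<le> C * norm (S o\<^sub>L opow Z k)"
        using Suc.prems(1) opow_bounded_ops[OF Zb] by (intro C(2)) auto
      also have "\<dots> \<le> C * (norm S * a ^ k)"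
        by (intro mult_left_mono C(1) order_trans[OF norm_blinfun_compose] order_trans[OF norm_opow] power_mono Za) auto
      finally have "norm w * norm (range_trace (blinfun_apply (F o\<^sub>L (S o\<^sub>L opow Z k)))) \<le> norm w * (C * (norm S * a ^ k))"
        by (rule mult_left_mono) simp
      then show ?thesis unfolding 1 norm_mult by (simp only: mult_ac)
    qed
    have 3: "norm (mat_trace (?D * (M X * M S))) \<le> real k * C * norm w * a ^ k * norm S"
    proof -
      have MXS: "M X * M S = M (X o\<^sub>L S)"
        using matrix_wrt_comp[OF bs(1) maps_spanI[OF Xb bs(2)] Suc.prems(2)] by (simp add: M_def blinfun_compose.rep_eq comp_def)
      have sp: "maps_span bs (blinfun_apply (X o\<^sub>L S))"
        using maps_span_comp[OF maps_spanI[OF Xb bs(2)] Suc.prems(2)] by (simp add: blinfun_compose.rep_eq comp_def)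
      have "norm (mat_trace (?D * (M X * M S))) \<le> real k * C * norm w * a ^ (k - 1) * norm (X o\<^sub>L S)"
        unfolding MXS by (rule Suc.IH[OF bounded_ops_compose[OF Xb Suc.prems(1)] sp])
      also have "\<dots> \<le> real k * C * norm w * a ^ (k - 1) * (a * norm S)"
        by (intro mult_left_mono order_trans[OF norm_blinfun_compose] mult_right_mono Xa) (use C(1) a0 in auto)
      also have "\<dots> = real k * C * norm w * a ^ k * norm S" by (cases k) auto
      finally show ?thesis .
    qed
    have "norm (mat_trace ((M Z ^\<^sub>m Suc k - M X ^\<^sub>m Suc k) * M S)) \<le> C * norm w * a ^ k * norm S + real k * C * norm w * a ^ k * norm S"
      unfolding split by (rule order_trans[OF norm_triangle_ineq add_mono[OF 2 3]])
    also have "\<dots> = real (Suc k) * C * norm w * a ^ (Suc k - 1) * norm S" by (simp add: algebra_simps)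
    finally show ?case .
  qed
  have Mid: "M id_blinfun = 1\<^sub>m n" using matrix_wrt_id[OF bs(1)] by (simp add: M_def n_def id_blinfun.rep_eq id_def)
  have "(M Z ^\<^sub>m k - M X ^\<^sub>m k) * M id_blinfun = M Z ^\<^sub>m k - M X ^\<^sub>m k"
    unfolding Mid by (rule right_mult_one_mat[OF minus_carrier_mat[OF Mp]])
  then have "norm (mat_trace (M Z ^\<^sub>m k) - mat_trace (M X ^\<^sub>m k)) \<le> real k * C * norm w * a ^ (k - 1) * norm (id_blinfun :: 'a \<Rightarrow>\<^sub>L 'a)"
    using claim[of id_blinfun k] maps_span_id[of bs] Mp by (simp add: mat_trace_diff[of _ n] id_blinfun.rep_eq id_def)
  also have "\<dots> \<le> real k * C * norm w * a ^ (k - 1) * 1"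
    by (intro mult_left_mono norm_blinfun_id_le) (use C(1) a0 in auto)
  finally show ?thesis
    using range_trace_power[OF bs(1) Zb Zr k] range_trace_power[OF bs(1) Xb bs(2) k] by (simp add: M_def Z_def)
qed

section \<open>Extension to the ideal\<close>

locale lp_ideal_det =
  fixes J :: "('a::cbanach \<Rightarrow>\<^sub>L 'a) set" and N :: "('a \<Rightarrow>\<^sub>L 'a) \<Rightarrow> real" and p q \<gamma> \<Gamma> :: real
  assumes p: "p > 0" and ideal: "lp_ideal p q \<gamma> J N" and \<Gamma>: "\<Gamma> > 0"
    and det_bound: "\<forall>F \<in> (finite_rank_ops :: ('a \<Rightarrow>\<^sub>L 'a) set).
           cmod (detp_one_minus p F) \<le> exp (\<Gamma> * eigenvalue_power_sum p F)"
begin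

abbreviation FR :: "('a \<Rightarrow>\<^sub>L 'a) set" where "FR \<equiv> finite_rank_ops"

lemma J_bounded_ops: "L \<in> J \<Longrightarrow> L \<in> bounded_ops" and FR_J: "F \<in> FR \<Longrightarrow> F \<in> J"
  and q1: "q \<ge> 1" and dense: "(quasi_norm_topology J N) closure_of FR = J"
  and norm_le_N: "L \<in> J \<Longrightarrow> norm L \<le> N L"
  and eigenvalue_sum: "L \<in> J \<Longrightarrow> eigenvalue_term p L summable_on discrete_eigenvalues L"
    "L \<in> J \<Longrightarrow> eigenvalue_power_sum p L powr (1 / p) \<le> \<gamma> * N L"
  and N_nonneg: "L \<in> J \<Longrightarrow> N L \<ge> 0" and N_eq_0: "L \<in> J \<Longrightarrow> N L = 0 \<longleftrightarrow> L = 0"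
  and N_scale: "L \<in> J \<Longrightarrow> N (c *\<^sub>C L) = cmod c * N L"
  and N_add: "K \<in> J \<Longrightarrow> L \<in> J \<Longrightarrow> N (K + L) \<le> q * (N K + N L)"
  and N_compose: "L \<in> J \<Longrightarrow> A \<in> bounded_ops \<Longrightarrow> B \<in> bounded_ops \<Longrightarrow> N (A o\<^sub>L L o\<^sub>L B) \<le> norm A * N L * norm B"
  and J_compose: "L \<in> J \<Longrightarrow> A \<in> bounded_ops \<Longrightarrow> B \<in> bounded_ops \<Longrightarrow> A o\<^sub>L L o\<^sub>L B \<in> J"
  and J_subspace: "complex_vs.subspace J"
  using ideal unfolding lp_ideal_def quasi_norm_on_def by auto

lemma J_add: "K \<in> J \<Longrightarrow> L \<in> J \<Longrightarrow> K + L \<in> J"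
  and J_scale: "L \<in> J \<Longrightarrow> c *\<^sub>C L \<in> J"
  and J_diff: "K \<in> J \<Longrightarrow> L \<in> J \<Longrightarrow> K - L \<in> J"
  and J_zero: "0 \<in> J"
  using complex_vs.subspace_add[OF J_subspace] complex_vs.subspace_scale[OF J_subspace]
    complex_vs.subspace_diff[OF J_subspace] complex_vs.subspace_0[OF J_subspace] by auto

lemma N_diff_commute: "K \<in> J \<Longrightarrow> L \<in> J \<Longrightarrow> N (K - L) = N (L - K)"
  using N_scale[OF J_diff, of K L "-1"] by (simp add: scaleC_one complex_vs.scale_minus_left)

lemma N_zero: "N 0 = 0"
  using N_eq_0[OF J_zero] by simp

lemma N_diff_triangle: "K \<in> J \<Longrightarrow> L \<in> J \<Longrightarrow> M \<in> J \<Longrightarrow> N (K - M) \<le> q * (N (K - L) + N (L - M))"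
  using N_add[OF J_diff[of K L] J_diff[of L M]] by simp

lemma N_le_diff: "K \<in> J \<Longrightarrow> L \<in> J \<Longrightarrow> N K \<le> q * (N L + N (K - L))"
  using N_add[OF _ J_diff[of K L], of L] by simp

definition growth_const :: real where "growth_const = \<gamma> powr p * \<Gamma>"

lemma growth_const_nonneg: "growth_const \<ge> 0"
  using \<Gamma> by (simp add: growth_const_def)

lemma eigenvalue_power_sum_nonneg: "eigenvalue_power_sum p L \<ge> 0"
  unfolding eigenvalue_power_sum_def by (intro infsum_nonneg) (simp add: eigenvalue_term_def)

lemma eigenvalue_sum_bound:
  assumes L: "L \<in> J"
  shows "\<Gamma> * eigenvalue_power_sum p L \<le> growth_const * N L powr p"
proof -
  let ?S = "eigenvalue_power_sum p L"
  have S: "?S \<ge> 0" by (rule eigenvalue_power_sum_nonneg)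
  have "?S \<le> \<gamma> powr p * N L powr p"
  proof (cases "\<gamma> \<ge> 0")
    case True
    have "?S = (?S powr (1 / p)) powr p" using S p by (simp add: powr_powr)
    also have "\<dots> \<le> (\<gamma> * N L) powr p" using eigenvalue_sum(2)[OF L] p by (intro powr_mono2) auto
    also have "\<dots> = \<gamma> powr p * N L powr p" using True N_nonneg[OF L] by (simp add: powr_mult)
    finally show ?thesis .
  next
    case False
    have "0 \<le> \<gamma> * N L" using eigenvalue_sum(2)[OF L] order_trans[OF powr_ge_zero] by blast
    then have "N L = 0" using False N_nonneg[OF L] by (simp add: zero_le_mult_iff)
    then have "?S powr (1 / p) \<le> 0" using eigenvalue_sum(2)[OF L] by simp
    then have "?S = 0" by (metis S less_eq_real_def not_le powr_gt_zero)
    then show ?thesis by simp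
  qed
  then show ?thesis using mult_left_mono[of ?S "\<gamma> powr p * N L powr p" \<Gamma>] \<Gamma> by (simp add: growth_const_def mult_ac)
qed

lemma detp_bound:
  assumes "F \<in> FR" shows "cmod (detp_one_minus p F) \<le> exp (growth_const * N F powr p)"
proof -
  have "cmod (detp_one_minus p F) \<le> exp (\<Gamma> * eigenvalue_power_sum p F)" using det_bound assms by blast
  also have "\<dots> \<le> exp (growth_const * N F powr p)" using eigenvalue_sum_bound[OF FR_J[OF assms]] by simp
  finally show ?thesis .
qed

text \<open>
  The bound for the determinant at all points of quasi-norm at most \<open>q\<^sup>2 x\<close>; the factor \<open>q\<^sup>2\<close> comes from two
  applications of the quasi-triangle inequality in \<open>lipschitz_of_line_bound\<close>.
\<close>

definition segment_bound :: "real \<Rightarrow> real" where "segment_bound x = exp (growth_const * (q\<^sup>2 * x) powr p)"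

lemma segment_bound_mono: "0 \<le> x \<Longrightarrow> x \<le> y \<Longrightarrow> segment_bound x \<le> segment_bound y"
  unfolding segment_bound_def using growth_const_nonneg p by (auto intro!: mult_left_mono powr_mono2)

lemma segment_bound_pos: "segment_bound x > 0" by (simp add: segment_bound_def)

text \<open>
  Along the line \<open>L + z (K - L)\<close>, Cauchy's estimate on a circle of radius \<open>1 / N(K - L)\<close> about a point of the
  segment bounds the derivative by \<open>N(K - L)\<close> times the supremum of \<open>D\<close> on the circle. There the
  increment has quasi-norm \<open>1\<close>. The lemma is used twice, for \<open>det\<^sub>p\<close> on the finite rank operators and for its
  extension on the whole ideal.
\<close>

lemma lipschitz_of_line_bound:
  assumes V: "V \<subseteq> J" "complex_vs.subspace V" and K: "K \<in> V" and L: "L \<in> V"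
    and bd: "\<And>M. M \<in> V \<Longrightarrow> cmod (D M) \<le> exp (growth_const * N M powr p)"
    and hol: "(\<lambda>z. D (L + z *\<^sub>C (K - L))) holomorphic_on UNIV"
  shows "cmod (D K - D L) \<le> N (K - L) * segment_bound (N K + N L + 1)"
proof (cases "K = L")
  case True
  then show ?thesis using N_zero by simp
next
  case False
  have KJ: "K \<in> J" "L \<in> J" using V K L by auto
  define d where "d = N (K - L)"
  have d: "d > 0" using False N_eq_0[OF J_diff[OF KJ]] N_nonneg[OF J_diff[OF KJ]] unfolding d_def by fastforce
  define f where "f = (\<lambda>z. D (L + z *\<^sub>C (K - L)))"
  have holf: "f holomorphic_on UNIV" using hol by (simp add: f_def)
  define B where "B = segment_bound (N K + N L + 1)"
  have der: "norm (deriv f (of_real t)) \<le> B * d" if t: "0 \<le> t" "t \<le> 1" for t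
  proof -
    have "norm ((deriv ^^ 1) f (of_real t)) \<le> fact 1 * B / (1 / d) ^ 1"
    proof (rule Cauchy_inequality)
      show "f holomorphic_on ball (of_real t) (1 / d)" "continuous_on (cball (of_real t) (1 / d)) f"
        using holf by (auto intro: holomorphic_on_subset holomorphic_on_imp_continuous_on)
      fix w :: complex assume w: "norm (of_real t - w) = 1 / d"
      define u where "u = w - of_real t"
      have u: "norm u = 1 / d" using w by (simp add: u_def norm_minus_commute)
      have eq: "L + w *\<^sub>C (K - L) = (of_real (1 - t) *\<^sub>C L + of_real t *\<^sub>C K) + u *\<^sub>C (K - L)"
        by (simp add: u_def complex_vs.scale_left_diff_distrib complex_vs.scale_right_diff_distrib scaleC_one)
      have "N (L + w *\<^sub>C (K - L)) \<le> q * (N (of_real (1 - t) *\<^sub>C L + of_real t *\<^sub>C K) + N (u *\<^sub>C (K - L)))"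
        unfolding eq using KJ by (intro N_add J_add J_scale J_diff)
      also have "N (u *\<^sub>C (K - L)) = 1" using KJ u d by (simp add: N_scale[OF J_diff] d_def)
      also have "N (of_real (1 - t) *\<^sub>C L + of_real t *\<^sub>C K) \<le> q * (N (of_real (1 - t) *\<^sub>C L) + N (of_real t *\<^sub>C K))"
        using KJ by (intro N_add J_scale)
      also have "N (of_real (1 - t) *\<^sub>C L) = (1 - t) * N L" unfolding N_scale[OF KJ(2)] using t by (simp del: of_real_diff)
      also have "N (of_real t *\<^sub>C K) = t * N K" unfolding N_scale[OF KJ(1)] using t by simp
      also have "(1 - t) * N L + t * N K \<le> N K + N L"
        using t mult_left_le_one_le[OF N_nonneg[OF KJ(1)], of t] mult_left_le_one_le[OF N_nonneg[OF KJ(2)], of "1 - t"] by linarith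
      also have "q * (q * (N K + N L) + 1) \<le> q\<^sup>2 * (N K + N L + 1)"
        using q1 by (simp add: power2_eq_square algebra_simps)
      finally have Nb: "N (L + w *\<^sub>C (K - L)) \<le> q\<^sup>2 * (N K + N L + 1)" using q1 by simp
      have V': "L + w *\<^sub>C (K - L) \<in> V"
        using V(2) K L by (intro complex_vs.subspace_add complex_vs.subspace_scale complex_vs.subspace_diff)
      have "norm (f w) \<le> exp (growth_const * N (L + w *\<^sub>C (K - L)) powr p)" unfolding f_def by (rule bd[OF V'])
      also have "\<dots> \<le> B" unfolding B_def segment_bound_def
        using Nb growth_const_nonneg p N_nonneg V' V(1) by (auto intro!: mult_left_mono powr_mono2)
      finally show "norm (f w) \<le> B" .
    qed (use d in simp)
    then show ?thesis by simp
  qed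
  have "norm (f 1 - f 0) \<le> (B * d) * norm (1 - 0 :: complex)"
  proof (rule field_differentiable_bound[of "closed_segment 0 1" f "deriv f"])
    fix z :: complex assume "z \<in> closed_segment 0 1"
    then obtain t where "0 \<le> t" "t \<le> 1" "z = (1 - t) *\<^sub>R 0 + t *\<^sub>R 1"
      unfolding closed_segment_def by blast
    then have t: "0 \<le> t" "t \<le> 1" "z = of_real t"
      by (simp_all add: scaleR_conv_of_real)
    show "(f has_field_derivative deriv f z) (at z within closed_segment 0 1)"
      by (rule has_field_derivative_at_within[OF holomorphic_derivI[OF holf open_UNIV UNIV_I]])
    show "norm (deriv f z) \<le> B * d" using der t by simp
  qed auto
  then show ?thesis by (simp add: f_def B_def d_def scaleC_one mult.commute)
qed

lemma detp_lipschitz: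
  assumes "K \<in> FR" "L \<in> FR"
  shows "cmod (detp_one_minus p K - detp_one_minus p L) \<le> N (K - L) * segment_bound (N K + N L + 1)"
proof (rule lipschitz_of_line_bound[where V = FR])
  show "complex_vs.subspace FR"
    by (auto simp: complex_vs.subspace_def zero_finite_rank)
  show "(\<lambda>z. detp_one_minus p (L + z *\<^sub>C (K - L))) holomorphic_on UNIV"
    using assms by (intro detp_line_holomorphic) auto
qed (use assms FR_J detp_bound in auto)

text \<open>
  Balls of a quasi-norm need not be open, so the open set is the set of points having a whole ball inside the
  given one. It is open by the quasi-triangle inequality, with radii shrinking by a factor \<open>2 q\<close>.
\<close>

lemma ball_contains_open:
  assumes x: "x \<in> J" and e: "e > 0"
  obtains U where "openin (quasi_norm_topology J N) U" "x \<in> U" "\<And>y. y \<in> U \<Longrightarrow> y \<in> J \<and> N (y - x) \<le> e"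
proof -
  define U where "U = {y \<in> J. \<exists>m::nat. m > 0 \<and> (\<forall>w\<in>J. N (w - y) \<le> 1 / real m \<longrightarrow> N (w - x) \<le> e)}"
  have "openin (quasi_norm_topology J N) U"
    unfolding openin_quasi_norm_topology
  proof (intro conjI ballI)
    fix y assume "y \<in> U"
    then obtain m :: nat where m: "m > 0" "y \<in> J" "\<And>w. w \<in> J \<Longrightarrow> N (w - y) \<le> 1 / real m \<Longrightarrow> N (w - x) \<le> e"
      by (auto simp: U_def)
    define k where "k = nat \<lceil>2 * q\<rceil> * m"
    have k: "real k \<ge> 2 * q * real m" unfolding k_def of_nat_mult by (intro mult_right_mono real_nat_ceiling_ge) auto
    have kpos: "k > 0" using q1 m(1) by (simp add: k_def)
    have qk: "q * (1 / real k + 1 / real k) \<le> 1 / real m"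
      using k kpos m(1) q1 by (simp add: field_simps)
    have "{w \<in> J. N (w - y) \<le> 1 / real k} \<subseteq> U"
    proof clarify
      fix w assume w: "w \<in> J" "N (w - y) \<le> 1 / real k"
      have "N (v - x) \<le> e" if v: "v \<in> J" "N (v - w) \<le> 1 / real k" for v
      proof (rule m(3)[OF v(1)])
        have "N (v - y) \<le> q * (N (v - w) + N (w - y))" by (rule N_diff_triangle[OF v(1) w(1) m(2)])
        also have "\<dots> \<le> q * (1 / real k + 1 / real k)" using q1 v w by (intro mult_left_mono add_mono) auto
        finally show "N (v - y) \<le> 1 / real m" using qk by linarith
      qed
      then show "w \<in> U" using w(1) kpos by (auto simp: U_def)
    qed
    then show "\<exists>n::nat. 0 < n \<and> {w \<in> J. N (w - y) \<le> 1 / real n} \<subseteq> U" using kpos by blast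
  qed (auto simp: U_def)
  moreover have "x \<in> U"
  proof -
    obtain m0 :: nat where "inverse (real (Suc m0)) < e"
      using reals_Archimedean[OF e] by blast
    then have "1 / real (Suc m0) \<le> e" by (simp add: inverse_eq_divide)
    then obtain m :: nat where m: "m > 0" "1 / real m \<le> e" by blast
    have "\<forall>w\<in>J. N (w - x) \<le> 1 / real m \<longrightarrow> N (w - x) \<le> e" using m(2) by auto
    then show ?thesis using x m(1) unfolding U_def by blast
  qed
  moreover have "N (y - x) \<le> e" "y \<in> J" if "y \<in> U" for y
  proof -
    show y: "y \<in> J" using that by (simp add: U_def)
    have "\<exists>m::nat. m > 0 \<and> (\<forall>w\<in>J. N (w - y) \<le> 1 / real m \<longrightarrow> N (w - x) \<le> e)" using that by (simp add: U_def)
    then obtain m :: nat where "\<forall>w\<in>J. N (w - y) \<le> 1 / real m \<longrightarrow> N (w - x) \<le> e" by (elim exE conjE)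
    then show "N (y - x) \<le> e" using y N_zero by simp
  qed
  ultimately show ?thesis using that by blast
qed

lemma approximation:
  assumes x: "x \<in> J" and e: "e > 0"
  obtains F where "F \<in> FR" "N (F - x) \<le> e"
proof -
  obtain U where U: "openin (quasi_norm_topology J N) U" "x \<in> U" "\<And>y. y \<in> U \<Longrightarrow> y \<in> J \<and> N (y - x) \<le> e"
    using ball_contains_open[OF x e] by blast
  have "x \<in> (quasi_norm_topology J N) closure_of FR" using x dense by simp
  then obtain F where "F \<in> FR" "F \<in> U" using U(1,2) unfolding in_closure_of by blast
  then show ?thesis using that U(3) by blast
qed

definition approximant :: "('a \<Rightarrow>\<^sub>L 'a) \<Rightarrow> nat \<Rightarrow> 'a \<Rightarrow>\<^sub>L 'a" where
  "approximant L n = (SOME F. F \<in> FR \<and> N (F - L) \<le> 1 / real (Suc n))"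

lemma approximant:
  assumes "L \<in> J" shows "approximant L n \<in> FR" "N (approximant L n - L) \<le> 1 / real (Suc n)"
proof -
  have "\<exists>F. F \<in> FR \<and> N (F - L) \<le> 1 / real (Suc n)"
    using approximation[OF assms, of "1 / real (Suc n)"] by (metis of_nat_0_less_iff zero_less_Suc zero_less_divide_1_iff)
  from someI_ex[OF this] show "approximant L n \<in> FR" "N (approximant L n - L) \<le> 1 / real (Suc n)"
    by (auto simp: approximant_def)
qed

lemma approximant_tendsto: "L \<in> J \<Longrightarrow> (\<lambda>n. N (approximant L n - L)) \<longlonglongrightarrow> 0"
proof (rule tendsto_sandwich)
  assume L: "L \<in> J"
  show "\<forall>\<^sub>F n in sequentially. 0 \<le> N (approximant L n - L)"
    using N_nonneg[OF J_diff[OF FR_J[OF approximant(1)[OF L]] L]] by simp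
  show "\<forall>\<^sub>F n in sequentially. N (approximant L n - L) \<le> 1 / real (Suc n)"
    using approximant(2)[OF L] by simp
  show "(\<lambda>n. 1 / real (Suc n)) \<longlonglongrightarrow> 0" by (rule LIMSEQ_Suc[OF lim_1_over_n])
qed simp

text \<open>
  A local Lipschitz constant for \<open>det\<^sub>p\<close> near an operator of quasi-norm \<open>x\<close>.
\<close>

definition local_lipschitz :: "real \<Rightarrow> real" where "local_lipschitz x = 2 * q * segment_bound (2 * q * (x + 1) + 1)"

lemma local_lipschitz_pos: "local_lipschitz x > 0"
  using q1 segment_bound_pos by (simp add: local_lipschitz_def)

lemma local_lipschitz_mono: "0 \<le> x \<Longrightarrow> x \<le> y \<Longrightarrow> local_lipschitz x \<le> local_lipschitz y"
  unfolding local_lipschitz_def using q1 by (intro mult_left_mono segment_bound_mono) auto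

lemma detp_close:
  assumes F: "F \<in> FR" "N (F - L) \<le> e" and G: "G \<in> FR" "N (G - L) \<le> e" and L: "L \<in> J" and e: "e \<le> 1"
  shows "cmod (detp_one_minus p F - detp_one_minus p G) \<le> e * local_lipschitz (N L)"
proof -
  have bd: "N H \<le> q * (N L + 1)" if "H \<in> FR" "N (H - L) \<le> e" for H
  proof -
    have "N H \<le> q * (N L + N (H - L))" by (rule N_le_diff[OF FR_J[OF that(1)] L])
    also have "\<dots> \<le> q * (N L + 1)" using that e q1 by (intro mult_left_mono) auto
    finally show ?thesis .
  qed
  have "N (F - G) \<le> q * (N (F - L) + N (L - G))" by (rule N_diff_triangle[OF FR_J[OF F(1)] L FR_J[OF G(1)]])
  also have "\<dots> \<le> q * (e + e)" using F G q1 N_diff_commute[OF L FR_J[OF G(1)]] by (intro mult_left_mono) auto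
  finally have 1: "N (F - G) \<le> 2 * q * e" by simp
  have nn: "N F \<ge> 0" "N G \<ge> 0" "N (F - G) \<ge> 0"
    using N_nonneg[OF FR_J[OF F(1)]] N_nonneg[OF FR_J[OF G(1)]] N_nonneg[OF J_diff[OF FR_J[OF F(1)] FR_J[OF G(1)]]] by auto
  have 2: "segment_bound (N F + N G + 1) \<le> segment_bound (2 * q * (N L + 1) + 1)"
    by (rule segment_bound_mono) (use nn bd[OF F] bd[OF G] in auto)
  have "cmod (detp_one_minus p F - detp_one_minus p G) \<le> N (F - G) * segment_bound (N F + N G + 1)"
    by (rule detp_lipschitz[OF F(1) G(1)])
  also have "\<dots> \<le> (2 * q * e) * segment_bound (2 * q * (N L + 1) + 1)"
    by (rule mult_mono[OF 1 2 order_trans[OF nn(3) 1] less_imp_le[OF segment_bound_pos]])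
  finally show ?thesis by (simp add: local_lipschitz_def mult_ac)
qed

lemma approximant_Cauchy:
  assumes L: "L \<in> J" shows "Cauchy (\<lambda>n. detp_one_minus p (approximant L n))"
proof (rule metric_CauchyI)
  fix e :: real assume e: "e > 0"
  obtain M where M: "1 / real (Suc M) < e / local_lipschitz (N L)"
    using reals_Archimedean[of "e / local_lipschitz (N L)"] e local_lipschitz_pos by (auto simp: inverse_eq_divide)
  have "dist (detp_one_minus p (approximant L m)) (detp_one_minus p (approximant L n)) < e" if "m \<ge> M" "n \<ge> M" for m n
  proof -
    have le: "1 / real (Suc m) \<le> 1 / real (Suc M)" "1 / real (Suc n) \<le> 1 / real (Suc M)"
      using that by (auto intro!: divide_left_mono)
    have "cmod (detp_one_minus p (approximant L m) - detp_one_minus p (approximant L n)) \<le> 1 / real (Suc M) * local_lipschitz (N L)"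
      by (rule detp_close[OF approximant(1)[OF L] order_trans[OF approximant(2)[OF L] le(1)] approximant(1)[OF L] order_trans[OF approximant(2)[OF L] le(2)] L]) simp
    also have "\<dots> < e" using M local_lipschitz_pos[of "N L"] by (simp add: pos_less_divide_eq)
    finally show ?thesis by (simp add: dist_norm)
  qed
  then show "\<exists>M. \<forall>m\<ge>M. \<forall>n\<ge>M. dist (detp_one_minus p (approximant L m)) (detp_one_minus p (approximant L n)) < e" by blast
qed

definition Dext :: "('a \<Rightarrow>\<^sub>L 'a) \<Rightarrow> complex" where
  "Dext = (\<lambda>L\<in>J. lim (\<lambda>n. detp_one_minus p (approximant L n)))"

lemma Dext_lim: "L \<in> J \<Longrightarrow> (\<lambda>n. detp_one_minus p (approximant L n)) \<longlonglongrightarrow> Dext L"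
  using Cauchy_convergent[OF approximant_Cauchy] by (simp add: Dext_def convergent_LIMSEQ_iff)

text \<open>
  Convergence to \<open>Dext L\<close> is uniform over all finite rank operators near \<open>L\<close>, with a modulus depending only on
  \<open>N L\<close>. Both continuity of \<open>Dext\<close> and uniform convergence along lines follow from this.
\<close>

lemma Dext_close:
  assumes F: "F \<in> FR" "N (F - L) \<le> e" and L: "L \<in> J" and e: "0 < e" "e \<le> 1"
  shows "cmod (detp_one_minus p F - Dext L) \<le> e * local_lipschitz (N L)"
proof (rule tendsto_upperbound)
  show "(\<lambda>n. cmod (detp_one_minus p F - detp_one_minus p (approximant L n))) \<longlonglongrightarrow> cmod (detp_one_minus p F - Dext L)"
    by (intro tendsto_intros Dext_lim L)
  have "\<forall>\<^sub>F n in sequentially. N (approximant L n - L) < e"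
    using approximant_tendsto[OF L] e(1) by (rule order_tendstoD)
  then show "\<forall>\<^sub>F n in sequentially. cmod (detp_one_minus p F - detp_one_minus p (approximant L n)) \<le> e * local_lipschitz (N L)"
  proof eventually_elim
    case (elim n)
    show ?case by (rule detp_close[OF F approximant(1)[OF L] less_imp_le[OF elim] L e(2)])
  qed
qed simp

lemma Dext_FR: "F \<in> FR \<Longrightarrow> Dext F = detp_one_minus p F"
proof -
  assume F: "F \<in> FR"
  have "cmod (detp_one_minus p F - Dext F) \<le> 0"
  proof (rule tendsto_lowerbound)
    show "((\<lambda>e. e * local_lipschitz (N F)) \<longlongrightarrow> 0) (at_right 0)" by (auto intro!: tendsto_eq_intros)
    have "\<forall>\<^sub>F e in at_right 0. e \<in> {0<..<(1::real)}" by (intro eventually_at_right_real) auto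
    then show "\<forall>\<^sub>F e in at_right 0. cmod (detp_one_minus p F - Dext F) \<le> e * local_lipschitz (N F)"
    proof eventually_elim
      case (elim e)
      show ?case by (rule Dext_close[OF F _ FR_J[OF F]]) (use elim N_zero in auto)
    qed
  qed auto
  then show ?thesis by simp
qed

lemma Dext_continuous_at:
  assumes L: "L \<in> J" and K: "K \<in> J" and e: "0 < e" "e \<le> 1" and KL: "N (K - L) \<le> e / (2 * q)"
  shows "cmod (Dext K - Dext L) \<le> e * local_lipschitz (N L)"
proof (rule tendsto_upperbound)
  show "(\<lambda>n. cmod (detp_one_minus p (approximant K n) - Dext L)) \<longlonglongrightarrow> cmod (Dext K - Dext L)"
    by (intro tendsto_intros Dext_lim K)
  have "\<forall>\<^sub>F n in sequentially. N (approximant K n - K) < e / (2 * q)"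
    using approximant_tendsto[OF K] e(1) q1 by (intro order_tendstoD) auto
  then show "\<forall>\<^sub>F n in sequentially. cmod (detp_one_minus p (approximant K n) - Dext L) \<le> e * local_lipschitz (N L)"
  proof eventually_elim
    case (elim n)
    have "N (approximant K n - L) \<le> q * (N (approximant K n - K) + N (K - L))"
      by (rule N_diff_triangle[OF FR_J[OF approximant(1)[OF K]] K L])
    also have "\<dots> \<le> q * (e / (2 * q) + e / (2 * q))" using elim KL q1 by (intro mult_left_mono) auto
    also have "\<dots> = e" using q1 by simp
    finally show ?case by (intro Dext_close approximant(1) K L e)
  qed
qed simp

lemma Dext_regularized: "is_regularized_det p J N Dext"
  unfolding is_regularized_det_def
proof (intro conjI ballI)
  show "Dext \<in> extensional J" by (simp add: Dext_def)
  show "Dext F = detp_one_minus p F" if "F \<in> FR" for F by (rule Dext_FR[OF that])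
  show "continuous_map (quasi_norm_topology J N) euclidean Dext"
    unfolding continuous_map_def
  proof (intro conjI allI impI)
    show "Dext \<in> topspace (quasi_norm_topology J N) \<rightarrow> topspace euclidean" by simp
    fix U :: "complex set" assume "openin euclidean U"
    then have U: "open U" by simp
    show "openin (quasi_norm_topology J N) {x \<in> topspace (quasi_norm_topology J N). Dext x \<in> U}"
      unfolding openin_quasi_norm_topology topspace_quasi_norm_topology
    proof (intro conjI ballI)
      fix L assume "L \<in> {x \<in> J. Dext x \<in> U}"
      then have L: "L \<in> J" "Dext L \<in> U" by auto
      obtain d where d: "d > 0" "ball (Dext L) d \<subseteq> U" using U L(2) by (meson openE)
      define e where "e = min 1 (d / (2 * local_lipschitz (N L)))"
      have e: "0 < e" "e \<le> 1" using d(1) local_lipschitz_pos by (auto simp: e_def)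
      have "e * local_lipschitz (N L) \<le> d / (2 * local_lipschitz (N L)) * local_lipschitz (N L)"
        using local_lipschitz_pos[of "N L"] by (intro mult_right_mono) (auto simp: e_def)
      then have el: "e * local_lipschitz (N L) < d" using d(1) local_lipschitz_pos[of "N L"] by simp
      have "e / (2 * q) > 0" using e q1 by simp
      then obtain n :: nat where n: "1 / real (Suc n) < e / (2 * q)"
        using reals_Archimedean by (metis inverse_eq_divide)
      have "{y \<in> J. N (y - L) \<le> 1 / real (Suc n)} \<subseteq> {x \<in> J. Dext x \<in> U}"
      proof clarify
        fix K assume K: "K \<in> J" "N (K - L) \<le> 1 / real (Suc n)"
        have "cmod (Dext K - Dext L) \<le> e * local_lipschitz (N L)"
          using K n by (intro Dext_continuous_at L(1) K(1) e) linarith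
        then have "Dext K \<in> ball (Dext L) d" using el by (simp add: dist_norm norm_minus_commute)
        then show "Dext K \<in> U" using d(2) by blast
      qed
      then show "\<exists>n::nat. 0 < n \<and> {y \<in> J. N (y - L) \<le> 1 / real n} \<subseteq> {x \<in> J. Dext x \<in> U}"
        by blast
    qed auto
  qed
qed

lemma regularized_det_tendsto:
  assumes D: "is_regularized_det p J N D" and L: "L \<in> J" and F: "\<And>n. F n \<in> J" "(\<lambda>n. N (F n - L)) \<longlonglongrightarrow> 0"
  shows "(\<lambda>n. D (F n)) \<longlonglongrightarrow> D L"
proof (rule topological_tendstoI)
  fix U assume U: "open U" "D L \<in> U"
  have "openin (quasi_norm_topology J N) {x \<in> topspace (quasi_norm_topology J N). D x \<in> U}"
    using D U(1) unfolding is_regularized_det_def continuous_map_def by auto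
  then have "\<forall>x\<in>{x \<in> J. D x \<in> U}. \<exists>n::nat. 0 < n \<and> {y \<in> J. N (y - x) \<le> 1 / real n} \<subseteq> {x \<in> J. D x \<in> U}"
    unfolding openin_quasi_norm_topology topspace_quasi_norm_topology by (rule conjunct2)
  moreover have "L \<in> {x \<in> J. D x \<in> U}" using L U(2) by simp
  ultimately have "\<exists>n::nat. 0 < n \<and> {y \<in> J. N (y - L) \<le> 1 / real n} \<subseteq> {x \<in> J. D x \<in> U}"
    by (rule bspec)
  then obtain n :: nat where n: "n > 0" "{y \<in> J. N (y - L) \<le> 1 / real n} \<subseteq> {x \<in> J. D x \<in> U}"
    by (elim exE conjE)
  have "\<forall>\<^sub>F k in sequentially. N (F k - L) < 1 / real n"
    using F(2) n(1) by (intro order_tendstoD) auto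
  then show "\<forall>\<^sub>F k in sequentially. D (F k) \<in> U"
  proof eventually_elim
    case (elim k)
    then have "F k \<in> {y \<in> J. N (y - L) \<le> 1 / real n}" using F(1) by simp
    then show ?case using n(2) by blast
  qed
qed

lemma regularized_det_unique:
  assumes D: "is_regularized_det p J N D" shows "D = Dext"
proof (rule extensionalityI)
  show "D \<in> extensional J" using D by (simp add: is_regularized_det_def)
  show "Dext \<in> extensional J" by (simp add: Dext_def)
  fix L assume L: "L \<in> J"
  have "(\<lambda>n. D (approximant L n)) \<longlonglongrightarrow> D L"
    using approximant[OF L] FR_J by (intro regularized_det_tendsto[OF D L] approximant_tendsto[OF L]) auto
  moreover have "D (approximant L n) = detp_one_minus p (approximant L n)" for n
    using D approximant(1)[OF L] by (simp add: is_regularized_det_def)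
  ultimately show "D L = Dext L" using Dext_lim[OF L] LIMSEQ_unique by simp
qed

lemma Dext_tendsto:
  assumes "L \<in> J" "\<And>n. F n \<in> J" "(\<lambda>n. N (F n - L)) \<longlonglongrightarrow> 0"
  shows "(\<lambda>n. Dext (F n)) \<longlonglongrightarrow> Dext L"
  by (rule regularized_det_tendsto[OF Dext_regularized assms])

text \<open>
  Determinants along lines converge locally uniformly, so that holomorphy is inherited by \<open>Dext\<close>, and
  Hurwitz' theorem becomes available.
\<close>

lemma line_uniform_limit:
  assumes K: "K \<in> J" and L: "L \<in> J" and F: "\<And>n. F n \<in> FR" "(\<lambda>n. N (F n - K)) \<longlonglongrightarrow> 0"
    and G: "\<And>n. G n \<in> FR" "(\<lambda>n. N (G n - L)) \<longlonglongrightarrow> 0"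
  shows "uniform_limit (cball 0 \<rho>) (\<lambda>n z. detp_one_minus p (F n + z *\<^sub>C G n)) (\<lambda>z. Dext (K + z *\<^sub>C L)) sequentially"
proof (rule uniform_limitI)
  fix \<epsilon> :: real assume \<epsilon>: "\<epsilon> > 0"
  define A where "A = local_lipschitz (q * (N K + \<bar>\<rho>\<bar> * N L))"
  define e where "e = min 1 (\<epsilon> / (2 * A))"
  have A: "A > 0" by (simp add: A_def local_lipschitz_pos)
  have e: "0 < e" "e \<le> 1" using \<epsilon> A by (auto simp: e_def)
  have "e * A \<le> \<epsilon> / (2 * A) * A" using A by (intro mult_right_mono) (auto simp: e_def)
  then have eA: "e * A < \<epsilon>" using \<epsilon> A by simp
  have "(\<lambda>n. q * (N (F n - K) + \<bar>\<rho>\<bar> * N (G n - L))) \<longlonglongrightarrow> q * (0 + \<bar>\<rho>\<bar> * 0)"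
    by (intro tendsto_intros F G)
  then have "\<forall>\<^sub>F n in sequentially. q * (N (F n - K) + \<bar>\<rho>\<bar> * N (G n - L)) < e"
    using e by (intro order_tendstoD) auto
  then show "\<forall>\<^sub>F n in sequentially. \<forall>z\<in>cball 0 \<rho>. dist (detp_one_minus p (F n + z *\<^sub>C G n)) (Dext (K + z *\<^sub>C L)) < \<epsilon>"
  proof eventually_elim
    case (elim n)
    show ?case
    proof
      fix z :: complex assume "z \<in> cball 0 \<rho>"
      then have z: "norm z \<le> \<bar>\<rho>\<bar>" by auto
      have J: "F n - K \<in> J" "G n - L \<in> J" using F G K L FR_J J_diff by auto
      have eq: "F n + z *\<^sub>C G n - (K + z *\<^sub>C L) = (F n - K) + z *\<^sub>C (G n - L)"
        by (simp add: complex_vs.scale_right_diff_distrib)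
      have "N (F n + z *\<^sub>C G n - (K + z *\<^sub>C L)) \<le> q * (N (F n - K) + norm z * N (G n - L))"
        unfolding eq N_scale[OF J(2), of z, symmetric] by (rule N_add[OF J(1) J_scale[OF J(2)]])
      also have "\<dots> \<le> q * (N (F n - K) + \<bar>\<rho>\<bar> * N (G n - L))"
        using q1 z N_nonneg[OF J(2)] by (intro mult_left_mono add_left_mono mult_right_mono) auto
      finally have 1: "N (F n + z *\<^sub>C G n - (K + z *\<^sub>C L)) \<le> e" using elim by linarith
      have "N (K + z *\<^sub>C L) \<le> q * (N K + norm z * N L)"
        using N_add[OF K J_scale[OF L], of z] N_scale[OF L, of z] by simp
      also have "\<dots> \<le> q * (N K + \<bar>\<rho>\<bar> * N L)"
        using q1 z N_nonneg[OF L] by (intro mult_left_mono add_left_mono mult_right_mono) auto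
      finally have 2: "N (K + z *\<^sub>C L) \<le> q * (N K + \<bar>\<rho>\<bar> * N L)" .
      have J': "K + z *\<^sub>C L \<in> J" using K L J_add J_scale by auto
      have "cmod (detp_one_minus p (F n + z *\<^sub>C G n) - Dext (K + z *\<^sub>C L)) \<le> e * local_lipschitz (N (K + z *\<^sub>C L))"
        using F G by (intro Dext_close 1 J' e) auto
      also have "\<dots> \<le> e * A" unfolding A_def using e 2 N_nonneg[OF J'] by (intro mult_left_mono local_lipschitz_mono) auto
      finally show "dist (detp_one_minus p (F n + z *\<^sub>C G n)) (Dext (K + z *\<^sub>C L)) < \<epsilon>"
        using eA by (simp add: dist_norm)
    qed
  qed
qed

lemma Dext_line_holomorphic:
  assumes K: "K \<in> J" and L: "L \<in> J"
  shows "(\<lambda>z. Dext (K + z *\<^sub>C L)) holomorphic_on UNIV"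
proof (rule holomorphic_uniform_sequence[of UNIV "\<lambda>n z. detp_one_minus p (approximant K n + z *\<^sub>C approximant L n)"])
  show "(\<lambda>z. detp_one_minus p (approximant K n + z *\<^sub>C approximant L n)) holomorphic_on UNIV" for n
    by (intro detp_line_holomorphic approximant K L)
  fix x :: complex
  have "uniform_limit (cball 0 (norm x + 1)) (\<lambda>n z. detp_one_minus p (approximant K n + z *\<^sub>C approximant L n)) (\<lambda>z. Dext (K + z *\<^sub>C L)) sequentially"
    by (intro line_uniform_limit K L approximant approximant_tendsto)
  moreover have "cball x 1 \<subseteq> cball 0 (norm x + 1)"
    by (auto simp: dist_norm) (metis add.commute norm_minus_commute norm_triangle_sub order_trans add_left_mono)
  ultimately have "uniform_limit (cball x 1) (\<lambda>n z. detp_one_minus p (approximant K n + z *\<^sub>C approximant L n)) (\<lambda>z. Dext (K + z *\<^sub>C L)) sequentially"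
    by (rule uniform_limit_on_subset)
  then show "\<exists>d>0. cball x d \<subseteq> UNIV \<and> uniform_limit (cball x d) (\<lambda>n z. detp_one_minus p (approximant K n + z *\<^sub>C approximant L n)) (\<lambda>z. Dext (K + z *\<^sub>C L)) sequentially"
    by (intro exI[of _ 1]) auto
qed auto

end

section \<open>Growth of the determinant along a ray\<close>

lemma reg_order: "p > 0 \<Longrightarrow> p \<le> real (Suc (reg_order p))"
proof -
  assume "p > 0"
  then have "nat \<lceil>p\<rceil> \<ge> 1" by linarith
  then have "Suc (reg_order p) = nat \<lceil>p\<rceil>" by (simp add: reg_order_def)
  then show ?thesis using real_nat_ceiling_ge[of p] by simp
qed

lemma detp_zero: "detp_one_minus p (0 :: 'a::cbanach \<Rightarrow>\<^sub>L 'a) = 1"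
proof -
  obtain \<mu> where "\<And>z. detp_one_minus p (z *\<^sub>C (0 :: 'a \<Rightarrow>\<^sub>L 'a)) = (\<Prod>i<length ([]::'a list). weierstrass_factor (reg_order p) (z * \<mu> i))"
    by (rule detp_weierstrass_product[of "0 :: 'a \<Rightarrow>\<^sub>L 'a" "[]"])
      (auto simp: zero_finite_rank basis_list_def complex_vs.independent_empty complex_vs.span_empty)
  from this[of 0] show ?thesis by simp
qed

lemma detp_eq_exp_trace:
  assumes bs: "basis_list bs" and F: "F \<in> bounded_ops" "range (blinfun_apply F) \<subseteq> lspan bs"
  shows "detp_one_minus p F = Determinant.det (1\<^sub>m (length bs) - matrix_wrt bs (blinfun_apply F)) *
     exp (\<Sum>k = 1..reg_order p. 1 / of_nat k * range_trace (blinfun_apply F ^^ k))"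
  unfolding detp_one_minus_def reg_order_def
  using det_one_minus_basis[OF bs clinear_map_bounded_ops[OF F(1)] F(2)] by simp

text \<open>
  In a basis that begins with a basis of the range of \<open>F\<close>, the matrix of \<open>F\<close> has only rank many nonzero rows.
\<close>

lemma det_line_polynomial:
  assumes X: "X \<in> finite_rank_ops" and F: "F \<in> finite_rank_ops" and as: "basis_list as" "lspan as = range (blinfun_apply F)"
  obtains P where "degree P \<le> length as"
    "\<And>w. detp_one_minus p (X + w *\<^sub>C F) = poly P w * exp (\<Sum>k = 1..reg_order p. 1 / of_nat k * range_trace (blinfun_apply (X + w *\<^sub>C F) ^^ k))"
proof -
  have as': "set as \<subseteq> range (blinfun_apply F)" using as(2) complex_vs.span_superset by blast
  obtain cs where bs: "basis_list (as @ cs)" "range (blinfun_apply F) \<subseteq> lspan (as @ cs)" "range (blinfun_apply X) \<subseteq> lspan (as @ cs)"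
    by (rule common_basis[OF F X as(1) as'])
  define bs where "bs = as @ cs"
  note bs = bs[folded bs_def]
  note Xb = finite_rank_bounded_ops[OF X] and Fb = finite_rank_bounded_ops[OF F]
  define n where "n = length bs"
  have MX: "matrix_wrt bs (blinfun_apply X) \<in> carrier_mat n n" and MF: "matrix_wrt bs (blinfun_apply F) \<in> carrier_mat n n"
    by (simp_all add: n_def)
  have rows: "(- matrix_wrt bs (blinfun_apply F)) $$ (i, j) = 0" if ij: "length as \<le> i" "i < n" "j < n" for i j
  proof -
    have "F (bs ! j) \<in> lspan as" using as(2) by auto
    then have "coord bs i (F (bs ! j)) = 0"
      using coord_append_zero[of as cs "F (bs ! j)" i] bs(1) ij by (simp add: bs_def n_def)
    then show ?thesis using ij MF by (simp add: matrix_wrt_index n_def)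
  qed
  obtain P where P: "degree P \<le> length as"
    "\<And>w. Determinant.det ((1\<^sub>m n - matrix_wrt bs (blinfun_apply X)) + w \<cdot>\<^sub>m (- matrix_wrt bs (blinfun_apply F))) = poly P w"
    using det_row_rank_polynomial[OF minus_carrier_mat[OF MX] uminus_carrier_mat[OF MF] rows] by blast
  have "detp_one_minus p (X + w *\<^sub>C F) = poly P w * exp (\<Sum>k = 1..reg_order p. 1 / of_nat k * range_trace (blinfun_apply (X + w *\<^sub>C F) ^^ k))" for w
  proof -
    have "1\<^sub>m n - matrix_wrt bs (blinfun_apply (X + w *\<^sub>C F))
        = (1\<^sub>m n - matrix_wrt bs (blinfun_apply X)) + w \<cdot>\<^sub>m (- matrix_wrt bs (blinfun_apply F))"
      unfolding matrix_wrt_line[OF bs(1) Xb bs(3) Fb bs(2)] using MX MF by (intro eq_matI) auto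
    then show ?thesis
      using detp_eq_exp_trace[OF bs(1) _ range_line[OF bs(3,2)], of w p] P(2)[of w] Xb Fb by (simp add: n_def)
  qed
  then show ?thesis using that P(1) by blast
qed

lemma detp_zero_eigenvector:
  assumes F: "F \<in> finite_rank_ops" and det: "detp_one_minus p F = 0"
  shows "\<exists>x. x \<noteq> 0 \<and> blinfun_apply F x = x"
proof -
  obtain bs where bs: "basis_list bs" "lspan bs = range (blinfun_apply F)" and Fb: "F \<in> bounded_ops"
    by (rule finite_rank_opsE[OF F])
  define n where "n = length bs"
  define M where "M = matrix_wrt bs (blinfun_apply F)"
  have M: "M \<in> carrier_mat n n" by (simp add: M_def n_def)
  have "Determinant.det (1\<^sub>m n - M) = 0"
    using detp_eq_exp_trace[OF bs(1) Fb, of p] bs(2) det by (simp add: n_def M_def)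
  then obtain v where v: "v \<in> carrier_vec n" "v \<noteq> 0\<^sub>v n" "(1\<^sub>m n - M) *\<^sub>v v = 0\<^sub>v n"
    using det_0_iff_vec_prod_zero_field[OF minus_carrier_mat[OF M]] by blast
  obtain i0 where i0: "i0 < n" "vec_index v i0 \<noteq> 0"
    using v(1,2) by (metis carrier_vecD eq_vecI index_zero_vec(1) zero_carrier_vec)
  define x where "x = (\<Sum>j<n. vec_index v j *\<^sub>C bs ! j)"
  have mem: "bs ! j \<in> lspan bs" if "j < n" for j using that by (auto simp: n_def intro: complex_vs.span_base)
  have x: "x \<in> lspan bs" unfolding x_def by (intro complex_vs.span_sum complex_vs.span_scale) (use mem in auto)
  have cx: "coord bs i x = vec_index v i" if "i < n" for i
  proof -
    have "coord bs i x = (\<Sum>j<n. vec_index v j * coord bs i (bs ! j))"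
      unfolding x_def by (rule coord_sum[OF bs(1)]) (use mem in auto)
    also have "\<dots> = (\<Sum>j<n. (if i = j then 1 else 0) * vec_index v j)"
      by (intro sum.cong) (use coord_nth[OF bs(1)] that in \<open>auto simp: n_def\<close>)
    also have "\<dots> = vec_index v i" using that by (simp add: sum_indicator_mult)
    finally show ?thesis .
  qed
  have msp: "maps_span bs (blinfun_apply F)" using maps_spanI[OF Fb, of bs] bs(2) by simp
  have Fx: "coord bs i (F x) = vec_index v i" if "i < n" for i
  proof -
    have "coord bs i (F x) = (\<Sum>k<n. M $$ (i, k) * vec_index v k)"
      using coord_apply[OF bs(1) msp x, of i] that cx by (simp add: M_def n_def matrix_wrt_index)
    moreover have "vec_index ((1\<^sub>m n - M) *\<^sub>v v) i = vec_index v i - (\<Sum>k<n. M $$ (i, k) * vec_index v k)"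
    proof -
      have "vec_index ((1\<^sub>m n - M) *\<^sub>v v) i = (\<Sum>k<n. ((if i = k then 1 else 0) - M $$ (i, k)) * vec_index v k)"
        using that M v(1) by (auto simp: scalar_prod_def lessThan_atLeast0 intro!: sum.cong)
      also have "\<dots> = vec_index v i - (\<Sum>k<n. M $$ (i, k) * vec_index v k)"
        using sum_indicator_mult[OF that, of 1 "vec_index v"] by (simp only: left_diff_distrib sum_subtractf) simp
      finally show ?thesis .
    qed
    ultimately show ?thesis using v(3) that by simp
  qed
  have "F x = x"
  proof -
    have "F x = (\<Sum>i<n. coord bs i (F x) *\<^sub>C bs ! i)" using coord_expand[OF bs(1), of "F x"] bs(2) by (simp add: n_def)
    also have "\<dots> = (\<Sum>i<n. coord bs i x *\<^sub>C bs ! i)" using Fx cx by simp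
    also have "\<dots> = x" using coord_expand[OF bs(1) x] by (simp add: n_def)
    finally show ?thesis .
  qed
  moreover have "x \<noteq> 0" using cx[OF i0(1)] i0(2) coord_zero[OF bs(1)] by auto
  ultimately show ?thesis by blast
qed

context lp_ideal_det
begin

text \<open>
  Consider \<open>w \<mapsto> det\<^sub>p(I - (z X + w F))\<close>. Up to the exponential of trace terms this is a polynomial of degree at
  most \<open>m\<close>, the rank of \<open>F\<close>. It is bounded on the circle \<open>|w| = \<rho>\<close>, where \<open>F\<close> enters the general bound
  only with the small weight \<open>\<rho>\<close>, and the extrapolation from there to \<open>w = z\<close> costs no more than
  \<open>(|z| / \<rho>)\<^sup>m\<close>. The change of the trace terms is controlled by \<open>trace_power_perturbation\<close>; the exponents
  \<open>k \<le> \<lceil>p\<rceil> - 1\<close> make it of order \<open>|z|\<^sup>k\<close>, which is lower than \<open>|z|\<^sup>p\<close>. The constants \<open>m\<close> and \<open>C\<close> do not depend on \<open>X\<close>.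
\<close>

lemma finite_rank_split_growth:
  assumes F: "F \<in> FR"
  shows "\<exists>(m::nat) C. C \<ge> 0 \<and>
    (\<forall>X z \<rho>. X \<in> FR \<longrightarrow> 0 < \<rho> \<longrightarrow> \<rho> \<le> norm z \<longrightarrow>
      cmod (detp_one_minus p (z *\<^sub>C (X + F))) \<le> exp (growth_const * (q * (norm z * N X + \<rho> * N F)) powr p
        + 2 * (\<Sum>k = 1..reg_order p. C * norm z * (norm z * (norm X + norm F)) ^ (k - 1))) * (norm z / \<rho>) ^ m)"
proof -
  obtain as where as: "basis_list as" "lspan as = range (blinfun_apply F)" and Fb: "F \<in> bounded_ops"
    by (rule finite_rank_opsE[OF F])
  obtain C where C: "C \<ge> 0" "\<And>S. S \<in> bounded_ops \<Longrightarrow> norm (range_trace (blinfun_apply (F o\<^sub>L S))) \<le> C * norm S"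
    using trace_finite_rank_bound[OF F] by blast
  show ?thesis
  proof (intro exI[of _ "length as"] exI[of _ C] conjI allI impI C(1))
    fix X :: "'a \<Rightarrow>\<^sub>L 'a" and z :: complex and \<rho> :: real
    assume X: "X \<in> FR" and \<rho>: "0 < \<rho>" "\<rho> \<le> norm z"
    define Y where "Y = z *\<^sub>C X"
    define a where "a = norm z * (norm X + norm F)"
    define s where "s w = (\<Sum>k = 1..reg_order p. 1 / of_nat k * range_trace (blinfun_apply (Y + w *\<^sub>C F) ^^ k))" for w
    define T where "T = (\<Sum>k = 1..reg_order p. C * norm z * a ^ (k - 1))"
    have Y: "Y \<in> FR" using X by (auto simp: Y_def)
    have a0: "a \<ge> 0" by (simp add: a_def)
    obtain P where P: "degree P \<le> length as" "\<And>w. detp_one_minus p (Y + w *\<^sub>C F) = poly P w * exp (s w)"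
      using det_line_polynomial[OF Y F as, of p] unfolding s_def by blast
    have corr: "norm (s w - s 0) \<le> T" if w: "norm w \<le> norm z" for w
    proof -
      have na: "norm Y + norm w * norm F \<le> a"
        using w by (simp add: Y_def a_def norm_scaleC distrib_left mult_right_mono)
      have "s w - s 0 = (\<Sum>k = 1..reg_order p. 1 / of_nat k *
          (range_trace (blinfun_apply (Y + w *\<^sub>C F) ^^ k) - range_trace (blinfun_apply Y ^^ k)))"
        by (simp add: s_def right_diff_distrib sum_subtractf diff_divide_distrib complex_vs.scale_zero_left)
      also have "norm \<dots> \<le> T" unfolding T_def
      proof (rule sum_norm_le)
        fix k assume "k \<in> {1..reg_order p}"
        then have k: "k > 0" by simp
        have "norm (range_trace (blinfun_apply (Y + w *\<^sub>C F) ^^ k) - range_trace (blinfun_apply Y ^^ k))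
            \<le> real k * C * norm w * a ^ (k - 1)"
          by (rule trace_power_perturbation[OF F C Y na k])
        also have "\<dots> \<le> real k * C * norm z * a ^ (k - 1)"
          using w C(1) a0 by (intro mult_right_mono mult_left_mono) auto
        finally have "norm (range_trace (blinfun_apply (Y + w *\<^sub>C F) ^^ k) - range_trace (blinfun_apply Y ^^ k)) / real k
            \<le> C * norm z * a ^ (k - 1)"
          using k by (simp add: pos_divide_le_eq mult_ac)
        then show "norm (1 / of_nat k * (range_trace (blinfun_apply (Y + w *\<^sub>C F) ^^ k) - range_trace (blinfun_apply Y ^^ k)))
            \<le> C * norm z * a ^ (k - 1)"
          by (simp add: norm_mult norm_divide)
      qed
      finally show ?thesis .
    qed
    define B where "B = exp (growth_const * (q * (norm z * N X + \<rho> * N F)) powr p + T)"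
    (* Dividing by exp (s w - s 0) rather than exp (s w) leaves only the change of the traces to be
       estimated; the traces of powers of Y themselves are not controlled by the quasi-norm. *)
    define P' where "P' = Polynomial.smult (exp (s 0)) P"
    have P': "poly P' w = detp_one_minus p (Y + w *\<^sub>C F) * exp (- (s w - s 0))" for w
      by (simp add: P'_def P(2) exp_diff exp_minus field_simps)
    have sphere: "norm (poly P' w) \<le> B" if w: "norm w = \<rho>" for w
    proof -
      have XJ: "X \<in> J" "F \<in> J" using X F FR_J by auto
      have "N (Y + w *\<^sub>C F) \<le> q * (norm z * N X + \<rho> * N F)"
        using N_add[OF J_scale[OF XJ(1), of z] J_scale[OF XJ(2), of w]] w
        by (simp add: Y_def N_scale[OF XJ(1)] N_scale[OF XJ(2)])
      then have "growth_const * N (Y + w *\<^sub>C F) powr p \<le> growth_const * (q * (norm z * N X + \<rho> * N F)) powr p"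
        using growth_const_nonneg p N_nonneg[OF FR_J[of "Y + w *\<^sub>C F"]] Y F by (auto intro!: mult_left_mono powr_mono2)
      moreover have "cmod (detp_one_minus p (Y + w *\<^sub>C F)) \<le> exp (growth_const * N (Y + w *\<^sub>C F) powr p)"
        using Y F by (intro detp_bound) auto
      moreover have "norm (exp (- (s w - s 0))) \<le> exp T"
      proof -
        have "norm (exp (- (s w - s 0))) \<le> exp (norm (s w - s 0))"
          using norm_exp[of "- (s w - s 0)"] by (simp only: norm_minus_cancel)
        also have "\<dots> \<le> exp T" using corr[of w] w \<rho> by simp
        finally show ?thesis .
      qed
      ultimately have "cmod (detp_one_minus p (Y + w *\<^sub>C F)) * norm (exp (- (s w - s 0)))
          \<le> exp (growth_const * (q * (norm z * N X + \<rho> * N F)) powr p) * exp T"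
        by (intro mult_mono) (auto intro: order_trans)
      then show ?thesis unfolding P' norm_mult B_def exp_add .
    qed
    have pz: "norm (poly P' z) \<le> B * (norm z / \<rho>) ^ length as"
      by (rule poly_growth_outside_disc[OF _ \<rho>(1) sphere \<rho>(2)]) (use P(1) in \<open>simp add: P'_def\<close>)
    have eq: "detp_one_minus p (z *\<^sub>C (X + F)) = poly P' z * exp (s z - s 0)"
      by (simp add: P' Y_def scaleC_add_right mult.assoc flip: exp_add)
    have ez: "norm (exp (s z - s 0)) \<le> exp T"
      by (rule order_trans[OF norm_exp]) (use corr[of z] in simp)
    have "cmod (detp_one_minus p (z *\<^sub>C (X + F))) \<le> (B * (norm z / \<rho>) ^ length as) * exp T"
      unfolding eq norm_mult by (rule mult_mono'[OF pz ez]) auto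
    also have "\<dots> = exp (growth_const * (q * (norm z * N X + \<rho> * N F)) powr p + 2 * T) * (norm z / \<rho>) ^ length as"
    proof -
      have "exp (x + 2 * T) = exp (x + T) * exp T" for x by (simp flip: exp_add)
      then show ?thesis by (simp only: B_def mult_ac)
    qed
    finally show "cmod (detp_one_minus p (z *\<^sub>C (X + F))) \<le> exp (growth_const * (q * (norm z * N X + \<rho> * N F)) powr p
        + 2 * (\<Sum>k = 1..reg_order p. C * norm z * (norm z * (norm X + norm F)) ^ (k - 1))) * (norm z / \<rho>) ^ length as"
      by (simp add: T_def a_def)
  qed
qed

text \<open>
  Fix a finite rank \<open>F\<close> with \<open>N(F - L) \<le> \<eta>\<close>. Every approximant \<open>G\<close> of \<open>L\<close> is \<open>F + X\<close> with \<open>N X = O(\<eta>)\<close>, and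
  \<open>finite_rank_split_growth\<close> with \<open>\<rho>\<close> a small multiple of \<open>|z|\<close> bounds \<open>det\<^sub>p(I - z G)\<close> by
  \<open>exp(O(\<eta>\<^sup>p) |z|\<^sup>p)\<close> up to factors of lower order, uniformly in \<open>G\<close>.
\<close>

lemma Dext_minimal_type:
  assumes L: "L \<in> J" and \<epsilon>: "\<epsilon> > 0"
  shows "\<exists>C. \<forall>z. cmod (Dext (z *\<^sub>C L)) \<le> C * exp (\<epsilon> * norm z ^ Suc (reg_order p))"
proof -
  define K where "K = reg_order p"
  have pK: "p \<le> real (Suc K)" using reg_order[OF p] by (simp add: K_def)
  obtain \<eta> where \<eta>: "0 < \<eta>" "\<eta> \<le> 1" "growth_const * (3 * q\<^sup>2 * \<eta>) powr p \<le> \<epsilon> / 2"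
  proof -
    have "((\<lambda>\<eta>. growth_const * (3 * q\<^sup>2 * \<eta>) powr p) \<longlongrightarrow> growth_const * (3 * q\<^sup>2 * 0) powr p) (at_right 0)"
    proof (rule tendsto_mult_left, rule tendsto_powr2[OF _ tendsto_const])
      show "((\<lambda>\<eta>. 3 * q\<^sup>2 * \<eta>) \<longlongrightarrow> 3 * q\<^sup>2 * 0) (at_right 0)"
        by (intro tendsto_mult_left tendsto_ident_at)
      show "\<forall>\<^sub>F \<eta> in at_right 0. 0 \<le> 3 * q\<^sup>2 * \<eta>"
        using eventually_at_right_less[of "0::real"] by (rule eventually_mono) simp
    qed (rule p)
    then have "((\<lambda>\<eta>. growth_const * (3 * q\<^sup>2 * \<eta>) powr p) \<longlongrightarrow> 0) (at_right 0)" using p by simp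
    then have "\<forall>\<^sub>F \<eta> in at_right 0. growth_const * (3 * q\<^sup>2 * \<eta>) powr p < \<epsilon> / 2"
      using \<epsilon> by (intro order_tendstoD) auto
    moreover have "\<forall>\<^sub>F \<eta> in at_right 0. \<eta> \<in> {0<..<(1::real)}" by (intro eventually_at_right_real) auto
    ultimately have "\<forall>\<^sub>F \<eta> in at_right 0. 0 < \<eta> \<and> \<eta> \<le> 1 \<and> growth_const * (3 * q\<^sup>2 * \<eta>) powr p \<le> \<epsilon> / 2"
      by eventually_elim auto
    from eventually_happens'[OF _ this] obtain \<eta>
      where "0 < \<eta>" "\<eta> \<le> 1" "growth_const * (3 * q\<^sup>2 * \<eta>) powr p \<le> \<epsilon> / 2" by auto
    then show ?thesis by (rule that)
  qed
  obtain F where F: "F \<in> FR" "N (F - L) \<le> \<eta>" by (rule approximation[OF L \<eta>(1)])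
  obtain m :: nat and C where C: "C \<ge> 0" and growth: "\<And>X z \<rho>. X \<in> FR \<Longrightarrow> 0 < \<rho> \<Longrightarrow> \<rho> \<le> norm z \<Longrightarrow>
      cmod (detp_one_minus p (z *\<^sub>C (X + F))) \<le> exp (growth_const * (q * (norm z * N X + \<rho> * N F)) powr p
        + 2 * (\<Sum>k = 1..K. C * norm z * (norm z * (norm X + norm F)) ^ (k - 1))) * (norm z / \<rho>) ^ m"
    using finite_rank_split_growth[OF F(1)] unfolding K_def by blast
  define T0 where "T0 = (\<Sum>k = 1..K. C * (2 * q + norm F) ^ (k - 1))"
  have T0: "T0 \<ge> 0" unfolding T0_def using C q1 by (intro sum_nonneg mult_nonneg_nonneg zero_le_power) auto
  define R0 where "R0 = 4 * T0 / \<epsilon>"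
  define E1 where "E1 = exp (2 * T0 * R0 ^ K) * ((N F + 1) / \<eta>) ^ m"
  define E2 where "E2 = exp (growth_const * (q * (N L + 1)) powr p)"
  have NF: "N F \<ge> 0" using N_nonneg[OF FR_J[OF F(1)]] .
  have bound: "cmod (detp_one_minus p (z *\<^sub>C G)) \<le> max E1 E2 * exp (\<epsilon> * norm z ^ Suc K)" if G: "G \<in> FR" "N (G - L) \<le> \<eta>" for G z
  proof (cases "norm z \<ge> 1")
    case True
    define X where "X = G - F"
    have X: "X \<in> FR" using G F by (auto simp: X_def)
    have "N X \<le> q * (N (G - L) + N (L - F))" unfolding X_def by (rule N_diff_triangle[OF FR_J[OF G(1)] L FR_J[OF F(1)]])
    also have "\<dots> \<le> q * (\<eta> + \<eta>)" using G F q1 N_diff_commute[OF L FR_J[OF F(1)]] by (intro mult_left_mono) auto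
    finally have NX: "N X \<le> 2 * q * \<eta>" by simp
    have "norm X \<le> N X" by (rule norm_le_N[OF FR_J[OF X]])
    also note NX
    also have "2 * q * \<eta> \<le> 2 * q * 1" using \<eta>(2) q1 by (intro mult_left_mono) auto
    finally have normX: "norm X \<le> 2 * q" by simp
    (* Then \<rho> N F is at most \<eta> |z|, and the ratio |z| / \<rho> does not depend on z. *)
    define \<rho> where "\<rho> = \<eta> * norm z / (N F + 1)"
    have \<rho>0: "\<rho> > 0" using \<eta>(1) True NF by (auto simp: \<rho>_def intro!: divide_pos_pos mult_pos_pos)
    have \<rho>F: "\<rho> * N F \<le> \<eta> * norm z"
    proof -
      have "\<rho> * N F \<le> \<rho> * (N F + 1)" using \<rho>0 by (intro mult_left_mono) auto
      also have "\<dots> = \<eta> * norm z" using NF by (simp add: \<rho>_def)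
      finally show ?thesis .
    qed
    have \<rho>z: "\<rho> \<le> norm z"
    proof -
      have "\<rho> \<le> \<eta> * norm z / 1" unfolding \<rho>_def using NF \<eta>(1) by (intro divide_left_mono) auto
      also have "\<dots> \<le> 1 * norm z" using \<eta>(2) mult_right_mono[of \<eta> 1 "norm z"] by simp
      finally show ?thesis by simp
    qed
    have ratio: "norm z / \<rho> = (N F + 1) / \<eta>" using True NF \<eta>(1) by (auto simp: \<rho>_def)
    have zpow: "norm z powr p \<le> norm z ^ Suc K"
    proof -
      have "norm z powr real (Suc K) = norm z ^ Suc K"
        by (rule powr_realpow) (use True in linarith)
      then show ?thesis using powr_mono[OF pK True] by (simp only:)
    qed
    have e1: "growth_const * (q * (norm z * N X + \<rho> * N F)) powr p \<le> \<epsilon> / 2 * norm z ^ Suc K"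
    proof -
      have "norm z * N X \<le> norm z * (2 * q * \<eta>)" using NX by (intro mult_left_mono) auto
      then have "norm z * N X + \<rho> * N F \<le> norm z * (2 * q * \<eta>) + \<eta> * norm z" using \<rho>F by linarith
      also have "\<dots> \<le> 3 * q * \<eta> * norm z" using q1 \<eta>(1) mult_right_mono[of 1 q "\<eta> * norm z"] by (simp add: algebra_simps)
      finally have "q * (norm z * N X + \<rho> * N F) \<le> q * (3 * q * \<eta> * norm z)" using q1 by (intro mult_left_mono) auto
      also have "\<dots> = (3 * q\<^sup>2 * \<eta>) * norm z" by (simp add: power2_eq_square)
      finally have "(q * (norm z * N X + \<rho> * N F)) powr p \<le> ((3 * q\<^sup>2 * \<eta>) * norm z) powr p"
        using p q1 N_nonneg[OF FR_J[OF X]] NF \<rho>0 by (intro powr_mono2) auto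
      also have "\<dots> = (3 * q\<^sup>2 * \<eta>) powr p * norm z powr p" using \<eta>(1) by (simp add: powr_mult)
      finally have "growth_const * (q * (norm z * N X + \<rho> * N F)) powr p \<le> growth_const * ((3 * q\<^sup>2 * \<eta>) powr p * norm z powr p)"
        using growth_const_nonneg by (intro mult_left_mono) auto
      also have "\<dots> = (growth_const * (3 * q\<^sup>2 * \<eta>) powr p) * norm z powr p" by simp
      also have "\<dots> \<le> \<epsilon> / 2 * norm z ^ Suc K" using \<eta>(3) zpow \<epsilon> by (intro mult_mono) auto
      finally show ?thesis .
    qed
    have e2: "2 * (\<Sum>k = 1..K. C * norm z * (norm z * (norm X + norm F)) ^ (k - 1)) \<le> 2 * T0 * R0 ^ K + \<epsilon> / 2 * norm z ^ Suc K"
    proof -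
      have "(\<Sum>k = 1..K. C * norm z * (norm z * (norm X + norm F)) ^ (k - 1)) \<le> (\<Sum>k = 1..K. C * (2 * q + norm F) ^ (k - 1) * norm z ^ K)"
      proof (rule sum_mono)
        fix k assume k: "k \<in> {1..K}"
        have "C * norm z * (norm z * (norm X + norm F)) ^ (k - 1) = C * (norm X + norm F) ^ (k - 1) * norm z ^ k"
          using k by (cases k) (auto simp: power_mult_distrib)
        also have "\<dots> \<le> C * (2 * q + norm F) ^ (k - 1) * norm z ^ K"
          using C k True normX q1 by (intro mult_mono power_mono power_increasing mult_left_mono) auto
        finally show "C * norm z * (norm z * (norm X + norm F)) ^ (k - 1) \<le> C * (2 * q + norm F) ^ (k - 1) * norm z ^ K" .
      qed
      also have "\<dots> = T0 * norm z ^ K" by (simp add: T0_def sum_distrib_right)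
      finally have 1: "2 * (\<Sum>k = 1..K. C * norm z * (norm z * (norm X + norm F)) ^ (k - 1)) \<le> 2 * T0 * norm z ^ K" by simp
      show ?thesis
      proof (cases "norm z \<le> R0")
        case True
        have "2 * T0 * norm z ^ K \<le> 2 * T0 * R0 ^ K" using True T0 by (intro mult_left_mono power_mono) auto
        moreover have "0 \<le> \<epsilon> / 2 * norm z ^ Suc K" using \<epsilon> by simp
        ultimately show ?thesis using 1 by linarith
      next
        case False
        have "2 * T0 = \<epsilon> / 2 * R0" using \<epsilon> by (simp add: R0_def)
        also have "\<dots> \<le> \<epsilon> / 2 * norm z" using False \<epsilon> by (intro mult_left_mono) auto
        finally have "2 * T0 * norm z ^ K \<le> \<epsilon> / 2 * norm z * norm z ^ K" by (intro mult_right_mono) auto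
        moreover have "0 \<le> 2 * T0 * R0 ^ K" using T0 \<epsilon> by (simp add: R0_def)
        ultimately show ?thesis using 1 by simp
      qed
    qed
    have "z *\<^sub>C G = z *\<^sub>C (X + F)" by (simp add: X_def)
    then have "cmod (detp_one_minus p (z *\<^sub>C G)) \<le> exp (growth_const * (q * (norm z * N X + \<rho> * N F)) powr p
        + 2 * (\<Sum>k = 1..K. C * norm z * (norm z * (norm X + norm F)) ^ (k - 1))) * (norm z / \<rho>) ^ m"
      using growth[OF X \<rho>0 \<rho>z] by (simp only:)
    also have "\<dots> \<le> exp (\<epsilon> / 2 * norm z ^ Suc K + (2 * T0 * R0 ^ K + \<epsilon> / 2 * norm z ^ Suc K)) * (norm z / \<rho>) ^ m"
      using e1 e2 \<rho>0 by (intro mult_right_mono) (simp_all only: exp_le_cancel_iff add_mono, auto)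
    also have "\<dots> = E1 * exp (\<epsilon> * norm z ^ Suc K)"
    proof -
      have "\<epsilon> / 2 * norm z ^ Suc K + (2 * T0 * R0 ^ K + \<epsilon> / 2 * norm z ^ Suc K) = 2 * T0 * R0 ^ K + \<epsilon> * norm z ^ Suc K" by simp
      then show ?thesis unfolding E1_def ratio by (simp only: exp_add mult_ac)
    qed
    also have "\<dots> \<le> max E1 E2 * exp (\<epsilon> * norm z ^ Suc K)" by (intro mult_right_mono) auto
    finally show ?thesis .
  next
    case False
    have GJ: "G \<in> J" by (rule FR_J[OF G(1)])
    have "N G \<le> q * (N L + N (G - L))" by (rule N_le_diff[OF GJ L])
    also have "\<dots> \<le> q * (N L + 1)" using G(2) \<eta>(2) q1 by (intro mult_left_mono) auto
    finally have NG: "N G \<le> q * (N L + 1)" .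
    have "N (z *\<^sub>C G) \<le> 1 * N G" unfolding N_scale[OF GJ] using False N_nonneg[OF GJ] by (intro mult_right_mono) auto
    then have "N (z *\<^sub>C G) \<le> q * (N L + 1)" using NG by simp
    then have "growth_const * N (z *\<^sub>C G) powr p \<le> growth_const * (q * (N L + 1)) powr p"
      using growth_const_nonneg p N_nonneg[OF J_scale[OF GJ]] by (intro mult_left_mono powr_mono2) auto
    then have "cmod (detp_one_minus p (z *\<^sub>C G)) \<le> E2"
      using detp_bound[OF finite_rank_ops_scaleC[OF G(1)], of z] unfolding E2_def by (meson exp_le_cancel_iff order_trans)
    also have "\<dots> \<le> max E1 E2 * 1" by simp
    also have "\<dots> \<le> max E1 E2 * exp (\<epsilon> * norm z ^ Suc K)"
    proof (rule mult_left_mono)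
      show "0 \<le> max E1 E2" by (simp add: E2_def le_max_iff_disj)
    qed (use \<epsilon> in simp)
    finally show ?thesis .
  qed
  have "cmod (Dext (z *\<^sub>C L)) \<le> max E1 E2 * exp (\<epsilon> * norm z ^ Suc K)" for z
  proof (rule tendsto_upperbound)
    have "(\<lambda>n. norm z * N (approximant L n - L)) \<longlonglongrightarrow> norm z * 0" by (intro tendsto_intros approximant_tendsto L)
    moreover have "N (z *\<^sub>C approximant L n - z *\<^sub>C L) = norm z * N (approximant L n - L)" for n
      using N_scale[OF J_diff[OF FR_J[OF approximant(1)[OF L]] L]] by (simp add: complex_vs.scale_right_diff_distrib)
    ultimately have "(\<lambda>n. Dext (z *\<^sub>C approximant L n)) \<longlonglongrightarrow> Dext (z *\<^sub>C L)"
      by (intro Dext_tendsto J_scale L FR_J[OF approximant(1)]) auto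
    then show "(\<lambda>n. cmod (Dext (z *\<^sub>C approximant L n))) \<longlonglongrightarrow> cmod (Dext (z *\<^sub>C L))" by (rule tendsto_norm)
    have "\<forall>\<^sub>F n in sequentially. N (approximant L n - L) < \<eta>" by (rule order_tendstoD(2)[OF approximant_tendsto[OF L] \<eta>(1)])
    then show "\<forall>\<^sub>F n in sequentially. cmod (Dext (z *\<^sub>C approximant L n)) \<le> max E1 E2 * exp (\<epsilon> * norm z ^ Suc K)"
    proof eventually_elim
      case (elim n)
      then show ?case using bound[OF approximant(1)[OF L], of n z] Dext_FR[OF finite_rank_ops_scaleC[OF approximant(1)[OF L]]] by simp
    qed
  qed simp
  then show ?thesis unfolding K_def by blast
qed

end

section \<open>Zeros of the determinant are reciprocals of eigenvalues\<close>

text \<open>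
  If \<open>A B = B A = 0\<close>, then \<open>1 - (A + B) = (1 - A) (1 - B)\<close> and \<open>(A + B)\<^sup>k = A\<^sup>k + B\<^sup>k\<close>.
\<close>

lemma mat_detp_add_orthogonal:
  fixes A B :: "complex mat"
  assumes A: "A \<in> carrier_mat n n" and B: "B \<in> carrier_mat n n" and AB: "A * B = 0\<^sub>m n n" and BA: "B * A = 0\<^sub>m n n"
  shows "mat_detp K (A + B) = mat_detp K A * mat_detp K B"
proof -
  have "(1\<^sub>m n - A) * (1\<^sub>m n - B) = 1\<^sub>m n - (A + B)"
  proof -
    have "(1\<^sub>m n - A) * (1\<^sub>m n - B) = 1\<^sub>m n * (1\<^sub>m n - B) - A * (1\<^sub>m n - B)"
      by (rule minus_mult_distrib_mat) (use A B in auto)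
    also have "A * (1\<^sub>m n - B) = A * 1\<^sub>m n - A * B"
      by (rule mult_minus_distrib_mat) (use A B in auto)
    finally show ?thesis unfolding AB using A B by (intro eq_matI) auto
  qed
  then have det: "Determinant.det (1\<^sub>m n - (A + B)) = Determinant.det (1\<^sub>m n - A) * Determinant.det (1\<^sub>m n - B)"
    using det_mult[OF minus_carrier_mat[OF A, of "1\<^sub>m n"] minus_carrier_mat[OF B, of "1\<^sub>m n"]] by simp
  have Ak: "A ^\<^sub>m k \<in> carrier_mat n n" and Bk: "B ^\<^sub>m k \<in> carrier_mat n n" for k
    using A B by (auto intro: pow_carrier_mat)
  have pow: "(A + B) ^\<^sub>m Suc k = A ^\<^sub>m Suc k + B ^\<^sub>m Suc k" for k
  proof (induction k)
    case 0
    show ?case using A B by simp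
  next
    case (Suc k)
    have AkB: "A ^\<^sub>m Suc k * B = 0\<^sub>m n n"
      using assoc_mult_mat[OF Ak[of k] A B] AB right_mult_zero_mat[OF Ak[of k]] by simp
    have BkA: "B ^\<^sub>m Suc k * A = 0\<^sub>m n n"
      using assoc_mult_mat[OF Bk[of k] B A] BA right_mult_zero_mat[OF Bk[of k]] by simp
    have "(A + B) ^\<^sub>m Suc (Suc k) = (A ^\<^sub>m Suc k + B ^\<^sub>m Suc k) * (A + B)"
      using Suc by (simp only: pow_mat.simps)
    also have "\<dots> = (A ^\<^sub>m Suc k + B ^\<^sub>m Suc k) * A + (A ^\<^sub>m Suc k + B ^\<^sub>m Suc k) * B"
      by (rule mult_add_distrib_mat[OF add_carrier_mat[OF Bk] A B])
    also have "(A ^\<^sub>m Suc k + B ^\<^sub>m Suc k) * A = A ^\<^sub>m Suc k * A + B ^\<^sub>m Suc k * A"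
      by (rule add_mult_distrib_mat[OF Ak Bk A])
    also have "(A ^\<^sub>m Suc k + B ^\<^sub>m Suc k) * B = A ^\<^sub>m Suc k * B + B ^\<^sub>m Suc k * B"
      by (rule add_mult_distrib_mat[OF Ak Bk B])
    finally have "(A + B) ^\<^sub>m Suc (Suc k) = (A ^\<^sub>m Suc (Suc k) + 0\<^sub>m n n) + (0\<^sub>m n n + B ^\<^sub>m Suc (Suc k))"
      unfolding AkB BkA by (simp only: pow_mat.simps)
    also have "\<dots> = A ^\<^sub>m Suc (Suc k) + B ^\<^sub>m Suc (Suc k)"
      using left_add_zero_mat[OF Bk] right_add_zero_mat[OF Ak] by (simp only:)
    finally show ?case .
  qed
  have tr: "mat_trace ((A + B) ^\<^sub>m k) = mat_trace (A ^\<^sub>m k) + mat_trace (B ^\<^sub>m k)" if k1: "k \<ge> 1" for k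
  proof -
    obtain j where "k = Suc j" using k1 by (cases k) auto
    then show ?thesis by (simp only: pow mat_trace_add[OF Ak Bk])
  qed
  have "(\<Sum>k = 1..K. 1 / of_nat k * mat_trace ((A + B) ^\<^sub>m k))
      = (\<Sum>k = 1..K. 1 / of_nat k * mat_trace (A ^\<^sub>m k)) + (\<Sum>k = 1..K. 1 / of_nat k * mat_trace (B ^\<^sub>m k))"
    unfolding sum.distrib[symmetric] by (intro sum.cong refl) (simp only: tr atLeastAtMost_iff distrib_left)
  moreover have "dim_row (A + B) = n" "dim_row A = n" "dim_row B = n" using A B by auto
  ultimately show ?thesis by (simp only: mat_detp_def det exp_add mult_ac)
qed

lemma detp_add_orthogonal:
  assumes A: "A \<in> finite_rank_ops" and B: "B \<in> finite_rank_ops"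
    and AB: "\<And>x. blinfun_apply A (blinfun_apply B x) = 0" and BA: "\<And>x. blinfun_apply B (blinfun_apply A x) = 0"
  shows "detp_one_minus p (A + B) = detp_one_minus p A * detp_one_minus p B"
proof -
  obtain bs where bs: "basis_list ([] @ bs)" "range (blinfun_apply A) \<subseteq> lspan ([] @ bs)" "range (blinfun_apply B) \<subseteq> lspan ([] @ bs)"
    using A B by (rule common_basis[where as = "[]"]) (auto simp: basis_list_def complex_vs.independent_empty)
  then have bs: "basis_list bs" "range (blinfun_apply A) \<subseteq> lspan bs" "range (blinfun_apply B) \<subseteq> lspan bs" by simp_all
  note Ab = finite_rank_bounded_ops[OF A] and Bb = finite_rank_bounded_ops[OF B]
  note sA = maps_spanI[OF Ab bs(2)] and sB = maps_spanI[OF Bb bs(3)]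
  define n where "n = length bs"
  let ?M = "\<lambda>A. matrix_wrt bs (blinfun_apply A)"
  have zero: "matrix_wrt bs (\<lambda>x. 0) = 0\<^sub>m n n"
    by (rule eq_matI) (auto simp: matrix_wrt_index coord_zero[OF bs(1)] n_def)
  have "?M A * ?M B = 0\<^sub>m n n" "?M B * ?M A = 0\<^sub>m n n"
    using matrix_wrt_comp[OF bs(1) sA sB] matrix_wrt_comp[OF bs(1) sB sA] AB BA zero by simp_all
  then have "mat_detp (reg_order p) (?M A + ?M B) = mat_detp (reg_order p) (?M A) * mat_detp (reg_order p) (?M B)"
    by (intro mat_detp_add_orthogonal[where n = n]) (simp_all add: n_def)
  moreover have "?M (A + B) = ?M A + ?M B"
    using matrix_wrt_add[OF bs(1) sA sB] by (simp add: plus_blinfun.rep_eq)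
  moreover have "range (blinfun_apply (A + B)) \<subseteq> lspan bs"
    using range_line[OF bs(2,3), of 1] by (simp add: scaleC_one)
  ultimately show ?thesis using detp_basis[OF bs(1)] bs Ab Bb by simp
qed

lemma zorder_weierstrass_factor_le:
  assumes a: "a \<noteq> 0"
  shows "zorder (\<lambda>z. weierstrass_factor k (z * \<mu>)) a \<le> 1"
proof (cases "a * \<mu> = 1")
  case True
  then have \<mu>: "\<mu> \<noteq> 0" by auto
  have "zorder (\<lambda>z. weierstrass_factor k (z * \<mu>)) a = 1"
  proof (rule zorder_eqI[of UNIV a "\<lambda>z. - \<mu> * exp (\<Sum>j=1..k. (z * \<mu>) ^ j / of_nat j)"])
    show "(\<lambda>z. - \<mu> * exp (\<Sum>j = 1..k. (z * \<mu>) ^ j / of_nat j)) holomorphic_on UNIV"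
      by (intro holomorphic_intros) auto
    fix w :: complex
    have "1 - w * \<mu> = - \<mu> * (w - a)" using True by (simp add: algebra_simps)
    then show "weierstrass_factor k (w * \<mu>) = - \<mu> * exp (\<Sum>j = 1..k. (w * \<mu>) ^ j / of_nat j) * (w - a) powi 1"
      by (simp add: weierstrass_factor_def)
  qed (use \<mu> in auto)
  then show ?thesis by simp
next
  case False
  have "zorder (\<lambda>z. weierstrass_factor k (z * \<mu>)) a = 0"
  proof (rule zorder_eq_0I)
    have "(\<lambda>z. weierstrass_factor k (z * \<mu>)) holomorphic_on UNIV" by (intro holomorphic_intros)
    then show "(\<lambda>z. weierstrass_factor k (z * \<mu>)) analytic_on {a}"
      using analytic_on_subset[of _ UNIV "{a}"] by (simp add: analytic_on_open)
  qed (use False in simp)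
  then show ?thesis by simp
qed

context lp_ideal_det
begin

lemma Dext_zero: "Dext 0 = 1"
  using Dext_FR[OF zero_finite_rank] detp_zero by simp

lemma Dext_scale_holomorphic: "L \<in> J \<Longrightarrow> (\<lambda>z. Dext (z *\<^sub>C L)) holomorphic_on UNIV"
  using Dext_line_holomorphic[OF J_zero, of L] by simp

lemma Dext_scale_approximant:
  assumes "L \<in> J" shows "(\<lambda>n. detp_one_minus p (z *\<^sub>C approximant L n)) \<longlonglongrightarrow> Dext (z *\<^sub>C L)"
proof -
  have "(\<lambda>n. norm z * N (approximant L n - L)) \<longlonglongrightarrow> norm z * 0" by (intro tendsto_intros approximant_tendsto assms)
  moreover have "N (z *\<^sub>C approximant L n - z *\<^sub>C L) = norm z * N (approximant L n - L)" for n
    using N_scale[OF J_diff[OF FR_J[OF approximant(1)[OF assms]] assms]] by (simp add: complex_vs.scale_right_diff_distrib)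
  ultimately have "(\<lambda>n. Dext (z *\<^sub>C approximant L n)) \<longlonglongrightarrow> Dext (z *\<^sub>C L)"
    by (intro Dext_tendsto J_scale assms FR_J[OF approximant(1)]) auto
  then show ?thesis using Dext_FR[OF finite_rank_ops_scaleC[OF approximant(1)[OF assms]]] by simp
qed

text \<open>
  Each approximant satisfies this because Weierstrass factors do, but with a constant of its own. The Schwarz
  lemma makes the constant uniform, since the determinants are uniformly bounded on the unit disc.
\<close>

lemma Dext_one_plus_O:
  assumes L: "L \<in> J" shows "one_plus_O (Suc (reg_order p)) (\<lambda>z. Dext (z *\<^sub>C L))"
proof -
  define n where "n = Suc (reg_order p)"
  define M where "M = exp (growth_const * (q * (N L + 1)) powr p) + 1"
  have fr: "cmod (detp_one_minus p (z *\<^sub>C approximant L k) - 1) \<le> M * norm z ^ n" if z: "norm z < 1" for z k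
  proof -
    let ?F = "approximant L k"
    have F: "?F \<in> FR" "?F \<in> J" using approximant(1)[OF L] FR_J by auto
    obtain bs where bs: "basis_list bs" "lspan bs = range (blinfun_apply ?F)" by (rule finite_rank_opsE[OF F(1)])
    obtain \<mu> where \<mu>: "\<And>z. detp_one_minus p (z *\<^sub>C ?F) = (\<Prod>i<length bs. weierstrass_factor (reg_order p) (z * \<mu> i))"
      using detp_weierstrass_product[OF F(1) bs(1)] bs(2) by blast
    have "one_plus_O n (\<lambda>z. \<Prod>i<length bs. weierstrass_factor (reg_order p) (\<mu> i * z))"
      unfolding n_def by (intro one_plus_O_prod one_plus_O_weierstrass_factor) auto
    then obtain C where C: "eventually (\<lambda>z. norm ((\<Prod>i<length bs. weierstrass_factor (reg_order p) (\<mu> i * z)) - 1) \<le> C * norm z ^ n) (nhds 0)"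
      unfolding one_plus_O_def by blast
    have NF: "N ?F \<le> q * (N L + 1)"
    proof -
      have "N ?F \<le> q * (N L + N (?F - L))" by (rule N_le_diff[OF F(2) L])
      also have "\<dots> \<le> q * (N L + 1)" using approximant(2)[OF L, of k] q1
        by (intro mult_left_mono add_left_mono) (auto intro: order_trans)
      finally show ?thesis .
    qed
    have "norm ((\<lambda>z. detp_one_minus p (z *\<^sub>C ?F) - 1) z) \<le> M * (norm z / 1) ^ n"
    proof (rule schwarz_vanishing[where r = 1])
      have "(\<lambda>z. \<Prod>i<length bs. weierstrass_factor (reg_order p) (z * \<mu> i)) holomorphic_on ball 0 1" by (intro holomorphic_intros)
      then show "(\<lambda>z. detp_one_minus p (z *\<^sub>C ?F) - 1) holomorphic_on ball 0 1" unfolding \<mu> by (intro holomorphic_intros)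
      show "\<forall>\<^sub>F z in nhds 0. cmod (detp_one_minus p (z *\<^sub>C ?F) - 1) \<le> C * cmod z ^ n"
        using C by (simp add: \<mu> mult.commute)
      fix w :: complex assume "w \<in> ball 0 1"
      then have "N (w *\<^sub>C ?F) \<le> 1 * N ?F" unfolding N_scale[OF F(2)] using N_nonneg[OF F(2)] by (intro mult_right_mono) auto
      then have "growth_const * N (w *\<^sub>C ?F) powr p \<le> growth_const * (q * (N L + 1)) powr p"
        using NF growth_const_nonneg p N_nonneg[OF J_scale[OF F(2)]] by (intro mult_left_mono powr_mono2) auto
      moreover have "cmod (detp_one_minus p (w *\<^sub>C ?F)) \<le> exp (growth_const * N (w *\<^sub>C ?F) powr p)"
        by (intro detp_bound finite_rank_ops_scaleC F)
      ultimately have "cmod (detp_one_minus p (w *\<^sub>C ?F)) \<le> exp (growth_const * (q * (N L + 1)) powr p)"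
        by (meson exp_le_cancel_iff order_trans)
      then show "cmod (detp_one_minus p (w *\<^sub>C ?F) - 1) \<le> M"
        using norm_triangle_ineq4[of "detp_one_minus p (w *\<^sub>C ?F)" 1] by (simp add: M_def)
    qed (use z in simp)
    then show ?thesis by simp
  qed
  have "cmod (Dext (z *\<^sub>C L) - 1) \<le> M * norm z ^ n" if z: "norm z < 1" for z
  proof (rule tendsto_upperbound)
    show "(\<lambda>k. cmod (detp_one_minus p (z *\<^sub>C approximant L k) - 1)) \<longlonglongrightarrow> cmod (Dext (z *\<^sub>C L) - 1)"
      by (intro tendsto_intros Dext_scale_approximant L)
  qed (use fr[OF z] in auto)
  moreover have "eventually (\<lambda>z::complex. z \<in> ball 0 1) (nhds 0)" by (intro eventually_nhds_in_open) auto
  ultimately have "eventually (\<lambda>z. cmod (Dext (z *\<^sub>C L) - 1) \<le> M * norm z ^ n) (nhds 0)"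
    by (auto elim: eventually_mono)
  moreover have "M \<ge> 0" unfolding M_def by (intro add_nonneg_nonneg) auto
  ultimately show ?thesis unfolding one_plus_O_def n_def by blast
qed

lemma not_constant_near_zero:
  assumes hol: "g holomorphic_on UNIV" and g0: "g 0 = (1::complex)"
  shows "eventually (\<lambda>z. g z \<noteq> 0) (at a)"
proof -
  have "eventually (\<lambda>w. g w \<noteq> 0 \<and> w \<in> UNIV) (at a)"
    by (rule non_zero_neighbour_alt[OF hol, of a 0]) (use g0 in auto)
  then show ?thesis by simp
qed

lemma norm_approximant_tendsto: "L \<in> J \<Longrightarrow> (\<lambda>n. norm (approximant L n - L)) \<longlonglongrightarrow> 0"
proof -
  assume L: "L \<in> J"
  have "\<forall>\<^sub>F n in sequentially. norm (approximant L n - L) \<le> N (approximant L n - L)"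
    using norm_le_N[OF J_diff[OF FR_J[OF approximant(1)[OF L]] L]] by simp
  then show ?thesis by (rule tendsto_sandwich[OF always_eventually[OF allI[OF norm_ge_zero]] _ tendsto_const approximant_tendsto[OF L]])
qed

text \<open>
  A left inverse \<open>V\<close> of \<open>1 - A\<close> gives \<open>\<parallel>x\<parallel> \<le> \<parallel>V\<parallel> \<parallel>x - A x\<parallel>\<close>. The estimate persists for the approximants
  \<open>z F\<^sub>n\<close> with \<open>z\<close> near \<open>1\<close>, hence these do not have the eigenvalue \<open>1\<close> and their determinants do not
  vanish near \<open>z = 1\<close>. By Hurwitz' theorem the limit \<open>Dext(z A)\<close> does not vanish at \<open>1\<close> either.
\<close>

lemma Dext_nonzero:
  assumes A: "A \<in> J" and V: "\<And>x. blinfun_apply V (x - blinfun_apply A x) = x"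
  shows "Dext A \<noteq> 0"
proof
  assume D0: "Dext A = 0"
  define b where "b = norm V + 1"
  have b: "b > 0" by (simp add: b_def add_nonneg_pos)
  (* For |z - 1| < r and F close to A, an eigenvector x of z F for the eigenvalue 1 would satisfy
     norm (x - A x) \<le> norm x / b, contradicting the left inverse since b exceeds norm V. *)
  define r where "r = 1 / (2 * b * (norm A + 1))"
  have r: "r > 0" using b by (auto simp: r_def intro!: divide_pos_pos mult_pos_pos add_nonneg_pos)
  have "\<forall>\<^sub>F n in sequentially. norm (approximant A n - A) < min 1 (1 / (2 * b))"
    by (rule order_tendstoD(2)[OF norm_approximant_tendsto[OF A]]) (use b in simp)
  then obtain n0 where n0: "\<And>n. n \<ge> n0 \<Longrightarrow> norm (approximant A n - A) < min 1 (1 / (2 * b))"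
    unfolding eventually_sequentially by blast
  define f where "f = (\<lambda>n z. detp_one_minus p (z *\<^sub>C approximant A (n + n0)))"
  have nz: "f n z \<noteq> 0" if z: "z \<in> ball 1 r" for n z
  proof
    let ?F = "approximant A (n + n0)"
    assume "f n z = 0"
    then obtain x where x: "x \<noteq> 0" "z *\<^sub>C ?F x = x"
      using detp_zero_eigenvector[OF finite_rank_ops_scaleC[OF approximant(1)[OF A]], of p z "n + n0"] by (auto simp: f_def)
    have close: "norm (?F - A) < 1" "norm (?F - A) < 1 / (2 * b)" using n0[of "n + n0"] by auto
    have nF: "norm ?F \<le> norm A + 1" using close(1) norm_triangle_sub[of ?F A] by linarith
    have z1: "norm (z - 1) < r" using z by (simp add: dist_norm norm_minus_commute)
    have "x - A x = (z - 1) *\<^sub>C ?F x + (?F - A) x"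
      using x(2) by (simp add: complex_vs.scale_left_diff_distrib scaleC_one blinfun.diff_left)
    then have "norm (x - A x) \<le> norm (z - 1) * norm (?F x) + norm ((?F - A) x)"
      using norm_triangle_ineq[of "(z - 1) *\<^sub>C ?F x" "(?F - A) x"] by (simp add: norm_scaleC)
    also have "\<dots> \<le> r * ((norm A + 1) * norm x) + 1 / (2 * b) * norm x"
    proof (intro add_mono)
      have "norm (?F x) \<le> (norm A + 1) * norm x"
        by (rule order_trans[OF norm_blinfun]) (use nF in \<open>auto intro: mult_right_mono\<close>)
      then show "norm (z - 1) * norm (?F x) \<le> r * ((norm A + 1) * norm x)"
        using z1 r by (intro mult_mono) auto
      show "norm ((?F - A) x) \<le> 1 / (2 * b) * norm x"
        by (rule order_trans[OF norm_blinfun mult_right_mono[OF less_imp_le[OF close(2)] norm_ge_zero]])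
    qed
    also have "r * ((norm A + 1) * norm x) = 1 / (2 * b) * norm x"
    proof -
      have "norm A + 1 > 0" by (simp add: add_nonneg_pos)
      then show ?thesis using b by (simp add: r_def)
    qed
    finally have "norm (x - A x) \<le> norm x / b" using b by (simp add: field_simps)
    then have "b * norm (x - A x) \<le> norm x" using b by (simp add: pos_le_divide_eq mult.commute)
    moreover have "norm x \<le> norm V * norm (x - A x)" using norm_blinfun[of V "x - A x"] V by simp
    ultimately have "b * norm (x - A x) \<le> norm V * norm (x - A x)" by linarith
    then have "norm (x - A x) \<le> 0" by (simp add: b_def distrib_right)
    then have "x - A x = 0" by simp
    then show False using V[of x] x(1) by (simp add: blinfun.zero_right)
  qed
  have hol: "(\<lambda>z. Dext (z *\<^sub>C A)) holomorphic_on UNIV" by (rule Dext_scale_holomorphic[OF A])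
  have "\<forall>\<^sub>F z in at 1. Dext (z *\<^sub>C A) \<noteq> 0"
    by (rule not_constant_near_zero[OF hol]) (simp add: Dext_zero)
  moreover have "\<forall>\<^sub>F z in at (1::complex). z \<in> ball 1 r" using r by (intro eventually_at_in_open') auto
  ultimately have "\<forall>\<^sub>F z in at (1::complex). Dext (z *\<^sub>C A) \<noteq> 0 \<and> z \<in> ball 1 r" by eventually_elim auto
  from eventually_happens'[OF _ this] obtain z where z: "Dext (z *\<^sub>C A) \<noteq> 0" "z \<in> ball 1 r" by auto
  have "Dext (1 *\<^sub>C A) \<noteq> 0"
  proof (rule Hurwitz_no_zeros[of "ball 1 r" f "\<lambda>z. Dext (z *\<^sub>C A)"])
    show "f n holomorphic_on ball 1 r" for n
      using detp_line_holomorphic[OF zero_finite_rank approximant(1)[OF A], of p "n + n0"]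
      unfolding f_def by (auto intro: holomorphic_on_subset)
    show "(\<lambda>z. Dext (z *\<^sub>C A)) holomorphic_on ball 1 r" using hol by (rule holomorphic_on_subset) auto
    show "\<not> (\<lambda>z. Dext (z *\<^sub>C A)) constant_on ball 1 r"
    proof
      assume "(\<lambda>z. Dext (z *\<^sub>C A)) constant_on ball 1 r"
      then obtain c where c: "\<And>w. w \<in> ball 1 r \<Longrightarrow> Dext (w *\<^sub>C A) = c" unfolding constant_on_def by blast
      have "c = 0" using c[of 1] D0 r by (simp add: scaleC_one)
      then show False using c[OF z(2)] z(1) by simp
    qed
    fix Kc :: "complex set" assume Kc: "compact Kc"
    then obtain \<rho> where \<rho>: "Kc \<subseteq> cball 0 \<rho>" using compact_imp_bounded[OF Kc] by (auto simp: bounded_iff subset_eq dist_norm)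
    have "uniform_limit (cball 0 \<rho>) (\<lambda>n z. detp_one_minus p (0 + z *\<^sub>C approximant A (n + n0))) (\<lambda>z. Dext (0 + z *\<^sub>C A)) sequentially"
    proof (rule line_uniform_limit[OF J_zero A])
      show "(\<lambda>n. N (approximant A (n + n0) - A)) \<longlonglongrightarrow> 0" using approximant_tendsto[OF A] by (rule LIMSEQ_ignore_initial_segment)
    qed (use approximant(1)[OF A] in \<open>auto simp: zero_finite_rank N_zero\<close>)
    then show "uniform_limit Kc f (\<lambda>z. Dext (z *\<^sub>C A)) sequentially"
      using uniform_limit_on_subset[OF _ \<rho>] by (simp add: f_def)
  qed (use r nz in auto)
  then show False using D0 by (simp add: scaleC_one)
qed

text \<open>
  For finite rank \<open>F\<close> the operators \<open>P F P\<close> and \<open>Q F Q\<close>, with \<open>Q = 1 - P\<close>, annihilate each other, so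
  \<open>detp_add_orthogonal\<close> applies. As \<open>P\<close> commutes with \<open>L\<close>, these operators approximate \<open>L P\<close> and \<open>L Q\<close> if
  \<open>F\<close> approximates \<open>L\<close>.
\<close>

lemma Dext_split:
  assumes L: "L \<in> J" and P: "P \<in> bounded_ops" "\<And>x. P (P x) = P x" "\<And>x. L (P x) = P (L x)"
  shows "L o\<^sub>L P \<in> J" "L o\<^sub>L (id_blinfun - P) \<in> J" "Dext (z *\<^sub>C L) = Dext (z *\<^sub>C (L o\<^sub>L P)) * Dext (z *\<^sub>C (L o\<^sub>L (id_blinfun - P)))"
proof -
  let ?Q = "id_blinfun - P"
  have Q: "?Q \<in> bounded_ops" using P(1) by auto
  have LP: "L o\<^sub>L P = P o\<^sub>L L o\<^sub>L P" using P by (intro blinfun_eqI) simp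
  have LQ: "L o\<^sub>L ?Q = ?Q o\<^sub>L L o\<^sub>L ?Q" using P by (intro blinfun_eqI) (simp add: blinfun.diff_left blinfun.diff_right)
  show LPJ: "L o\<^sub>L P \<in> J" unfolding LP by (intro J_compose L P)
  show LQJ: "L o\<^sub>L ?Q \<in> J" unfolding LQ by (intro J_compose L Q)
  have sum: "(L o\<^sub>L P) + (L o\<^sub>L ?Q) = L" by (intro blinfun_eqI) (simp add: blinfun.add_left blinfun.diff_left blinfun.diff_right)
  define F where "F n = approximant L n" for n
  define A where "A n = P o\<^sub>L F n o\<^sub>L P" for n
  define B where "B n = ?Q o\<^sub>L F n o\<^sub>L ?Q" for n
  have FR: "F n \<in> FR" for n using approximant(1)[OF L] by (simp add: F_def)
  have AFR: "A n \<in> FR" and BFR: "B n \<in> FR" for n using FR P(1) Q by (auto simp: A_def B_def)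
  have FL: "F n - L \<in> J" for n using FR_J[OF FR] L by (rule J_diff)
  have lim: "(\<lambda>n. N ((S o\<^sub>L F n o\<^sub>L S) - (S o\<^sub>L L o\<^sub>L S))) \<longlonglongrightarrow> 0" if S: "S \<in> bounded_ops" for S
  proof (rule tendsto_sandwich)
    have eq: "(S o\<^sub>L F n o\<^sub>L S) - (S o\<^sub>L L o\<^sub>L S) = S o\<^sub>L (F n - L) o\<^sub>L S" for n
      by (intro blinfun_eqI) (simp add: blinfun.diff_left blinfun.diff_right)
    show "\<forall>\<^sub>F n in sequentially. 0 \<le> N ((S o\<^sub>L F n o\<^sub>L S) - (S o\<^sub>L L o\<^sub>L S))"
      unfolding eq using N_nonneg J_compose[OF FL S S] by simp
    show "\<forall>\<^sub>F n in sequentially. N ((S o\<^sub>L F n o\<^sub>L S) - (S o\<^sub>L L o\<^sub>L S)) \<le> norm S * N (F n - L) * norm S"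
      unfolding eq using N_compose[OF FL S S] by simp
    have "(\<lambda>n. norm S * N (F n - L) * norm S) \<longlonglongrightarrow> norm S * 0 * norm S"
      unfolding F_def by (intro tendsto_intros approximant_tendsto L)
    then show "(\<lambda>n. norm S * N (F n - L) * norm S) \<longlonglongrightarrow> 0" by simp
  qed simp
  have limA: "(\<lambda>n. N (A n - (L o\<^sub>L P))) \<longlonglongrightarrow> 0" using lim[OF P(1)] by (simp only: A_def flip: LP)
  have limB: "(\<lambda>n. N (B n - (L o\<^sub>L ?Q))) \<longlonglongrightarrow> 0" using lim[OF Q] by (simp only: B_def flip: LQ)
  have limz: "(\<lambda>n. Dext (z *\<^sub>C G n)) \<longlonglongrightarrow> Dext (z *\<^sub>C K)"
    if K: "K \<in> J" and G: "\<And>n. G n \<in> J" "(\<lambda>n. N (G n - K)) \<longlonglongrightarrow> 0" for G K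
  proof (rule Dext_tendsto)
    have "(\<lambda>n. norm z * N (G n - K)) \<longlonglongrightarrow> norm z * 0" by (intro tendsto_intros G)
    moreover have "N (z *\<^sub>C G n - z *\<^sub>C K) = norm z * N (G n - K)" for n
      using N_scale[OF J_diff[OF G(1) K], of z n] by (simp add: complex_vs.scale_right_diff_distrib)
    ultimately show "(\<lambda>n. N (z *\<^sub>C G n - z *\<^sub>C K)) \<longlonglongrightarrow> 0" by simp
  qed (use K G J_scale in auto)
  have "(\<lambda>n. N (A n + B n - L)) \<longlonglongrightarrow> 0"
  proof (rule tendsto_sandwich)
    have J: "A n - (L o\<^sub>L P) \<in> J" "B n - (L o\<^sub>L ?Q) \<in> J" for n using FR_J[OF AFR] FR_J[OF BFR] LPJ LQJ J_diff by auto
    have eq: "A n + B n - L = (A n - (L o\<^sub>L P)) + (B n - (L o\<^sub>L ?Q))" for n using sum by (simp add: algebra_simps)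
    show "\<forall>\<^sub>F n in sequentially. 0 \<le> N (A n + B n - L)"
      unfolding eq using N_nonneg[OF J_add[OF J]] by simp
    show "\<forall>\<^sub>F n in sequentially. N (A n + B n - L) \<le> q * (N (A n - (L o\<^sub>L P)) + N (B n - (L o\<^sub>L ?Q)))"
      unfolding eq using N_add[OF J] by simp
    have "(\<lambda>n. q * (N (A n - (L o\<^sub>L P)) + N (B n - (L o\<^sub>L ?Q)))) \<longlonglongrightarrow> q * (0 + 0)" by (intro tendsto_intros limA limB)
    then show "(\<lambda>n. q * (N (A n - (L o\<^sub>L P)) + N (B n - (L o\<^sub>L ?Q)))) \<longlonglongrightarrow> 0" by simp
  qed simp
  then have 1: "(\<lambda>n. Dext (z *\<^sub>C (A n + B n))) \<longlonglongrightarrow> Dext (z *\<^sub>C L)"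
    by (rule limz[OF L J_add[OF FR_J[OF AFR] FR_J[OF BFR]]])
  have 2: "(\<lambda>n. Dext (z *\<^sub>C A n) * Dext (z *\<^sub>C B n)) \<longlonglongrightarrow> Dext (z *\<^sub>C (L o\<^sub>L P)) * Dext (z *\<^sub>C (L o\<^sub>L ?Q))"
    by (intro tendsto_mult limz LPJ LQJ limA limB) (use FR_J AFR BFR in auto)
  have "Dext (z *\<^sub>C (A n + B n)) = Dext (z *\<^sub>C A n) * Dext (z *\<^sub>C B n)" for n
  proof -
    have PQ: "P (x - P x) = 0" "P x - P (P x) = 0" for x using P(2) by (simp_all add: blinfun.diff_right)
    have "detp_one_minus p (z *\<^sub>C A n + z *\<^sub>C B n) = detp_one_minus p (z *\<^sub>C A n) * detp_one_minus p (z *\<^sub>C B n)"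
    proof (rule detp_add_orthogonal)
      fix x
      have "A n (?Q y) = 0" "B n (P y) = 0" for y
        by (simp_all add: A_def B_def blinfun.diff_left PQ P(2) blinfun.zero_right)
      moreover have "z *\<^sub>C B n x = ?Q (z *\<^sub>C F n (?Q x))" "z *\<^sub>C A n x = P (z *\<^sub>C F n (P x))"
        using bounded_opsD[OF Q] bounded_opsD[OF P(1)] by (simp_all add: A_def B_def)
      ultimately have "A n (z *\<^sub>C B n x) = 0" "B n (z *\<^sub>C A n x) = 0" by (simp_all only:)
      then show "(z *\<^sub>C A n) ((z *\<^sub>C B n) x) = 0" "(z *\<^sub>C B n) ((z *\<^sub>C A n) x) = 0" by simp_all
    qed (use AFR BFR in auto)
    then show ?thesis
      using Dext_FR[OF finite_rank_ops_scaleC[OF AFR]] Dext_FR[OF finite_rank_ops_scaleC[OF BFR]]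
        Dext_FR[OF finite_rank_ops_scaleC[OF finite_rank_ops_add[OF AFR BFR]]]
      by (simp add: scaleC_add_right)
  qed
  then show "Dext (z *\<^sub>C L) = Dext (z *\<^sub>C (L o\<^sub>L P)) * Dext (z *\<^sub>C (L o\<^sub>L ?Q))"
    using 1 2 LIMSEQ_unique by simp
qed

text \<open>
  Let \<open>\<mu> = 1 / a\<close>. By density \<open>L\<close> is a finite rank perturbation of an operator of norm less than \<open>|\<mu>|\<close>, so
  \<open>analytic_fredholm\<close> applies: either \<open>\<mu>\<close> is in the resolvent set, which is excluded by \<open>Dext_nonzero\<close>, or it is an
  isolated eigenvalue with Riesz projection \<open>P\<close> of finite rank. By \<open>Dext_split\<close>, \<open>Dext(z L)\<close> is the product
  of \<open>Dext(z L P)\<close>, which consists of as many Weierstrass factors as the rank of \<open>P\<close>, each having at most a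
  simple zero, and \<open>Dext(z L (1 - P))\<close>, which does not vanish at \<open>a\<close> by \<open>complement_left_inverse\<close>.
\<close>

lemma zero_of_Dext_eigenvalue:
  assumes L: "L \<in> J" and a: "Dext (a *\<^sub>C L) = 0"
  shows "inverse a \<in> discrete_eigenvalues L" "nat (zorder (\<lambda>z. Dext (z *\<^sub>C L)) a) \<le> alg_multiplicity L (inverse a)"
proof -
  have a0: "a \<noteq> 0" using a Dext_zero by auto
  define \<mu> where "\<mu> = inverse a"
  have \<mu>0: "\<mu> \<noteq> 0" and a\<mu>: "a = inverse \<mu>" using a0 by (auto simp: \<mu>_def)
  note Lb = J_bounded_ops[OF L]
  obtain F where F: "F \<in> FR" "N (F - L) \<le> norm \<mu> / 2" by (rule approximation[OF L half_gt_zero[OF zero_less_norm_iff[THEN iffD2, OF \<mu>0]]])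
  have "norm (L - F) \<le> norm \<mu> / 2"
    using norm_le_N[OF J_diff[OF FR_J[OF F(1)] L]] F(2) by (simp add: norm_minus_commute)
  also have "\<dots> < norm \<mu>" using \<mu>0 by simp
  finally interpret fp: finite_rank_perturbation L F \<mu> using Lb F(1) by unfold_locales
  obtain Np C \<delta> where fred: "\<delta> > 0" "\<And>z. z \<noteq> \<mu> \<Longrightarrow> norm (z - \<mu>) < \<delta> \<Longrightarrow> z \<notin> op_spectrum L"
    "eventually (\<lambda>z. norm ((z - \<mu>) ^ Np *\<^sub>C op_resolvent L z) \<le> C) (at \<mu>)"
    "\<mu> \<in> op_spectrum L \<Longrightarrow> \<exists>x. x \<noteq> 0 \<and> L x = \<mu> *\<^sub>C x"
  proof (rule fp.analytic_fredholm, goal_cases)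
    case (1 N' C \<delta>)
    show thesis
    proof (rule that)
      show "z \<notin> op_spectrum L" if "z \<noteq> \<mu>" "norm (z - \<mu>) < \<delta>" for z using that by (rule 1(3))
      show "\<exists>x. x \<noteq> 0 \<and> L x = \<mu> *\<^sub>C x" if "\<mu> \<in> op_spectrum L" using that by (rule 1(5))
    qed (rule 1)+
  qed
  have spec: "\<mu> \<in> op_spectrum L"
  proof (rule ccontr)
    assume "\<mu> \<notin> op_spectrum L"
    then have R: "is_resolvent_at L \<mu> (op_resolvent L \<mu>)" by (rule op_resolvent_works)
    have "(\<mu> *\<^sub>C op_resolvent L \<mu>) (x - (a *\<^sub>C L) x) = x" for x
    proof -
      have "(\<mu> *\<^sub>C op_resolvent L \<mu>) (x - (a *\<^sub>C L) x) = op_resolvent L \<mu> (\<mu> *\<^sub>C (x - a *\<^sub>C L x))"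
        by (simp add: bounded_opsD[OF resolvent_bounded_ops[OF R]])
      also have "\<mu> *\<^sub>C (x - a *\<^sub>C L x) = \<mu> *\<^sub>C x - L x"
        using \<mu>0 by (simp add: a\<mu> complex_vs.scale_right_diff_distrib scaleC_scaleC scaleC_one)
      finally show ?thesis using resolvent_left[OF R] by simp
    qed
    from Dext_nonzero[OF J_scale[OF L] this] show False using a by simp
  qed
  (* The radius that riesz_projection chooses. *)
  define r where "r = (SOME r. 0 < r \<and> op_spectrum L \<inter> cball \<mu> r \<subseteq> {\<mu>})"
  have "0 < \<delta> / 2 \<and> op_spectrum L \<inter> cball \<mu> (\<delta> / 2) \<subseteq> {\<mu>}"
  proof (intro conjI subsetI)
    fix z assume z: "z \<in> op_spectrum L \<inter> cball \<mu> (\<delta> / 2)"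
    then have "norm (z - \<mu>) \<le> \<delta> / 2" by (simp add: dist_norm norm_minus_commute)
    then have "norm (z - \<mu>) < \<delta>" using fred(1) by linarith
    then show "z \<in> {\<mu>}" using fred(2)[of z] z by auto
  qed (use fred(1) in simp)
  then have "0 < r \<and> op_spectrum L \<inter> cball \<mu> r \<subseteq> {\<mu>}" unfolding r_def by (rule someI)
  then have r: "0 < r" "op_spectrum L \<inter> cball \<mu> r \<subseteq> {\<mu>}" by simp_all
  interpret isp: isolated_spectral_point L \<mu> r using Lb r by unfold_locales
  have Pr: "riesz_projection L \<mu> = isp.Proj" by (simp only: riesz_projection_def isp.Proj_def flip: r_def)
  have nil: "(blinfun_apply isp.T ^^ Np) (isp.Proj x) = 0" for x by (rule isp.T_power_Proj_zero[OF fred(3)])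
  have idem: "isp.Proj (isp.Proj x) = isp.Proj x" for x by (rule isp.Proj_idem[OF nil])
  obtain Y where Y: "finite Y" "{x. (blinfun_apply (L - \<mu> *\<^sub>C id_blinfun) ^^ Np) x = 0} \<subseteq> complex_vs.span Y"
    using fp.kernel_power_finite_dim by blast
  have PFR: "isp.Proj \<in> FR"
    by (rule finite_rank_opsI[OF isp.Proj_bounded_ops _ Y(1)]) (use nil Y(2) in \<open>auto simp: isp.T_def\<close>)
  have "\<mu> isolated_in op_spectrum L"
    unfolding isolated_in_def
  proof (intro conjI exI)
    show "ball \<mu> \<delta> \<inter> op_spectrum L = {\<mu>}"
    proof (intro equalityI subsetI)
      fix z assume z: "z \<in> ball \<mu> \<delta> \<inter> op_spectrum L"
      then have "norm (z - \<mu>) < \<delta>" by (simp add: dist_norm norm_minus_commute)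
      then show "z \<in> {\<mu>}" using fred(2)[of z] z by auto
    qed (use fred(1) spec in auto)
  qed (use spec in auto)
  then have "\<mu> \<in> discrete_eigenvalues L"
    using fred(4)[OF spec] PFR by (simp add: discrete_eigenvalues_def Pr)
  then show "inverse a \<in> discrete_eigenvalues L" by (simp add: \<mu>_def)
  define LP where "LP = L o\<^sub>L isp.Proj"
  define LQ where "LQ = L o\<^sub>L (id_blinfun - isp.Proj)"
  note split = Dext_split[OF L isp.Proj_bounded_ops idem isp.L_Proj, folded LP_def LQ_def]
  obtain V where V: "\<And>x. blinfun_apply V (x - inverse \<mu> *\<^sub>C L (x - isp.Proj x)) = x"
    using isp.complement_left_inverse[OF idem \<mu>0] by blast
  have nz: "Dext (a *\<^sub>C LQ) \<noteq> 0"
  proof (rule Dext_nonzero[OF J_scale[OF split(2)]])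
    show "V (x - (a *\<^sub>C LQ) x) = x" for x using V[of x] by (simp add: LQ_def a\<mu> blinfun.diff_left)
  qed
  obtain bs where bs: "basis_list bs" "lspan bs = range (blinfun_apply isp.Proj)" by (rule finite_rank_opsE[OF PFR])
  have LPFR: "LP \<in> FR" unfolding LP_def using PFR Lb by auto
  have LPr: "range (blinfun_apply LP) \<subseteq> lspan bs" unfolding bs(2) by (auto simp: LP_def isp.L_Proj)
  obtain m where m: "\<And>z. detp_one_minus p (z *\<^sub>C LP) = (\<Prod>i<length bs. weierstrass_factor (reg_order p) (z * m i))"
    using detp_weierstrass_product[OF LPFR bs(1) LPr] by blast
  have g: "Dext (z *\<^sub>C L) = (\<Prod>i<length bs. weierstrass_factor (reg_order p) (z * m i)) * Dext (z *\<^sub>C LQ)" for z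
    unfolding split(3)[of z] Dext_FR[OF finite_rank_ops_scaleC[OF LPFR]] m ..
  have an: "f analytic_on {a}" if "f holomorphic_on UNIV" for f
    using analytic_on_subset[of f UNIV "{a}"] that by (simp add: analytic_on_open)
  have ev: "\<forall>\<^sub>F z in at a. (\<Prod>i<length bs. weierstrass_factor (reg_order p) (z * m i)) * Dext (z *\<^sub>C LQ) \<noteq> 0"
    using not_constant_near_zero[OF Dext_scale_holomorphic[OF L], of a] Dext_zero by (simp add: g)
  have "zorder (\<lambda>z. Dext (z *\<^sub>C L)) a = zorder (\<lambda>z. \<Prod>i<length bs. weierstrass_factor (reg_order p) (z * m i)) a + zorder (\<lambda>z. Dext (z *\<^sub>C LQ)) a"
    unfolding g by (intro zorder_times_analytic an Dext_scale_holomorphic split(2) ev holomorphic_intros)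
  also have "zorder (\<lambda>z. Dext (z *\<^sub>C LQ)) a = 0"
    by (intro zorder_eq_0I an Dext_scale_holomorphic split(2) nz)
  also have "zorder (\<lambda>z. \<Prod>i<length bs. weierstrass_factor (reg_order p) (z * m i)) a
      = (\<Sum>i<length bs. zorder (\<lambda>z. weierstrass_factor (reg_order p) (z * m i)) a)"
    by (rule zorder_prod_analytic) (use ev in \<open>auto intro!: an holomorphic_intros elim: eventually_mono\<close>)
  also have "\<dots> \<le> (\<Sum>i<length bs. 1)" by (intro sum_mono zorder_weierstrass_factor_le a0)
  finally have "zorder (\<lambda>z. Dext (z *\<^sub>C L)) a \<le> int (length bs)" by simp
  moreover have "alg_multiplicity L \<mu> = length bs"
  proof -
    have "alg_multiplicity L \<mu> = complex_vs.dim (lspan bs)" by (simp add: alg_multiplicity_def Pr bs(2))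
    also have "\<dots> = card (set bs)" using bs(1) by (intro complex_vs.dim_span_eq_card_independent) (simp add: basis_list_def)
    also have "\<dots> = length bs" using bs(1) by (simp add: basis_list_def distinct_card)
    finally show ?thesis .
  qed
  ultimately show "nat (zorder (\<lambda>z. Dext (z *\<^sub>C L)) a) \<le> alg_multiplicity L (inverse a)" by (simp add: \<mu>_def)
qed

end

section \<open>Rank one operators and the sharp bounds\<close>

lemma detp_rank_one:
  assumes \<phi>: "cfunctional \<phi>" and \<phi>b: "\<phi> b = 1"
  shows "detp_one_minus p (u *\<^sub>C rank_one \<phi> b) = weierstrass_factor (reg_order p) u"
proof -
  let ?A = "u *\<^sub>C rank_one \<phi> b"
  have b0: "b \<noteq> 0" using \<phi> \<phi>b unfolding cfunctional_def by (metis add_cancel_left_left zero_neq_one)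
  have A: "?A x = (u * \<phi> x) *\<^sub>C b" for x by (simp add: rank_one_apply[OF \<phi>] scaleC_scaleC)
  have bs: "basis_list [b]" by (simp add: basis_list_def complex_vs.dependent_single b0)
  have Ab: "?A \<in> bounded_ops" using rank_one_bounded_ops[OF \<phi>] by auto
  have sub: "range (blinfun_apply ?A) \<subseteq> lspan [b]"
  proof clarify
    show "?A x \<in> lspan [b]" for x unfolding A by (intro complex_vs.span_scale complex_vs.span_base) simp
  qed
  define M where "M = (\<lambda>c::complex. mat 1 1 (\<lambda>_. c))"
  have Mc: "M c \<in> carrier_mat 1 1" for c by (simp add: M_def)
  have "matrix_wrt [b] (blinfun_apply ?A) = M u"
  proof (rule eq_matI)
    fix i j assume "i < dim_row (M u)" "j < dim_col (M u)"
    then have ij: "i = 0" "j = 0" by (simp_all add: M_def)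
    have bl: "b \<in> lspan [b]" by (simp add: complex_vs.span_base)
    have "coord [b] 0 (?A b) = u"
      using coord_scale[OF bs bl, of 0 "u * \<phi> b"] coord_nth[OF bs, of 0 0] by (simp only: A \<phi>b) simp
    then show "matrix_wrt [b] (blinfun_apply ?A) $$ (i, j) = M u $$ (i, j)"
      by (simp add: ij matrix_wrt_index M_def)
  qed (simp_all add: M_def)
  moreover have pow: "M u ^\<^sub>m k = M (u ^ k)" for k
  proof (induction k)
    case 0
    show ?case by (rule eq_matI) (auto simp: M_def)
  next
    case (Suc k)
    then show ?case by (intro eq_matI) (auto simp: M_def scalar_prod_def)
  qed
  have "mat_detp K (M u) = weierstrass_factor K u" for K
  proof -
    have "Determinant.det (1\<^sub>m (dim_row (M u)) - M u) = 1 - u"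
      by (subst det_single) (auto simp: M_def)
    moreover have "mat_trace (M u ^\<^sub>m k) = u ^ k" for k by (simp add: pow) (simp add: M_def mat_trace_def)
    ultimately show ?thesis by (simp add: mat_detp_def weierstrass_factor_def)
  qed
  ultimately show ?thesis using detp_basis[OF bs Ab sub] by simp
qed

text \<open>
  Here \<open>Q = rank_one \<phi> b\<close> is a projection, and the resolvent of \<open>u Q\<close> is \<open>Q / (z - u) + (1 - Q) / z\<close>. So the spectrum is
  contained in \<open>{0, u}\<close>, the point \<open>0\<close> contributes nothing to the sum, and \<open>u\<close> is a simple pole with
  one-dimensional eigenspace.
\<close>

lemma eigenvalue_power_sum_rank_one:
  assumes \<phi>: "cfunctional \<phi>" and \<phi>b: "\<phi> b = 1" and u: "u \<noteq> 0"
  shows "eigenvalue_power_sum p (u *\<^sub>C rank_one \<phi> b) \<le> norm u powr p"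
proof -
  define Q where "Q = rank_one \<phi> b"
  define A where "A = u *\<^sub>C Q"
  have Qx: "Q x = \<phi> x *\<^sub>C b" for x unfolding Q_def by (rule rank_one_apply[OF \<phi>])
  have QQ: "Q (Q x) = Q x" for x using \<phi> \<phi>b by (simp add: Qx cfunctional_def)
  have Qb: "Q \<in> bounded_ops" unfolding Q_def by (rule rank_one_bounded_ops[OF \<phi>])
  have Ab: "A \<in> bounded_ops" using Qb by (simp add: A_def bounded_ops_scaleC)
  define R where "R = (\<lambda>z. (1 / (z - u)) *\<^sub>C Q + (1 / z) *\<^sub>C (id_blinfun - Q))"
  have res: "is_resolvent_at A z (R z)" if z: "z \<noteq> 0" "z \<noteq> u" for z
  proof (rule is_resolventI)
    show Rb: "R z \<in> bounded_ops" unfolding R_def using Qb by auto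
    have QA: "Q (z *\<^sub>C x - A x) = (z - u) *\<^sub>C Q x" for x
      by (simp add: A_def blinfun.diff_right bounded_opsD[OF Qb] QQ complex_vs.scale_left_diff_distrib)
    have Ax: "A x = u *\<^sub>C Q x" for x by (simp add: A_def)
    show "R z (z *\<^sub>C x - A x) = x" for x
    proof -
      have "R z (z *\<^sub>C x - A x) = (1 / (z - u)) *\<^sub>C (z - u) *\<^sub>C Q x + (1 / z) *\<^sub>C ((z *\<^sub>C x - u *\<^sub>C Q x) - (z - u) *\<^sub>C Q x)"
        unfolding R_def blinfun.add_left scaleC_blinfun.rep_eq blinfun.diff_left id_blinfun.rep_eq id_apply by (simp only: QA) (simp only: Ax)
      also have "(z *\<^sub>C x - u *\<^sub>C Q x) - (z - u) *\<^sub>C Q x = z *\<^sub>C (x - Q x)"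
        by (simp add: complex_vs.scale_left_diff_distrib complex_vs.scale_right_diff_distrib)
      finally show ?thesis using z by (simp add: scaleC_scaleC scaleC_one)
    qed
    then show "z *\<^sub>C R z x - A (R z x) = x" for x
    proof -
      have c: "A (R z x) = R z (A x)"
        by (simp add: Ax R_def blinfun.add_left blinfun.add_right blinfun.diff_left blinfun.diff_right
            bounded_opsD[OF Qb] QQ complex_vs.scale_zero_right scaleC_scaleC mult.commute)
      have "R z (z *\<^sub>C x - A x) = z *\<^sub>C R z x - A (R z x)"
        by (simp only: blinfun.diff_right bounded_opsD[OF Rb] c)
      then show ?thesis using \<open>\<And>x. R z (z *\<^sub>C x - A x) = x\<close> by simp
    qed
  qed
  have spec: "op_spectrum A \<subseteq> {0, u}" using res not_in_spectrumI by blast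
  have "alg_multiplicity A u \<le> 1"
  proof -
    define r where "r = (SOME r. 0 < r \<and> op_spectrum A \<inter> cball u r \<subseteq> {u})"
    have "0 < norm u / 2 \<and> op_spectrum A \<inter> cball u (norm u / 2) \<subseteq> {u}"
      using spec u by auto
    then have "0 < r \<and> op_spectrum A \<inter> cball u r \<subseteq> {u}" unfolding r_def by (rule someI)
    then have r: "0 < r" "op_spectrum A \<inter> cball u r \<subseteq> {u}" by simp_all
    interpret isp: isolated_spectral_point A u r using Ab r by unfold_locales
    have Pr: "riesz_projection A u = isp.Proj" by (simp only: riesz_projection_def isp.Proj_def flip: r_def)
    have "\<forall>\<^sub>F z in at u. z \<in> ball u (norm u / 2) - {u}" using u by (intro eventually_at_in_open) auto
    then have "\<forall>\<^sub>F z in at u. norm ((z - u) ^ 1 *\<^sub>C op_resolvent A z) \<le> norm Q + norm (id_blinfun - Q)"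
    proof eventually_elim
      case (elim z)
      then have zu: "z \<noteq> u" "norm (z - u) < norm u / 2" by (auto simp: dist_norm norm_minus_commute)
      have "norm u \<le> norm z + norm (z - u)" using norm_triangle_ineq4[of z "z - u"] by simp
      then have le: "norm (z - u) \<le> norm z" using zu(2) by linarith
      have z0: "z \<noteq> 0" using zu by auto
      have "(z - u) ^ 1 *\<^sub>C op_resolvent A z = Q + ((z - u) / z) *\<^sub>C (id_blinfun - Q)"
        using zu by (simp add: op_resolventI[OF res[OF z0 zu(1)]] R_def scaleC_add_right scaleC_scaleC scaleC_one)
      also have "norm \<dots> \<le> norm Q + norm ((z - u) / z) * norm (id_blinfun - Q)"
        using norm_triangle_ineq[of Q "((z - u) / z) *\<^sub>C (id_blinfun - Q)"] by (simp only: norm_scaleC)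
      also have "norm ((z - u) / z) * norm (id_blinfun - Q) \<le> 1 * norm (id_blinfun - Q)"
        using le z0 by (intro mult_right_mono) (auto simp: norm_divide)
      finally show ?case by simp
    qed
    from isp.T_power_Proj_zero[OF this] have "isp.T (isp.Proj x) = 0" for x by simp
    then have "A (isp.Proj x) = u *\<^sub>C isp.Proj x" for x using isp.T_apply[of "isp.Proj x"] by simp
    moreover have "A y = u *\<^sub>C Q y" for y by (simp add: A_def)
    ultimately have "u *\<^sub>C Q (isp.Proj x) = u *\<^sub>C isp.Proj x" for x by metis
    then have "isp.Proj x = \<phi> (isp.Proj x) *\<^sub>C b" for x using u Qx by (metis complex_vs.scale_left_imp_eq)
    then have "isp.Proj x \<in> complex_vs.span {b}" for x
      by (metis complex_vs.span_base complex_vs.span_scale singletonI)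
    then have "complex_vs.dim (range (blinfun_apply isp.Proj)) \<le> card {b}"
      by (intro complex_vs.dim_le_card) auto
    then show ?thesis by (simp add: alg_multiplicity_def Pr)
  qed
  then have mult: "real (alg_multiplicity A u) * norm u powr p \<le> 1 * norm u powr p" by (intro mult_right_mono) auto
  let ?D = "discrete_eigenvalues A"
  have D: "?D \<subseteq> {0, u}" using spec by (auto simp: discrete_eigenvalues_def isolated_in_def)
  have "eigenvalue_power_sum p A = (\<Sum>\<mu>\<in>?D. eigenvalue_term p A \<mu>)"
    unfolding eigenvalue_power_sum_def by (rule infsum_finite) (rule finite_subset[OF D], simp)
  also have "\<dots> \<le> (\<Sum>\<mu>\<in>{0, u}. eigenvalue_term p A \<mu>)"
    by (rule sum_mono2[OF _ D]) (auto simp: eigenvalue_term_def)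
  also have "\<dots> \<le> norm u powr p" using u mult by (simp add: eigenvalue_term_def)
  finally show ?thesis by (simp only: A_def Q_def)
qed

context lp_ideal_det
begin

text \<open>
  The Weierstrass factor is the regularized determinant of a multiple of a rank one projection, to which the
  assumption on \<open>\<Gamma>\<close> applies. A rank one projection exists as soon as there is a nonzero operator of finite
  rank.
\<close>

lemma weierstrass_factor_le_exp:
  assumes F: "F \<in> FR" "F \<noteq> 0"
  shows "norm (weierstrass_factor (reg_order p) u) \<le> exp (\<Gamma> * norm u powr p)"
proof (cases "u = 0")
  case True
  then show ?thesis by simp
next
  case False
  obtain bs where bs: "basis_list bs" "lspan bs = range (blinfun_apply F)" by (rule finite_rank_opsE[OF F(1)])
  have "bs \<noteq> []"
  proof
    assume "bs = []"
    then have "F x = 0" for x using bs(2) by (auto simp: complex_vs.span_empty)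
    then show False using F(2) by (auto intro: blinfun_eqI)
  qed
  then have len: "0 < length bs" by simp
  have "bs ! 0 \<in> range (blinfun_apply F)" unfolding bs(2)[symmetric] using len by (intro complex_vs.span_base) simp
  then obtain b where b: "bs ! 0 = F b" by blast
  define \<phi> where "\<phi> = (\<lambda>x. coord bs 0 (F x))"
  have \<phi>: "cfunctional \<phi>" unfolding \<phi>_def
    by (rule cfunctional_coord[OF bs(1) finite_rank_bounded_ops[OF F(1)] equalityD2[OF bs(2)] len])
  have \<phi>b: "\<phi> b = 1" using coord_nth[OF bs(1) len len] by (simp add: \<phi>_def b)
  have "u *\<^sub>C rank_one \<phi> b \<in> FR"
  proof (intro finite_rank_ops_scaleC finite_rank_opsI)
    show "rank_one \<phi> b \<in> bounded_ops" by (rule rank_one_bounded_ops[OF \<phi>])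
    show "range (blinfun_apply (rank_one \<phi> b)) \<subseteq> complex_vs.span {b}"
      by (auto simp: rank_one_apply[OF \<phi>] intro: complex_vs.span_scale complex_vs.span_base)
  qed simp
  then have "norm (weierstrass_factor (reg_order p) u) \<le> exp (\<Gamma> * eigenvalue_power_sum p (u *\<^sub>C rank_one \<phi> b))"
    using det_bound detp_rank_one[OF \<phi> \<phi>b] by metis
  also have "\<dots> \<le> exp (\<Gamma> * norm u powr p)"
    using eigenvalue_power_sum_rank_one[OF \<phi> \<phi>b False] \<Gamma> by (simp add: mult_left_mono)
  finally show ?thesis .
qed

text \<open>
  The map \<open>a \<mapsto> 1 / a\<close> injects the zeros of \<open>z \<mapsto> Dext(z L)\<close> into the discrete eigenvalues.
\<close>

lemma zeros_sum_le:
  assumes L: "L \<in> J" and Z: "finite Z" "Z \<subseteq> {a. Dext (a *\<^sub>C L) = 0}"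
  shows "(\<Sum>a\<in>Z. nat (zorder (\<lambda>z. Dext (z *\<^sub>C L)) a) * norm a powr (-p)) \<le> eigenvalue_power_sum p L"
proof -
  have D0: "Dext (a *\<^sub>C L) = 0" if "a \<in> Z" for a using Z(2) that by blast
  have "(\<Sum>a\<in>Z. nat (zorder (\<lambda>z. Dext (z *\<^sub>C L)) a) * norm a powr (-p)) \<le> (\<Sum>a\<in>Z. eigenvalue_term p L (inverse a))"
  proof (rule sum_mono)
    fix a assume a: "a \<in> Z"
    have "norm (inverse a) powr p = norm a powr (-p)" by (simp add: norm_inverse powr_minus inverse_powr)
    moreover have "real (nat (zorder (\<lambda>z. Dext (z *\<^sub>C L)) a)) \<le> real (alg_multiplicity L (inverse a))"
      using zero_of_Dext_eigenvalue(2)[OF L D0[OF a]] by simp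
    ultimately show "nat (zorder (\<lambda>z. Dext (z *\<^sub>C L)) a) * norm a powr (-p) \<le> eigenvalue_term p L (inverse a)"
      unfolding eigenvalue_term_def by (simp only: mult_right_mono powr_ge_zero)
  qed
  also have "\<dots> = (\<Sum>\<mu>\<in>inverse ` Z. eigenvalue_term p L \<mu>)"
    by (subst sum.reindex) (auto simp: inj_on_def)
  also have "\<dots> \<le> eigenvalue_power_sum p L"
    unfolding eigenvalue_power_sum_def
  proof (rule finite_sum_le_infsum[OF eigenvalue_sum(1)[OF L]])
    show "inverse ` Z \<subseteq> discrete_eigenvalues L" using zero_of_Dext_eigenvalue(1)[OF L D0] by blast
  qed (use Z in \<open>auto simp: eigenvalue_term_def\<close>)
  finally show ?thesis .
qed

text \<open>
  \<open>entire_bound_by_zeros\<close> for \<open>z \<mapsto> Dext(z L)\<close>. If \<open>0\<close> is the only operator of finite rank, then all approximants vanish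
  and \<open>Dext L = 1\<close>.
\<close>

lemma Dext_eigenvalue_bound:
  assumes L: "L \<in> J"
  shows "cmod (Dext L) \<le> exp (\<Gamma> * eigenvalue_power_sum p L)"
proof (cases "\<exists>F\<in>FR. F \<noteq> 0")
  case True
  then obtain F where F: "F \<in> FR" "F \<noteq> 0" by blast
  have "norm (Dext (1 *\<^sub>C L)) \<le> exp (\<Gamma> * eigenvalue_power_sum p L)"
    by (rule entire_bound_by_zeros[OF Dext_scale_holomorphic[OF L] p reg_order[OF p] less_imp_le[OF \<Gamma>]
          Dext_one_plus_O[OF L] Dext_minimal_type[OF L] zeros_sum_le[OF L] weierstrass_factor_le_exp[OF F]])
  then show ?thesis by (simp add: scaleC_one)
next
  case False
  then have "approximant L n = 0" for n using approximant(1)[OF L] by blast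
  then have "Dext L = 1" using Dext_lim[OF L] by (simp add: detp_zero LIMSEQ_const_iff)
  moreover have "0 \<le> \<Gamma> * eigenvalue_power_sum p L"
    using eigenvalue_power_sum_nonneg \<Gamma> by (intro mult_nonneg_nonneg) auto
  ultimately show ?thesis by simp
qed

lemma Dext_bound: "L \<in> J \<Longrightarrow> cmod (Dext L) \<le> exp (growth_const * N L powr p)"
  using order_trans[OF Dext_eigenvalue_bound] eigenvalue_sum_bound by (meson exp_le_cancel_iff order_trans)

lemma Dext_lipschitz:
  assumes "K \<in> J" "L \<in> J"
  shows "cmod (Dext K - Dext L) \<le> N (K - L) * segment_bound (N K + N L + 1)"
  by (rule lipschitz_of_line_bound[OF order_refl J_subspace assms Dext_bound Dext_line_holomorphic])
    (use assms J_diff in auto)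

lemma segment_bound_eq:
  assumes "x \<ge> 0" shows "segment_bound x = exp (q powr (2 * p) * \<gamma> powr p * \<Gamma> * x powr p)"
proof -
  have "(q\<^sup>2 * x) powr p = (q powr 2) powr p * x powr p"
    using assms q1 by (simp add: powr_mult powr_numeral)
  then show ?thesis by (simp add: segment_bound_def growth_const_def powr_powr mult_ac)
qed

end

theorem theorem4p3:
  fixes J :: "('a::cbanach \<Rightarrow>\<^sub>L 'a) set"
    and N :: "('a \<Rightarrow>\<^sub>L 'a) \<Rightarrow> real"
    and p q \<gamma> \<Gamma> :: real
  assumes "p > 0"
    and "lp_ideal p q \<gamma> J N"
    and "\<Gamma> > 0"
    and "\<forall>F \<in> (finite_rank_ops :: ('a \<Rightarrow>\<^sub>L 'a) set).
           cmod (detp_one_minus p F) \<le> exp (\<Gamma> * eigenvalue_power_sum p F)"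
  shows "(\<exists>!D. is_regularized_det p J N D) \<and>
    (\<forall>D. is_regularized_det p J N D \<longrightarrow>
      (\<forall>L\<in>J. cmod (D L) \<le> exp (\<gamma> powr p * \<Gamma> * N L powr p)) \<and>
      (\<forall>K\<in>J. \<forall>L\<in>J. cmod (D K - D L)
         \<le> N (K - L) * exp (q powr (2 * p) * \<gamma> powr p * \<Gamma> * (N K + N L + 1) powr p)))"
proof -
  interpret lp_ideal_det J N p q \<gamma> \<Gamma> using assms by unfold_locales
  have "cmod (D L) \<le> exp (\<gamma> powr p * \<Gamma> * N L powr p)"
    if "is_regularized_det p J N D" "L \<in> J" for D L
    using Dext_bound[OF that(2)] regularized_det_unique[OF that(1)] by (simp add: growth_const_def)
  moreover have "cmod (D K - D L) \<le> N (K - L) * exp (q powr (2 * p) * \<gamma> powr p * \<Gamma> * (N K + N L + 1) powr p)"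
    if "is_regularized_det p J N D" "K \<in> J" "L \<in> J" for D K L
    using Dext_lipschitz[OF that(2,3)] regularized_det_unique[OF that(1)]
      segment_bound_eq[of "N K + N L + 1"] N_nonneg[OF that(2)] N_nonneg[OF that(3)] by simp
  moreover have "\<exists>!D. is_regularized_det p J N D"
    using Dext_regularized regularized_det_unique by (rule ex1I)
  ultimately show ?thesis by blast
qed

end
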